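(* Suppose there is a randomized polynomial-time algorithm that, on input a formula $F(X,Y)$ such that $\forall X\,\exists Y\,F(X,Y)$ is a tautology and in which $y_i\in Y$ is uniquely defined in terms of $(X,Y^{1:i-1})$ by a circuit of size polynomial in $|F|$, returns a Skolem function for $y_i$. Then $\mathrm{NP}=\mathrm{RP}$.
   Context: $F(X,Y)$ is a Boolean formula over input variables $X=\{X_1,\dots,X_n\}$ (possibly $n=0$) and output variables $Y=\{Y_1,\dots,Y_m\}$ (here $y_i$ denotes $Y_i$); $|F|$ is its size; $Y^{1:i-1}=\{Y_1,\dots,Y_{i-1}\}$. For $Z\subseteq (X\cup Y)\setminus\{Y_i\}$, the variable $Y_i$ is uniquely defined in terms of $Z$ if $F(X,Y)\wedge F(\hat X,\hat Y)\wedge (Z=\hat Z)\implies Y_i=\hat Y_i$ holds, where $\hat X,\hat Y$ are fresh copies of $X,Y$ and $\hat Z$ is the corresponding copy of $Z$. It is uniquely defined in terms of $(X,Y^{1:i-1})$ by a circuit of size $s$ if there is a circuit of size $s$ computing $Y_i$ from $(X,Y^{1:i-1})$ on all satisfying assignments of $F$. Skolem functions for $F$ are Boolean functions $\Psi=\langle\psi_1,\dots,\psi_m\rangle$ such that $\exists Y\,F(X,Y)\equiv F(X,\Psi(X))$; $\psi_i$ is the Skolem function for $Y_i$, and $\psi_i$ may be written in terms of other $Y$ variables provided there are no cyclic dependencies. For $Y_i$ uniquely defined in terms of $(X,Y^{1:i-1})$, a Skolem function for $Y_i$ is a circuit on $(X,Y^{1:i-1})$ that agrees with $Y_i$ on all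 satisfying assignments of $F$. *)

theory Defs
  imports "HOL-Probability.Probability" "HOL-Computational_Algebra.Polynomial"
begin

section \<open>Polynomial time, NP and RP\<close>

text \<open>
  The machine model is the deterministic multi-tape Turing machine with two-way infinite tapes.
  Symbol 0 is the blank, symbols 1 and 2 stand for the bits 0 and 1. Tape 0 initially holds the
  input, tape 1 an auxiliary bit string (the certificate of a verifier, or the coin tosses of a
  randomized machine), and the result is read off tape 2; there may be further work tapes.
  The states are \<open>0, \<dots>, num_states\<close>, where 0 is initial and \<open>num_states\<close> is the halting state.
\<close>

datatype dir = MoveLeft | Stay | MoveRight

fun offset :: "dir \<Rightarrow> int" where
  "offset MoveLeft = -1"
| "offset Stay = 0"
| "offset MoveRight = 1"

record tm =
  num_tapes :: nat
  num_syms :: nat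
  num_states :: nat
  delta :: "nat \<Rightarrow> nat list \<Rightarrow> nat \<times> (nat \<times> dir) list"

text \<open>
  Only the finitely many values of \<^const>\<open>delta\<close> on non-halting states and on lists of
  \<open>num_tapes\<close> symbols below \<open>num_syms\<close> matter for a computation.
\<close>

definition wf_tm :: "tm \<Rightarrow> bool" where
  "wf_tm M \<longleftrightarrow> 3 \<le> num_tapes M \<and> 3 \<le> num_syms M \<and>
     (\<forall>q < num_states M. \<forall>ss. length ss = num_tapes M \<and> set ss \<subseteq> {..<num_syms M} \<longrightarrow>
        fst (delta M q ss) \<le> num_states M \<and>
        length (snd (delta M q ss)) = num_tapes M \<and>
        fst ` set (snd (delta M q ss)) \<subseteq> {..<num_syms M})"

type_synonym tape = "(int \<Rightarrow> nat) \<times> int"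
type_synonym config = "nat \<times> tape list"

definition read_tape :: "tape \<Rightarrow> nat" where
  "read_tape t = fst t (snd t)"

definition act_tape :: "tape \<Rightarrow> nat \<times> dir \<Rightarrow> tape" where
  "act_tape t a = ((fst t)(snd t := fst a), snd t + offset (snd a))"

definition step :: "tm \<Rightarrow> config \<Rightarrow> config" where
  "step M c = (if fst c = num_states M then c
     else (let a = delta M (fst c) (map read_tape (snd c))
           in (fst a, map2 act_tape (snd c) (snd a))))"

definition contents :: "bool list \<Rightarrow> int \<Rightarrow> nat" where
  "contents x j = (if 0 \<le> j \<and> j < int (length x) then (if x ! nat j then 2 else 1) else 0)"

definition init :: "tm \<Rightarrow> bool list \<Rightarrow> bool list \<Rightarrow> config" where
  "init M x r = (0, (contents x, 0) # (contents r, 0) #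
     replicate (num_tapes M - 2) (contents [], 0))"

text \<open>Halting configurations are fixed points of \<^const>\<open>step\<close>, so \<open>t\<close> is an upper bound on
  the running time.\<close>

definition computes_within :: "tm \<Rightarrow> bool list \<Rightarrow> bool list \<Rightarrow> nat \<Rightarrow> bool list \<Rightarrow> bool" where
  "computes_within M x r t out \<longleftrightarrow>
     (let c = (step M ^^ t) (init M x r)
      in fst c = num_states M \<and> fst (snd c ! 2) = contents out)"

definition polytime :: "(bool list \<Rightarrow> bool list \<Rightarrow> bool list) \<Rightarrow> bool" where
  "polytime f \<longleftrightarrow> (\<exists>M (p :: nat poly). wf_tm M \<and>
     (\<forall>x r. computes_within M x r (poly p (length x + length r)) (f x r)))"

definition NP :: "bool list set set" where
  "NP = {L. \<exists>V (p :: nat poly). polytime V \<and>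
     (\<forall>x. x \<in> L \<longleftrightarrow> (\<exists>w. length w = poly p (length x) \<and> V x w = [True]))}"

definition coins :: "nat \<Rightarrow> bool list pmf" where
  "coins k = pmf_of_set {r. length r = k}"

text \<open>A randomized polynomial-time algorithm, given by its output distribution on each input.\<close>

definition rand_polytime :: "(bool list \<Rightarrow> bool list pmf) \<Rightarrow> bool" where
  "rand_polytime A \<longleftrightarrow> (\<exists>f (p :: nat poly). polytime f \<and>
     (\<forall>x. A x = map_pmf (f x) (coins (poly p (length x)))))"

definition RP :: "bool list set set" where
  "RP = {L. \<exists>A. rand_polytime A \<and>
     (\<forall>x. (x \<in> L \<longrightarrow> pmf (A x) [True] \<ge> 1 / 2) \<and> (x \<notin> L \<longrightarrow> pmf (A x) [True] = 0))}"


section \<open>Formulas and circuits\<close>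

text \<open>Variables carry the indices \<open>X 1, \<dots>, X n\<close> and \<open>Y 1, \<dots>, Y m\<close>.\<close>

datatype var = X nat | Y nat

fun var_val :: "(nat \<Rightarrow> bool) \<Rightarrow> (nat \<Rightarrow> bool) \<Rightarrow> var \<Rightarrow> bool" where
  "var_val x y (X j) = x j"
| "var_val x y (Y j) = y j"

datatype form = FVar var | FNot form | FAnd form form | FOr form form

fun form_val :: "form \<Rightarrow> (nat \<Rightarrow> bool) \<Rightarrow> (nat \<Rightarrow> bool) \<Rightarrow> bool" where
  "form_val (FVar v) x y = var_val x y v"
| "form_val (FNot F) x y = (\<not> form_val F x y)"
| "form_val (FAnd F G) x y = (form_val F x y \<and> form_val G x y)"
| "form_val (FOr F G) x y = (form_val F x y \<or> form_val G x y)"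

fun vars :: "form \<Rightarrow> var set" where
  "vars (FVar v) = {v}"
| "vars (FNot F) = vars F"
| "vars (FAnd F G) = vars F \<union> vars G"
| "vars (FOr F G) = vars F \<union> vars G"

fun fsize :: "form \<Rightarrow> nat" where
  "fsize (FVar v) = 1"
| "fsize (FNot F) = fsize F + 1"
| "fsize (FAnd F G) = fsize F + fsize G + 1"
| "fsize (FOr F G) = fsize F + fsize G + 1"

definition all_vars :: "nat \<Rightarrow> nat \<Rightarrow> var set" where
  "all_vars n m = X ` {1..n} \<union> Y ` {1..m}"

text \<open>
  A circuit is a list of gates in topological order; gates refer to earlier gates by their
  (0-based) position, and the last gate is the output.
\<close>

datatype gate = GConst bool | GVar var | GNot nat | GAnd nat nat | GOr nat nat

type_synonym circuit = "gate list"

fun gate_preds :: "gate \<Rightarrow> nat set" where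
  "gate_preds (GConst b) = {}"
| "gate_preds (GVar v) = {}"
| "gate_preds (GNot j) = {j}"
| "gate_preds (GAnd j k) = {j, k}"
| "gate_preds (GOr j k) = {j, k}"

fun gate_vars :: "gate \<Rightarrow> var set" where
  "gate_vars (GVar v) = {v}"
| "gate_vars _ = {}"

definition circuit_on :: "var set \<Rightarrow> circuit \<Rightarrow> bool" where
  "circuit_on Z C \<longleftrightarrow> C \<noteq> [] \<and>
     (\<forall>j < length C. gate_vars (C ! j) \<subseteq> Z \<and> gate_preds (C ! j) \<subseteq> {..<j})"

fun gate_val :: "(nat \<Rightarrow> bool) \<Rightarrow> (nat \<Rightarrow> bool) \<Rightarrow> bool list \<Rightarrow> gate \<Rightarrow> bool" where
  "gate_val x y ws (GConst b) = b"
| "gate_val x y ws (GVar v) = var_val x y v"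
| "gate_val x y ws (GNot j) = (\<not> ws ! j)"
| "gate_val x y ws (GAnd j k) = (ws ! j \<and> ws ! k)"
| "gate_val x y ws (GOr j k) = (ws ! j \<or> ws ! k)"

definition circuit_val :: "circuit \<Rightarrow> (nat \<Rightarrow> bool) \<Rightarrow> (nat \<Rightarrow> bool) \<Rightarrow> bool" where
  "circuit_val C x y = last (foldl (\<lambda>ws g. ws @ [gate_val x y ws g]) [] C)"

text \<open>\<open>C\<close> is a circuit on \<open>X\<^sub>1, \<dots>, X\<^sub>n, Y\<^sub>1, \<dots>, Y\<^sub>i\<^sub>-\<^sub>1\<close> that agrees with \<open>Y\<^sub>i\<close> on all satisfying
  assignments of \<open>F\<close>.\<close>

definition skolem_circuit :: "nat \<Rightarrow> form \<Rightarrow> nat \<Rightarrow> circuit \<Rightarrow> bool" where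
  "skolem_circuit n F i C \<longleftrightarrow> circuit_on (all_vars n (i - 1)) C \<and>
     (\<forall>x y. form_val F x y \<longrightarrow> circuit_val C x y = y i)"

definition uniquely_defined_by_size :: "nat \<Rightarrow> form \<Rightarrow> nat \<Rightarrow> nat \<Rightarrow> bool" where
  "uniquely_defined_by_size n F i s \<longleftrightarrow> (\<exists>C. length C = s \<and> skolem_circuit n F i C)"


section \<open>Encoding of inputs and outputs\<close>

text \<open>Prefix-free binary encodings; all indices are written in unary.\<close>

definition enc_nat :: "nat \<Rightarrow> bool list" where
  "enc_nat k = replicate k True @ [False]"

fun enc_var :: "var \<Rightarrow> bool list" where
  "enc_var (X j) = False # enc_nat j"
| "enc_var (Y j) = True # enc_nat j"

fun enc_form :: "form \<Rightarrow> bool list" where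
  "enc_form (FVar v) = enc_nat 0 @ enc_var v"
| "enc_form (FNot F) = enc_nat 1 @ enc_form F"
| "enc_form (FAnd F G) = enc_nat 2 @ enc_form F @ enc_form G"
| "enc_form (FOr F G) = enc_nat 3 @ enc_form F @ enc_form G"

definition enc_instance :: "nat \<Rightarrow> nat \<Rightarrow> form \<Rightarrow> nat \<Rightarrow> bool list" where
  "enc_instance n m F i = enc_nat n @ enc_nat m @ enc_nat i @ enc_form F"

fun enc_gate :: "gate \<Rightarrow> bool list" where
  "enc_gate (GConst b) = enc_nat 0 @ [b]"
| "enc_gate (GVar v) = enc_nat 1 @ enc_var v"
| "enc_gate (GNot j) = enc_nat 2 @ enc_nat j"
| "enc_gate (GAnd j k) = enc_nat 3 @ enc_nat j @ enc_nat k"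
| "enc_gate (GOr j k) = enc_nat 4 @ enc_nat j @ enc_nat k"

definition enc_circuit :: "circuit \<Rightarrow> bool list" where
  "enc_circuit C = concat (map enc_gate C)"

lemma enc_nat_prefix_free: "enc_nat a @ u = enc_nat b @ v \<longleftrightarrow> a = b \<and> u = v"
proof (induction a arbitrary: b)
  case 0
  show ?case by (cases b) (auto simp: enc_nat_def)
next
  case (Suc a)
  then show ?case by (cases b) (auto simp: enc_nat_def)
qed

lemma enc_var_prefix_free: "enc_var a @ u = enc_var b @ v \<longleftrightarrow> a = b \<and> u = v"
  by (cases a; cases b) (auto simp: enc_nat_prefix_free)

lemma enc_form_prefix_free: "enc_form F @ u = enc_form G @ v \<longleftrightarrow> F = G \<and> u = v"
proof (induction F arbitrary: G u v)
  case (FVar w)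
  show ?case by (cases G) (simp_all add: enc_nat_prefix_free enc_var_prefix_free)
next
  case (FNot F)
  then show ?case by (cases G) (simp_all add: enc_nat_prefix_free)
next
  case (FAnd F1 F2)
  then show ?case by (cases G) (simp_all add: enc_nat_prefix_free)
next
  case (FOr F1 F2)
  then show ?case by (cases G) (simp_all add: enc_nat_prefix_free)
qed

lemma enc_instance_inject:
  "enc_instance n m F i = enc_instance n' m' F' i' \<longleftrightarrow> n = n' \<and> m = m' \<and> F = F' \<and> i = i'"
  using enc_form_prefix_free[of F "[]" F' "[]"]
  by (auto simp: enc_instance_def enc_nat_prefix_free)

lemma enc_gate_prefix_free: "enc_gate a @ u = enc_gate b @ v \<longleftrightarrow> a = b \<and> u = v"
  by (cases a; cases b) (simp_all add: enc_nat_prefix_free enc_var_prefix_free)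

lemma enc_circuit_inject: "enc_circuit C = enc_circuit D \<longleftrightarrow> C = D"
proof (induction C arbitrary: D)
  case Nil
  have "enc_gate g \<noteq> []" for g by (cases g) (simp_all add: enc_nat_def)
  then show ?case by (cases D) (auto simp: enc_circuit_def)
next
  case (Cons a C)
  have "enc_gate g \<noteq> []" for g by (cases g) (simp_all add: enc_nat_def)
  with Cons show ?case by (cases D) (auto simp: enc_circuit_def enc_gate_prefix_free)
qed

end

theory Submission
  imports Defs
begin

text \<open>
  A language in NP is decided with the help of the Skolem algorithm as follows. Random parity
  conditions on the witness (Valiant and Vazirani) leave exactly one witness \<open>w\<close> with probability at
  least 1/8, if their number is guessed correctly. The Cook-Levin tableau of the verifier for the
  language and the parity conditions is then a formula that determines \<open>w\<close>. Guessing
  the bits of \<open>w\<close> one by one from constant Skolem functions would be useless, as a random bit is right with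
  probability 1/2; instead the formula gets selector inputs \<open>X\<^sub>1, \<dots>, X\<^sub>m\<close> and the output
  \<open>Y\<^sub>1 = (\<Or>j. X\<^sub>j \<and> w\<^sub>j)\<close>. It is satisfiable for all \<open>X\<close>, the unique Skolem function for \<open>Y\<^sub>1\<close> has a circuit
  of linear size, and any circuit for it yields all bits of \<open>w\<close> by evaluation at unit vectors. The
  result is checked with the verifier, so that the error is one-sided, and the whole is repeated.

  To avoid programming Turing machines, functions are composed from a few operations that
  are closed under polynomial-time computability (composition and polynomially bounded
  unary recursion), which are compiled to machines through a small language of stack programs.
  Conversely a machine is viewed as a cellular automaton centred at its heads; this view serves both
  for simulating machines by such functions and for the tableau.
\<close>

section \<open>Stack programs\<close>

text \<open>Two constraints shape the construction. The promise of the Skolem algorithm concerns a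
  single output, and a circuit for that output may read the earlier outputs. The distinguished
  output is therefore \<open>Y 1\<close>: its circuits see only \<open>X\<close> and cannot copy
  witness bits. The tableau, in turn, may leave its own variables undetermined, so one-way
  implications are enough. If the number of conditions is guessed wrongly or isolation fails, the
  formula can violate the promise and the answer is arbitrary. The circuit with the witness
  hard-wired has size at most \<open>2 * m + 1\<close> and the formula has size at least
  \<open>m\<close>, so the promise holds with the polynomial 1 + 2n. Isolation (1/8) and the
  algorithm (1/2) succeed together with probability at least 1/16, and twelve independent rounds all
  fail with probability at most (15/16)^12 < 1/2. Since \<open>polytime\<close> speaks of concrete
  machines, the given machines must become composable functions and the composed functions must
  become machines again; hence the two translations.\<close>

datatype com = Skip | Push nat nat | Pop nat | Seq com com | If nat nat com com | While nat com

type_synonym store = "nat \<Rightarrow> nat list"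

definition top_sym :: "nat list \<Rightarrow> nat" where
  "top_sym s = (case s of [] \<Rightarrow> 0 | a # _ \<Rightarrow> a)"

text \<open>A tape shows only the symbol under its head, so an empty stack and a stack with 0 on top
  look alike; popping does nothing in either case.\<close>

definition pop_sym :: "nat list \<Rightarrow> nat list" where
  "pop_sym s = (if top_sym s = 0 then s else tl s)"

text \<open>The number in the third place is an upper bound on the number of steps of the compiled machine.\<close>

inductive ex :: "com \<Rightarrow> store \<Rightarrow> nat \<Rightarrow> store \<Rightarrow> bool" where
  ex_Skip: "ex Skip s 0 s"
| ex_Push: "ex (Push r a) s 2 (s(r := a # s r))"
| ex_Pop: "ex (Pop r) s 1 (s(r := pop_sym (s r)))"
| ex_Seq: "ex c s t s' \<Longrightarrow> ex d s' u s'' \<Longrightarrow> ex (Seq c d) s (t + u) s''"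
| ex_IfT: "top_sym (s r) = a \<Longrightarrow> ex c s t s' \<Longrightarrow> ex (If r a c d) s (Suc t) s'"
| ex_IfF: "top_sym (s r) \<noteq> a \<Longrightarrow> ex d s t s' \<Longrightarrow> ex (If r a c d) s (Suc t) s'"
| ex_WhileF: "top_sym (s r) = 0 \<Longrightarrow> ex (While r c) s 1 s"
| ex_WhileT: "top_sym (s r) \<noteq> 0 \<Longrightarrow> ex c s t s' \<Longrightarrow> ex (While r c) s' u s'' \<Longrightarrow>
    ex (While r c) s (Suc t + u) s''"
| ex_mono: "ex c s t s' \<Longrightarrow> t \<le> u \<Longrightarrow> ex c s u s'"

primrec wfc :: "nat \<Rightarrow> nat \<Rightarrow> com \<Rightarrow> bool" where
  "wfc K S Skip = True"
| "wfc K S (Push r a) = (r < K \<and> a < S)"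
| "wfc K S (Pop r) = (r < K)"
| "wfc K S (Seq c d) = (wfc K S c \<and> wfc K S d)"
| "wfc K S (If r a c d) = (r < K \<and> wfc K S c \<and> wfc K S d)"
| "wfc K S (While r c) = (r < K \<and> wfc K S c)"

lemma wfc_mono: "wfc K S c \<Longrightarrow> K \<le> K' \<Longrightarrow> S \<le> S' \<Longrightarrow> wfc K' S' c"
  by (induction c) auto

lemma wfc_exists: "\<exists>K S. wfc K S c"
proof (induction c)
  case (Push r a) show ?case by (rule exI[of _ "Suc r"], rule exI[of _ "Suc a"]) simp
next
  case (Pop r) show ?case by (rule exI[of _ "Suc r"]) simp
next
  case (Seq c d)
  then obtain K S K' S' where "wfc K S c" "wfc K' S' d" by blast
  then have "wfc (max K K') (max S S') (Seq c d)" by (auto intro: wfc_mono)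
  then show ?case by blast
next
  case (If r a c d)
  then obtain K S K' S' where "wfc K S c" "wfc K' S' d" by blast
  then have "wfc (Suc r + max K K') (max S S') (If r a c d)" by (auto intro: wfc_mono)
  then show ?case by blast
next
  case (While r c)
  then obtain K S where "wfc K S c" by blast
  then have "wfc (Suc r + K) S (While r c)" by (auto intro: wfc_mono)
  then show ?case by blast
qed simp

text \<open>No command adds symbols faster than it uses up steps, so every time bound is also a
  bound on the length of the result.\<close>

lemma ex_length: "ex c s t s' \<Longrightarrow> length (s' r) \<le> length (s r) + t"
  by (induction rule: ex.induct) (auto simp: pop_sym_def intro: le_trans)


section \<open>Compilation to Turing machines\<close>

text \<open>The states of a block are 0 to \<open>nst c\<close>, the last one being its exit. In
  \<open>Seq c d\<close> the exit of \<open>c\<close> is the start of \<open>d\<close>, so no state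
  is spent on the link, and \<open>Skip\<close> consists of its exit alone.\<close>

primrec nst :: "com \<Rightarrow> nat" where
  "nst Skip = 0"
| "nst (Push r a) = 2"
| "nst (Pop r) = 1"
| "nst (Seq c d) = nst c + nst d"
| "nst (If r a c d) = Suc (nst c + nst d)"
| "nst (While r c) = Suc (nst c)"

definition keep :: "nat list \<Rightarrow> (nat \<times> dir) list" where
  "keep ss = map (\<lambda>a. (a, Stay)) ss"

text \<open>Shifts a block with exit \<open>n\<close> behind a test state and diverts its exit to
  \<open>N\<close>: past the other branch for \<open>If\<close>, back to the test for
  \<open>While\<close>.\<close>

definition redir :: "nat \<Rightarrow> nat \<Rightarrow> nat \<Rightarrow> nat" where
  "redir n N q = (if q = n then N else Suc q)"

text \<open>A machine step writes before it moves. \<open>Push\<close> has to move to the free cell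
  first and so takes two steps, while \<open>Pop\<close> erases and moves in one.\<close>

primrec trans_of :: "com \<Rightarrow> nat \<Rightarrow> nat list \<Rightarrow> nat \<times> (nat \<times> dir) list" where
  "trans_of Skip q ss = (0, keep ss)"
| "trans_of (Push r a) q ss =
    (if q = 0 then (1, (keep ss)[r := (ss ! r, MoveRight)]) else (2, (keep ss)[r := (a, Stay)]))"
| "trans_of (Pop r) q ss = (1, if ss ! r = 0 then keep ss else (keep ss)[r := (0, MoveLeft)])"
| "trans_of (Seq c d) q ss =
    (if q < nst c then trans_of c q ss else apfst ((+) (nst c)) (trans_of d (q - nst c) ss))"
| "trans_of (If r a c d) q ss =
    (if q = 0 then (if ss ! r = a then redir (nst c) (Suc (nst c + nst d)) 0 else Suc (nst c), keep ss)
     else if q < Suc (nst c) then apfst (redir (nst c) (Suc (nst c + nst d))) (trans_of c (q - 1) ss)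
     else apfst ((+) (Suc (nst c))) (trans_of d (q - Suc (nst c)) ss))"
| "trans_of (While r c) q ss =
    (if q = 0 then (if ss ! r = 0 then Suc (nst c) else redir (nst c) 0 0, keep ss)
     else apfst (redir (nst c) 0) (trans_of c (q - 1) ss))"

definition compile :: "nat \<Rightarrow> nat \<Rightarrow> com \<Rightarrow> tm" where
  "compile K S c = \<lparr>num_tapes = K, num_syms = S, num_states = nst c, delta = trans_of c\<rparr>"

lemma trans_of_wf:
  "wfc K S c \<Longrightarrow> 0 < S \<Longrightarrow> q < nst c \<Longrightarrow> length ss = K \<Longrightarrow> set ss \<subseteq> {..<S} \<Longrightarrow>
   fst (trans_of c q ss) \<le> nst c \<and> length (snd (trans_of c q ss)) = K \<and>
   fst ` set (snd (trans_of c q ss)) \<subseteq> {..<S}"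
proof (induction c arbitrary: q)
  case (Push r a)
  have "fst ` set ((keep ss)[r := x]) \<subseteq> {..<S}" if "fst x < S" for x :: "nat \<times> dir"
    using that Push set_update_subset_insert[of "keep ss" r x] by (force simp: keep_def)
  moreover have "ss ! r < S" using Push nth_mem by fastforce
  ultimately show ?case using Push by (simp add: keep_def)
next
  case (Pop r)
  have "fst ` set ((keep ss)[r := x]) \<subseteq> {..<S}" if "fst x < S" for x :: "nat \<times> dir"
    using that Pop set_update_subset_insert[of "keep ss" r x] by (force simp: keep_def)
  then show ?case using Pop by (auto simp: keep_def)
next
  case (Seq c d)
  show ?case
  proof (cases "q < nst c")
    case True
    then show ?thesis using Seq.IH(1)[of q] Seq.prems by auto
  next
    case False
    then show ?thesis using Seq.IH(2)[of "q - nst c"] Seq.prems by auto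
  qed
next
  case (If r a c d)
  consider "q = 0" | "q \<noteq> 0" "q < Suc (nst c)" | "q \<noteq> 0" "\<not> q < Suc (nst c)" by blast
  then show ?case
  proof cases
    case 1 then show ?thesis using If.prems by (auto simp: keep_def redir_def)
  next
    case 2 then show ?thesis using If.IH(1)[of "q - 1"] If.prems by (auto simp: redir_def intro: trans_le_add1)
  next
    case 3 then show ?thesis using If.IH(2)[of "q - Suc (nst c)"] If.prems by auto
  qed
next
  case (While r c)
  show ?case
  proof (cases "q = 0")
    case True then show ?thesis using While.prems by (auto simp: keep_def redir_def)
  next
    case False then show ?thesis using While.IH[of "q - 1"] While.prems by (auto simp: redir_def)
  qed
qed simp

lemma wf_compile: "wfc K S c \<Longrightarrow> 3 \<le> K \<Longrightarrow> 3 \<le> S \<Longrightarrow> wf_tm (compile K S c)"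
  unfolding wf_tm_def compile_def using trans_of_wf[of K S c] by simp

lemma trans_of_le: "q < nst c \<Longrightarrow> fst (trans_of c q ss) \<le> nst c"
proof (induction c arbitrary: q)
  case (Seq c d)
  then show ?case using Seq.IH(1)[of q] Seq.IH(2)[of "q - nst c"]
    by (cases "q < nst c") (auto intro: trans_le_add1)
next
  case (If r a c d)
  then show ?case using If.IH(1)[of "q - 1"] If.IH(2)[of "q - Suc (nst c)"]
    by (cases "q < Suc (nst c)") (auto simp: redir_def intro: trans_le_add1)
next
  case (While r c)
  then show ?case using While.IH[of "q - 1"] by (auto simp: redir_def)
qed auto

lemma funpow_halted: "fst c = num_states M \<Longrightarrow> (step M ^^ t) c = c"
  by (induction t) (simp_all add: step_def)

text \<open>Only \<open>t' \<le> t\<close> can be claimed: \<open>M\<close> idles in its halting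
  state, whereas \<open>N\<close> goes on from \<open>f (num_states M)\<close>, which need not be
  halting. This is what allows a block to be followed by further code.\<close>

lemma embed_run:
  assumes "\<And>q ss. q < num_states M \<Longrightarrow> delta N (f q) ss = apfst f (delta M q ss)"
    and "\<And>q. q < num_states M \<Longrightarrow> f q \<noteq> num_states N"
    and "\<And>q ss. q < num_states M \<Longrightarrow> fst (delta M q ss) \<le> num_states M"
  shows "q \<le> num_states M \<Longrightarrow> (step M ^^ t) (q, ts) = (num_states M, ts') \<Longrightarrow>
    \<exists>t'\<le>t. (step N ^^ t') (f q, ts) = (f (num_states M), ts')"
proof (induction t arbitrary: q ts)
  case 0
  then show ?case by auto
next
  case (Suc t)
  show ?case
  proof (cases "q = num_states M")
    case True
    then have "(q, ts) = (num_states M, ts')" using Suc.prems funpow_halted[of "(q, ts)" M "Suc t"] by simp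
    then show ?thesis using True by (intro exI[of _ 0]) simp
  next
    case False
    then have q: "q < num_states M" using Suc.prems by simp
    define q1 ts1 where "q1 = fst (step M (q, ts))" and "ts1 = snd (step M (q, ts))"
    have s: "step M (q, ts) = (q1, ts1)" by (simp add: q1_def ts1_def)
    have "q1 \<le> num_states M" using assms(3)[OF q] q by (simp add: q1_def step_def Let_def)
    moreover have "(step M ^^ t) (q1, ts1) = (num_states M, ts')"
      using Suc.prems(2) s by (simp del: funpow.simps add: funpow_Suc_right)
    ultimately obtain t' where t': "t' \<le> t" "(step N ^^ t') (f q1, ts1) = (f (num_states M), ts')"
      using Suc.IH by blast
    have "step N (f q, ts) = (f q1, ts1)"
      using q assms(1)[OF q] assms(2)[OF q] by (simp add: q1_def ts1_def step_def Let_def)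
    then have "(step N ^^ Suc t') (f q, ts) = (f (num_states M), ts')"
      using t'(2) by (simp del: funpow.simps add: funpow_Suc_right)
    then show ?thesis using t'(1) by (intro exI[of _ "Suc t'"]) simp
  qed
qed

text \<open>The bottom of a stack lies at position 0 and the head is on its top, so that the head of an
  empty stack is at position \<open>-1\<close>.\<close>

definition stack_tape :: "nat list \<Rightarrow> tape" where
  "stack_tape s = ((\<lambda>j. if 0 \<le> j \<and> j < int (length s) then rev s ! nat j else 0), int (length s) - 1)"

definition tapes :: "nat \<Rightarrow> store \<Rightarrow> tape list" where
  "tapes K s = map (\<lambda>r. stack_tape (s r)) [0..<K]"

lemma read_stack_tape: "read_tape (stack_tape s) = top_sym s"
  by (cases s) (auto simp: read_tape_def stack_tape_def top_sym_def nth_append nat_diff_distrib)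

lemma act_push1:
  "act_tape (act_tape (stack_tape s) (top_sym s, MoveRight)) (a, Stay) = stack_tape (a # s)"
proof -
  have "(fst (stack_tape s))(snd (stack_tape s) := top_sym s) = fst (stack_tape s)"
    using read_stack_tape[of s] fun_upd_triv[of "fst (stack_tape s)" "snd (stack_tape s)"]
    by (simp add: read_tape_def del: fun_upd_triv)
  then show ?thesis
    by (auto simp: act_tape_def stack_tape_def nth_append fun_eq_iff)
qed

lemma act_pop: "act_tape (stack_tape (a # s)) (0, MoveLeft) = stack_tape s"
  by (auto simp: act_tape_def stack_tape_def nth_append fun_eq_iff)

lemma map_read_tapes: "map read_tape (tapes K s) = map (\<lambda>r. top_sym (s r)) [0..<K]"
  by (simp add: tapes_def read_stack_tape)

lemma tapes_upd: "r < K \<Longrightarrow> tapes K (s(r := x)) = (tapes K s)[r := stack_tape x]"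
  by (rule nth_equalityI) (auto simp: tapes_def nth_list_update)

lemma map2_keep_gen: "map2 act_tape ts (keep (map read_tape ts)) = ts"
  by (rule nth_equalityI) (auto simp: keep_def act_tape_def read_tape_def)

lemma map2_upd: "r < length ts \<Longrightarrow>
   map2 act_tape ts ((keep (map read_tape ts))[r := x]) = ts[r := act_tape (ts ! r) x]"
  by (rule nth_equalityI)
    (auto simp: keep_def act_tape_def read_tape_def nth_list_update)

lemma compile_sel [simp]:
  "num_tapes (compile K S c) = K" "num_states (compile K S c) = nst c" "delta (compile K S c) = trans_of c"
  by (simp_all add: compile_def)

lemma funpow_trans: "(f ^^ t) x = y \<Longrightarrow> (f ^^ u) y = z \<Longrightarrow> (f ^^ (t + u)) x = z"
  by (simp add: add.commute[of t] funpow_add)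

text \<open>Induction on the execution, since a loop needs the result for its own remaining
  iterations. Each block is a copy of the machine of the subprogram, whose run
  \<open>embed_run\<close> transports; each test adds one step that leaves the tapes as they
  are.\<close>

theorem compile_correct:
  "ex c s t s' \<Longrightarrow> wfc K S c \<Longrightarrow>
   \<exists>t'\<le>t. (step (compile K S c) ^^ t') (0, tapes K s) = (nst c, tapes K s')"
proof (induction rule: ex.induct)
  case (ex_Skip s)
  then show ?case by simp
next
  case (ex_Push r a s)
  let ?M = "compile K S (Push r a)"
  let ?ts = "(tapes K s)[r := act_tape (tapes K s ! r) (top_sym (s r), MoveRight)]"
  have r: "r < K" using ex_Push by simp
  have tr: "tapes K s ! r = stack_tape (s r)" using r by (simp add: tapes_def)
  have len: "length (tapes K s) = K" by (simp add: tapes_def)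
  have "step ?M (0, tapes K s) = (1, ?ts)"
    using r by (simp add: step_def map2_upd len)
       (simp add: tr read_stack_tape)
  moreover have "step ?M (1, ?ts) = (2, ?ts[r := act_tape (?ts ! r) (a, Stay)])"
    using r by (simp only: step_def) (simp add: len map2_upd)
  moreover have "?ts[r := act_tape (?ts ! r) (a, Stay)] = tapes K (s(r := a # s r))"
    using r by (simp add: tapes_upd len tr act_push1)
  ultimately have "(step ?M ^^ 2) (0, tapes K s) = (2, tapes K (s(r := a # s r)))"
    by (simp only: numeral_2_eq_2 funpow.simps comp_apply id_apply One_nat_def)
  then show ?case by (intro exI[of _ 2]) (simp add: fun_upd_def)
next
  case (ex_Pop r s)
  have r: "r < K" using ex_Pop by simp
  have tr: "tapes K s ! r = stack_tape (s r)" using r by (simp add: tapes_def)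
  have len: "length (tapes K s) = K" by (simp add: tapes_def)
  have "step (compile K S (Pop r)) (0, tapes K s) = (1, tapes K (s(r := pop_sym (s r))))"
  proof (cases "top_sym (s r) = 0")
    case True
    then show ?thesis using r
      by (simp add: step_def len tr read_stack_tape map2_keep_gen pop_sym_def)
  next
    case False
    then obtain a u where "s r = a # u" by (cases "s r") (auto simp: top_sym_def)
    then show ?thesis using False r
      by (simp add: step_def len tr read_stack_tape map2_upd pop_sym_def act_pop tapes_upd)
  qed
  then show ?case by (intro exI[of _ 1]) (simp add: fun_upd_def)
next
  case (ex_Seq c s t s' d u s'')
  let ?M = "compile K S (Seq c d)"
  obtain t1 where t1: "t1 \<le> t" "(step (compile K S c) ^^ t1) (0, tapes K s) = (nst c, tapes K s')"
    using ex_Seq by auto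
  obtain u1 where u1: "u1 \<le> u" "(step (compile K S d) ^^ u1) (0, tapes K s') = (nst d, tapes K s'')"
    using ex_Seq by auto
  obtain t2 where t2: "t2 \<le> t1" "(step ?M ^^ t2) (0, tapes K s) = (nst c, tapes K s')"
    using embed_run[of "compile K S c" ?M "\<lambda>q. q" 0 t1 "tapes K s" "tapes K s'"] t1 trans_of_le
    by (auto simp: apfst_def map_prod_def split: prod.splits)
  obtain u2 where u2: "u2 \<le> u1" "(step ?M ^^ u2) (nst c, tapes K s') = (nst c + nst d, tapes K s'')"
    using embed_run[of "compile K S d" ?M "(+) (nst c)" 0 u1 "tapes K s'" "tapes K s''"] u1 trans_of_le
    by auto
  show ?case
    using funpow_trans[OF t2(2) u2(2)] t1 u1 t2 u2 by (intro exI[of _ "t2 + u2"]) simp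
next
  case (ex_IfT s r a c t s' d)
  let ?M = "compile K S (If r a c d)"
  let ?f = "redir (nst c) (Suc (nst c + nst d))"
  obtain t1 where t1: "t1 \<le> t" "(step (compile K S c) ^^ t1) (0, tapes K s) = (nst c, tapes K s')"
    using ex_IfT by auto
  have r: "r < K" using ex_IfT by simp
  have "map read_tape (tapes K s) ! r = a" using ex_IfT r by (simp add: map_read_tapes)
  then have st: "step ?M (0, tapes K s) = (?f 0, tapes K s)" by (simp add: step_def map2_keep_gen)
  obtain t2 where t2: "t2 \<le> t1" "(step ?M ^^ t2) (?f 0, tapes K s) = (?f (nst c), tapes K s')"
    using embed_run[of "compile K S c" ?M ?f 0 t1 "tapes K s" "tapes K s'"] t1 trans_of_le
    by (auto simp: redir_def)
  have "(step ?M ^^ Suc t2) (0, tapes K s) = (nst (If r a c d), tapes K s')"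
    using t2(2) st by (simp del: funpow.simps add: funpow_Suc_right) (simp add: redir_def)
  then show ?case using t1 t2 by (intro exI[of _ "Suc t2"]) simp
next
  case (ex_IfF s r a d t s' c)
  let ?M = "compile K S (If r a c d)"
  let ?f = "(+) (Suc (nst c))"
  obtain t1 where t1: "t1 \<le> t" "(step (compile K S d) ^^ t1) (0, tapes K s) = (nst d, tapes K s')"
    using ex_IfF by auto
  have r: "r < K" using ex_IfF by simp
  have "map read_tape (tapes K s) ! r \<noteq> a" using ex_IfF r by (simp add: map_read_tapes)
  then have st: "step ?M (0, tapes K s) = (?f 0, tapes K s)" by (simp add: step_def map2_keep_gen)
  obtain t2 where t2: "t2 \<le> t1" "(step ?M ^^ t2) (?f 0, tapes K s) = (?f (nst d), tapes K s')"
    using embed_run[of "compile K S d" ?M ?f 0 t1 "tapes K s" "tapes K s'"] t1 trans_of_le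
    by auto
  have "(step ?M ^^ Suc t2) (0, tapes K s) = (nst (If r a c d), tapes K s')"
    using t2(2) st by (simp del: funpow.simps add: funpow_Suc_right)
  then show ?case using t1 t2 by (intro exI[of _ "Suc t2"]) simp
next
  case (ex_WhileF s r c)
  have "map read_tape (tapes K s) ! r = 0" using ex_WhileF by (simp add: map_read_tapes)
  then have "step (compile K S (While r c)) (0, tapes K s) = (nst (While r c), tapes K s)"
    by (simp add: step_def map2_keep_gen)
  then show ?case by (intro exI[of _ 1]) simp
next
  case (ex_WhileT s r c t s' u s'')
  let ?M = "compile K S (While r c)"
  let ?f = "redir (nst c) 0"
  obtain t1 where t1: "t1 \<le> t" "(step (compile K S c) ^^ t1) (0, tapes K s) = (nst c, tapes K s')"
    using ex_WhileT by auto
  obtain u1 where u1: "u1 \<le> u" "(step ?M ^^ u1) (0, tapes K s') = (nst (While r c), tapes K s'')"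
    using ex_WhileT by auto
  have r: "r < K" using ex_WhileT by simp
  have "map read_tape (tapes K s) ! r \<noteq> 0" using ex_WhileT r by (simp add: map_read_tapes)
  then have st: "step ?M (0, tapes K s) = (?f 0, tapes K s)" by (simp add: step_def map2_keep_gen)
  obtain t2 where t2: "t2 \<le> t1" "(step ?M ^^ t2) (?f 0, tapes K s) = (?f (nst c), tapes K s')"
    using embed_run[of "compile K S c" ?M ?f 0 t1 "tapes K s" "tapes K s'"] t1 trans_of_le
    by (auto simp: redir_def)
  have "(step ?M ^^ Suc t2) (0, tapes K s) = (0, tapes K s')"
    using t2(2) st by (simp del: funpow.simps add: funpow_Suc_right) (simp add: redir_def)
  from funpow_trans[OF this u1(2)] show ?case using t1 t2 u1 by (intro exI[of _ "Suc t2 + u1"]) simp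
next
  case (ex_mono c s t s' u)
  then show ?case using le_trans by blast
qed

section \<open>Functions computed by stack programs in polynomial time\<close>

lemma poly_nat_mono: "m \<le> n \<Longrightarrow> poly (p :: nat poly) m \<le> poly p n"
  by (induction p) (auto intro: add_mono mult_mono)

definition pbd :: "(nat \<Rightarrow> nat) \<Rightarrow> bool" where
  "pbd f \<longleftrightarrow> (\<exists>p. \<forall>n. f n \<le> poly p n)"

lemma pbd_const [intro]: "pbd (\<lambda>n. c)"
  unfolding pbd_def by (rule exI[of _ "[:c:]"]) simp

lemma pbd_id [intro]: "pbd (\<lambda>n. n)"
  unfolding pbd_def by (rule exI[of _ "[:0, 1:]"]) simp

lemma pbd_add [intro]: "pbd f \<Longrightarrow> pbd g \<Longrightarrow> pbd (\<lambda>n. f n + g n)"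
  unfolding pbd_def by (metis add_mono poly_add)

lemma pbd_mult [intro]: "pbd f \<Longrightarrow> pbd g \<Longrightarrow> pbd (\<lambda>n. f n * g n)"
  unfolding pbd_def by (metis mult_le_mono poly_mult)

lemma pbd_Suc [intro]: "pbd f \<Longrightarrow> pbd (\<lambda>n. Suc (f n))"
  using pbd_add[of "\<lambda>_. 1" f] by auto

lemma pbd_poly [intro]: "pbd f \<Longrightarrow> pbd (\<lambda>n. poly p (f n))"
  unfolding pbd_def by (metis order_trans poly_nat_mono poly_pcompose)

lemma pbd_poly0 [intro]: "pbd (poly p)"
  unfolding pbd_def by blast

lemma pbd_sum [intro]: "(\<And>i. i < (l::nat) \<Longrightarrow> pbd (f i)) \<Longrightarrow> pbd (\<lambda>n. \<Sum>i<l. f i n)"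
  by (induction l) auto

section \<open>The class of functions computed by stack programs\<close>

type_synonym env = "nat \<Rightarrow> bool list"

definition bits :: "bool list \<Rightarrow> nat list" where
  "bits xs = map (\<lambda>b. if b then 2 else 1) xs"

lemma bits_simps [simp]: "bits [] = []" "bits (x # xs) = (if x then 2 else 1) # bits xs"
  "bits (xs @ ys) = bits xs @ bits ys" "length (bits xs) = length xs" "rev (bits xs) = bits (rev xs)"
  "bits (replicate n True) = replicate n 2"
  by (simp_all add: bits_def rev_map)

definition esize :: "nat \<Rightarrow> env \<Rightarrow> nat" where
  "esize k e = (\<Sum>i<k. length (e i))"

lemma esize_mono: "k \<le> k' \<Longrightarrow> esize k e \<le> esize k' e"
  unfolding esize_def by (rule sum_mono2) auto

text \<open>All registers from \<open>b\<close> on are empty before a call. As \<open>fpk\<close>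
  demands the store \<open>s(b := ...)\<close> after it, the scratch registers are emptied again and
  calls can be chained. The map \<open>rs\<close> may send several arguments to one
  register.\<close>

definition matches :: "nat \<Rightarrow> (nat \<Rightarrow> nat) \<Rightarrow> nat \<Rightarrow> store \<Rightarrow> env \<Rightarrow> bool" where
  "matches k rs b s e \<longleftrightarrow> (\<forall>i<k. s (rs i) = bits (e i)) \<and> (\<forall>r\<ge>b. s r = [])"

text \<open>The program may be chosen depending on the registers \<open>rs\<close> of the arguments and on the register
  \<open>b\<close> of the result; the registers beyond \<open>b\<close> serve as scratch space. No renaming of programs
  is needed in this way.\<close>

definition fpk :: "nat \<Rightarrow> (env \<Rightarrow> bool list) \<Rightarrow> bool" where
  "fpk k F \<longleftrightarrow> (\<forall>rs b. (\<forall>i<k. rs i < b) \<longrightarrow>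
     (\<exists>c p. \<forall>s e. matches k rs b s e \<longrightarrow> ex c s (poly p (esize k e)) (s(b := bits (F e)))))"

text \<open>Environments are infinite, but a program reads only the first \<open>k\<close> entries;
  hiding \<open>k\<close> frees the closure rules from arities.\<close>

definition fp :: "(env \<Rightarrow> bool list) \<Rightarrow> bool" where
  "fp F \<longleftrightarrow> (\<exists>k. fpk k F)"

lemma ex_cong: "ex c s t s' \<Longrightarrow> t \<le> u \<Longrightarrow> s' = s'' \<Longrightarrow> ex c s u s''"
  using ex_mono by blast

lemma ex_If: "ex (if top_sym (s r) = a then c else d) s t s' \<Longrightarrow> ex (If r a c d) s (Suc t) s'"
  by (auto intro: ex_IfT ex_IfF split: if_splits)

lemma fpkI:
  assumes "\<And>(rs :: nat \<Rightarrow> nat) b. (\<And>i. i < k \<Longrightarrow> rs i < b) \<Longrightarrow>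
    \<exists>c f. pbd f \<and> (\<forall>s e. matches k rs b s e \<longrightarrow> ex c s (f (esize k e)) (s(b := bits (F e))))"
  shows "fpk k F"
  unfolding fpk_def
proof (intro allI impI)
  fix rs :: "nat \<Rightarrow> nat" and b
  assume "\<forall>i<k. rs i < b"
  then obtain c f where "pbd f"
    and cf: "\<And>s e. matches k rs b s e \<Longrightarrow> ex c s (f (esize k e)) (s(b := bits (F e)))"
    using assms by blast
  from \<open>pbd f\<close> obtain p where p: "\<And>n. f n \<le> poly p n" unfolding pbd_def by blast
  show "\<exists>c p. \<forall>s e. matches k rs b s e \<longrightarrow> ex c s (poly p (esize k e)) (s(b := bits (F e)))"
    using ex_mono[OF cf p] by blast
qed

lemma fpkD:
  assumes "fpk k F" "\<And>i. i < k \<Longrightarrow> rs i < b"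
  obtains c p where
    "\<And>s e. matches k rs b s e \<Longrightarrow> ex c s (poly p (esize k e)) (s(b := bits (F e)))"
  using assms unfolding fpk_def by meson

lemma fpk_mono:
  assumes "fpk k F" "k \<le> k'" shows "fpk k' F"
proof (rule fpkI)
  fix rs :: "nat \<Rightarrow> nat" and b :: nat
  assume "\<And>i. i < k' \<Longrightarrow> rs i < b"
  then obtain c p where cp:
    "\<And>s e. matches k rs b s e \<Longrightarrow> ex c s (poly p (esize k e)) (s(b := bits (F e)))"
    using fpkD[OF assms(1), of rs b] assms(2) by (meson order_less_le_trans)
  have "ex c s (poly p (esize k' e)) (s(b := bits (F e)))" if "matches k' rs b s e" for s e
  proof (rule ex_mono[OF cp])
    show "matches k rs b s e" using that assms(2) by (simp add: matches_def)
    show "poly p (esize k e) \<le> poly p (esize k' e)" by (intro poly_nat_mono esize_mono assms(2))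
  qed
  then show "\<exists>c f. pbd f \<and> (\<forall>s e. matches k' rs b s e \<longrightarrow> ex c s (f (esize k' e)) (s(b := bits (F e))))"
    by (intro exI[of _ c] exI[of _ "poly p"]) auto
qed

lemma fpk_length:
  assumes "fpk k F"
  obtains p where "\<And>e. length (F e) \<le> poly p (esize k e)"
proof -
  obtain c p where cp:
    "\<And>s e. matches k (\<lambda>i. i) k s e \<Longrightarrow> ex c s (poly p (esize k e)) (s(k := bits (F e)))"
    using fpkD[OF assms, of "\<lambda>i. i" k] by blast
  have "length (F e) \<le> poly p (esize k e)" for e
  proof -
    let ?s = "\<lambda>i. if i < k then bits (e i) else []"
    have "matches k (\<lambda>i. i) k ?s e" by (simp add: matches_def)
    from ex_length[OF cp[OF this], of k] show ?thesis by simp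
  qed
  then show ?thesis using that by blast
qed

subsection \<open>Moving data between registers\<close>

definition clear :: "nat \<Rightarrow> com" where
  "clear r = While r (Pop r)"

lemma ex_clear: "s r = bits xs \<Longrightarrow> ex (clear r) s (2 * length xs + 1) (s(r := []))"
proof (induction xs arbitrary: s)
  case Nil
  show ?case unfolding clear_def by (rule ex_cong[OF ex_WhileF]) (use Nil in \<open>auto simp: top_sym_def\<close>)
next
  case (Cons x xs)
  have p: "ex (Pop r) s 1 (s(r := bits xs))"
    using ex_Pop[of r s] Cons.prems by (simp add: pop_sym_def top_sym_def split: if_splits)
  have "ex (clear r) (s(r := bits xs)) (2 * length xs + 1) (s(r := []))"
    by (rule ex_cong[OF Cons.IH]) auto
  then have "ex (clear r) s (Suc 1 + (2 * length xs + 1)) (s(r := []))"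
    using p unfolding clear_def by (intro ex_WhileT[of s r]) (auto simp: Cons.prems top_sym_def)
  then show ?case by (rule ex_mono) simp
qed

text \<open>Pouring one stack into another reverses it, so \<open>move\<close> and
  \<open>copy\<close> pour twice. The reversal itself is what \<open>fp_polytime\<close> uses at its
  input and output.\<close>

definition mv :: "nat \<Rightarrow> nat \<Rightarrow> com" where
  "mv r t = While r (If r 2 (Seq (Pop r) (Push t 2)) (Seq (Pop r) (Push t 1)))"

lemma ex_mv:
  "s r = bits xs \<Longrightarrow> r \<noteq> t \<Longrightarrow>
   ex (mv r t) s (5 * length xs + 1) (s(r := [], t := bits (rev xs) @ s t))"
proof (induction xs arbitrary: s)
  case Nil
  show ?case unfolding mv_def by (rule ex_cong[OF ex_WhileF]) (use Nil in \<open>auto simp: top_sym_def\<close>)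
next
  case (Cons x xs)
  let ?a = "if x then 2 else 1"
  let ?s = "s(r := bits xs, t := ?a # s t)"
  have p: "ex (Pop r) s 1 (s(r := bits xs))"
    using ex_Pop[of r s] Cons.prems by (simp add: pop_sym_def top_sym_def split: if_splits)
  have "ex (Seq (Pop r) (Push t ?a)) s (1 + 2) ?s"
    using ex_Seq[OF p ex_Push[of t ?a]] Cons.prems by simp
  then have b: "ex (If r 2 (Seq (Pop r) (Push t 2)) (Seq (Pop r) (Push t 1))) s (Suc (1 + 2)) ?s"
    by (intro ex_If) (cases x; simp add: top_sym_def Cons.prems)
  have "ex (mv r t) ?s (5 * length xs + 1) (?s(r := [], t := bits (rev xs) @ ?s t))"
    using Cons by (intro Cons.IH) auto
  moreover have "?s(r := [], t := bits (rev xs) @ ?s t) = s(r := [], t := bits (rev (x # xs)) @ s t)"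
    using Cons.prems by auto
  ultimately have "ex (mv r t) ?s (5 * length xs + 1) (s(r := [], t := bits (rev (x # xs)) @ s t))"
    by simp
  then have "ex (mv r t) s (Suc (Suc (1 + 2)) + (5 * length xs + 1)) (s(r := [], t := bits (rev (x # xs)) @ s t))"
    using b unfolding mv_def by (intro ex_WhileT[of s r]) (auto simp: Cons.prems top_sym_def)
  then show ?case by (rule ex_mono) simp
qed

definition move :: "nat \<Rightarrow> nat \<Rightarrow> nat \<Rightarrow> com" where
  "move r t u = Seq (mv r u) (mv u t)"

lemma ex_move:
  assumes "s r = bits xs" "s u = []" "r \<noteq> t" "r \<noteq> u" "t \<noteq> u"
  shows "ex (move r t u) s (10 * length xs + 2) (s(r := [], t := bits xs @ s t))"
proof -
  have 1: "ex (mv r u) s (5 * length xs + 1) (s(r := [], u := bits (rev xs)))"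
    using ex_mv[of s r xs u] assms by simp
  have "ex (mv u t) (s(r := [], u := bits (rev xs))) (5 * length xs + 1)
     (s(r := [], t := bits xs @ s t))"
    by (rule ex_cong[OF ex_mv[of _ u "rev xs" t]]) (use assms in auto)
  from ex_Seq[OF 1 this] show ?thesis unfolding move_def by (rule ex_mono) simp
qed

definition copy :: "nat \<Rightarrow> nat \<Rightarrow> nat \<Rightarrow> com" where
  "copy r t u = Seq (mv r u) (While u (If u 2 (Seq (Pop u) (Seq (Push r 2) (Push t 2)))
     (Seq (Pop u) (Seq (Push r 1) (Push t 1)))))"

lemma ex_copy:
  assumes "s r = bits xs" "s u = []" "r \<noteq> t" "r \<noteq> u" "t \<noteq> u"
  shows "ex (copy r t u) s (12 * length xs + 2) (s(t := bits xs @ s t))"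
proof -
  let ?w = "While u (If u 2 (Seq (Pop u) (Seq (Push r 2) (Push t 2)))
     (Seq (Pop u) (Seq (Push r 1) (Push t 1))))"
  have w: "s u = bits ys \<Longrightarrow> ex ?w s (7 * length ys + 1)
      (s(u := [], r := bits (rev ys) @ s r, t := bits (rev ys) @ s t))" for ys s
  proof (induction ys arbitrary: s)
    case Nil
    show ?case by (rule ex_cong[OF ex_WhileF]) (use Nil in \<open>auto simp: top_sym_def\<close>)
  next
    case (Cons y ys)
    let ?a = "if y then 2 else 1"
    let ?s = "s(u := bits ys, r := ?a # s r, t := ?a # s t)"
    have p: "ex (Pop u) s 1 (s(u := bits ys))"
      using ex_Pop[of u s] Cons.prems by (simp add: pop_sym_def top_sym_def split: if_splits)
    have "ex (Seq (Push r ?a) (Push t ?a)) (s(u := bits ys)) (2 + 2) ?s"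
      by (rule ex_cong[OF ex_Seq[OF ex_Push ex_Push]]) (use assms in auto)
    from ex_Seq[OF p this] have "ex (Seq (Pop u) (Seq (Push r ?a) (Push t ?a))) s 5 ?s" by simp
    then have b: "ex (If u 2 (Seq (Pop u) (Seq (Push r 2) (Push t 2)))
        (Seq (Pop u) (Seq (Push r 1) (Push t 1)))) s (Suc 5) ?s"
      by (intro ex_If) (cases y; simp add: top_sym_def Cons.prems)
    have "ex ?w ?s (7 * length ys + 1)
        (s(u := [], r := bits (rev (y # ys)) @ s r, t := bits (rev (y # ys)) @ s t))"
      by (rule ex_cong[OF Cons.IH]) (use assms in auto)
    then have "ex ?w s (Suc (Suc 5) + (7 * length ys + 1))
        (s(u := [], r := bits (rev (y # ys)) @ s r, t := bits (rev (y # ys)) @ s t))"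
      using b by (intro ex_WhileT[of s u]) (auto simp: Cons.prems top_sym_def)
    then show ?case by (rule ex_mono) simp
  qed
  have 1: "ex (mv r u) s (5 * length xs + 1) (s(r := [], u := bits (rev xs)))"
    using ex_mv[of s r xs u] assms by simp
  have "ex ?w (s(r := [], u := bits (rev xs))) (7 * length xs + 1) (s(t := bits xs @ s t))"
    by (rule ex_cong[OF w[of _ "rev xs"]]) (use assms in auto)
  from ex_Seq[OF 1 this] show ?thesis unfolding copy_def by (rule ex_mono) simp
qed

subsection \<open>Basic functions\<close>

lemma fp_arg: "fp (\<lambda>e. e i)"
proof -
  have "fpk (Suc i) (\<lambda>e. e i)"
  proof (rule fpkI)
    fix rs :: "nat \<Rightarrow> nat" and b :: nat
    assume rs: "\<And>j. j < Suc i \<Longrightarrow> rs j < b"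
    have "ex (copy (rs i) b (Suc b)) s (12 * esize (Suc i) e + 2) (s(b := bits (e i)))"
      if "matches (Suc i) rs b s e" for s e
      by (rule ex_cong[OF ex_copy[of _ _ "e i"]])
        (use that rs[of i] in \<open>auto simp: matches_def esize_def\<close>)
    then show "\<exists>c f. pbd f \<and>
        (\<forall>s e. matches (Suc i) rs b s e \<longrightarrow> ex c s (f (esize (Suc i) e)) (s(b := bits (e i))))"
      by (intro exI[of _ "copy (rs i) b (Suc b)"] exI[of _ "\<lambda>n. 12 * n + 2"] conjI pbd_add pbd_mult) auto
  qed
  then show ?thesis unfolding fp_def by blast
qed

lemma fp_Nil: "fp (\<lambda>e. [])"
proof -
  have "fpk 0 (\<lambda>e. [])"
  proof (rule fpkI)
    fix rs :: "nat \<Rightarrow> nat" and b :: nat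
    have "ex Skip s 0 (s(b := bits []))" if "matches 0 rs b s e" for s e
      by (rule ex_cong[OF ex_Skip]) (use that in \<open>auto simp: matches_def\<close>)
    then show "\<exists>c f. pbd f \<and>
        (\<forall>s e. matches 0 rs b s e \<longrightarrow> ex c s (f (esize 0 e)) (s(b := bits [])))"
      by (intro exI[of _ Skip] exI[of _ "\<lambda>n. 0"]) auto
  qed
  then show ?thesis unfolding fp_def by blast
qed

lemma fp_Cons:
  assumes "fp F" shows "fp (\<lambda>e. x # F e)"
proof -
  obtain k where k: "fpk k F" using assms fp_def by blast
  have "fpk k (\<lambda>e. x # F e)"
  proof (rule fpkI)
    fix rs :: "nat \<Rightarrow> nat" and b :: nat
    assume rs: "\<And>j. j < k \<Longrightarrow> rs j < b"
    obtain c p where c: "\<And>s e. matches k rs b s e \<Longrightarrow> ex c s (poly p (esize k e)) (s(b := bits (F e)))"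
      using fpkD[OF k, of rs b] rs by blast
    have "ex (Seq c (Push b (if x then 2 else 1))) s (poly p (esize k e) + 2) (s(b := bits (x # F e)))"
      if "matches k rs b s e" for s e
      by (rule ex_cong[OF ex_Seq[OF c[OF that] ex_Push]]) auto
    then show "\<exists>c f. pbd f \<and>
        (\<forall>s e. matches k rs b s e \<longrightarrow> ex c s (f (esize k e)) (s(b := bits (x # F e))))"
      by (intro exI[of _ "Seq c (Push b (if x then 2 else 1))"] exI[of _ "\<lambda>n. poly p n + 2"] conjI pbd_add) auto
  qed
  then show ?thesis unfolding fp_def by blast
qed

lemma fp_tl:
  assumes "fp F" shows "fp (\<lambda>e. tl (F e))"
proof -
  obtain k where k: "fpk k F" using assms fp_def by blast
  have pop: "pop_sym (bits xs) = bits (tl xs)" for xs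
    by (cases xs) (auto simp: pop_sym_def top_sym_def)
  have "fpk k (\<lambda>e. tl (F e))"
  proof (rule fpkI)
    fix rs :: "nat \<Rightarrow> nat" and b :: nat
    assume rs: "\<And>j. j < k \<Longrightarrow> rs j < b"
    obtain c p where c: "\<And>s e. matches k rs b s e \<Longrightarrow> ex c s (poly p (esize k e)) (s(b := bits (F e)))"
      using fpkD[OF k, of rs b] rs by blast
    have "ex (Seq c (Pop b)) s (poly p (esize k e) + 1) (s(b := bits (tl (F e))))"
      if "matches k rs b s e" for s e
      by (rule ex_cong[OF ex_Seq[OF c[OF that] ex_Pop]]) (auto simp: pop)
    then show "\<exists>c f. pbd f \<and>
        (\<forall>s e. matches k rs b s e \<longrightarrow> ex c s (f (esize k e)) (s(b := bits (tl (F e)))))"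
      by (intro exI[of _ "Seq c (Pop b)"] exI[of _ "\<lambda>n. poly p n + 1"]) auto
  qed
  then show ?thesis unfolding fp_def by blast
qed

lemma fp_case_arg: "fp (\<lambda>e. if e 0 = [] then e 1 else if hd (e 0) then e 2 else e 3)"
proof -
  have "fpk 4 (\<lambda>e. if e 0 = [] then e 1 else if hd (e 0) then e 2 else e 3)" (is "fpk 4 ?F")
  proof (rule fpkI)
    fix rs :: "nat \<Rightarrow> nat" and b :: nat
    assume rs: "\<And>j. j < 4 \<Longrightarrow> rs j < b"
    let ?c = "If (rs 0) 0 (copy (rs 1) b (Suc b))
      (If (rs 0) 2 (copy (rs 2) b (Suc b)) (copy (rs 3) b (Suc b)))"
    have "ex ?c s (12 * esize 4 e + 4) (s(b := bits (?F e)))" if m: "matches 4 rs b s e" for s e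
    proof -
      have cp: "ex (copy (rs i) b (Suc b)) s (12 * esize 4 e + 2) (s(b := bits (e i)))" if "i < 4" for i
      proof (rule ex_cong[OF ex_copy[of _ _ "e i"]])
        have "length (e i) \<le> esize 4 e"
          unfolding esize_def by (rule member_le_sum) (use that in auto)
        then show "12 * length (e i) + 2 \<le> 12 * esize 4 e + 2" by simp
      qed (use m rs[of i] that in \<open>auto simp: matches_def\<close>)
      have h: "s (rs 0) = bits (e 0)" using m by (simp add: matches_def)
      consider "e 0 = []" | "e 0 \<noteq> []" "hd (e 0)" | "e 0 \<noteq> []" "\<not> hd (e 0)" by blast
      then show ?thesis
      proof cases
        case 1
        then have "ex ?c s (Suc (12 * esize 4 e + 2)) (s(b := bits (e 1)))"
          using cp[of 1] h by (intro ex_IfT) (auto simp: top_sym_def)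
        then show ?thesis using 1 by (auto intro: ex_mono)
      next
        case 2
        then obtain xs where xs: "e 0 = True # xs" by (cases "e 0") auto
        then have "ex ?c s (Suc (Suc (12 * esize 4 e + 2))) (s(b := bits (e 2)))"
          using cp[of 2] h by (intro ex_IfF[of s "rs 0" 0] ex_IfT[of s "rs 0" 2]) (auto simp: top_sym_def)
        then show ?thesis using 2 by (auto intro: ex_mono)
      next
        case 3
        then obtain xs where xs: "e 0 = False # xs" by (cases "e 0") auto
        then have "ex ?c s (Suc (Suc (12 * esize 4 e + 2))) (s(b := bits (e 3)))"
          using cp[of 3] h by (intro ex_IfF[of s "rs 0"]) (auto simp: top_sym_def)
        then show ?thesis using 3 by (auto intro: ex_mono)
      qed
    qed
    then show "\<exists>c f. pbd f \<and>
        (\<forall>s e. matches 4 rs b s e \<longrightarrow> ex c s (f (esize 4 e)) (s(b := bits (?F e))))"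
      by (intro exI[of _ ?c] exI[of _ "\<lambda>n. 12 * n + 4"] conjI pbd_add pbd_mult) auto
  qed
  then show ?thesis unfolding fp_def by blast
qed

subsection \<open>Composition and unary recursion\<close>

text \<open>\<open>G l\<close> is run with result register \<open>b + l\<close>, so the values
  already stored lie below its scratch space. This is where the free choice of the base in
  \<open>fpk\<close> pays off.\<close>

lemma eval_block:
  assumes "\<And>i. i < l \<Longrightarrow> fpk k (G i)" "\<And>i. i < k \<Longrightarrow> rs i < b"
  shows "\<exists>c f. pbd f \<and> (\<forall>s e. matches k rs b s e \<longrightarrow>
    ex c s (f (esize k e)) (\<lambda>r. if b \<le> r \<and> r < b + l then bits (G (r - b) e) else s r))"
  using assms(1)
proof (induction l)
  case 0
  have "ex Skip s 0 (\<lambda>r. if b \<le> r \<and> r < b + 0 then bits (G (r - b) e) else s r)" for s e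
    by (rule ex_cong[OF ex_Skip]) (auto simp: fun_eq_iff)
  then show ?case by (intro exI[of _ Skip] exI[of _ "\<lambda>n. 0"]) auto
next
  case (Suc l)
  let ?S = "\<lambda>l s e r. if b \<le> r \<and> r < b + l then bits (G (r - b) e) else s r"
  obtain c f where f: "pbd f" and c: "\<And>s e. matches k rs b s e \<Longrightarrow> ex c s (f (esize k e)) (?S l s e)"
    using Suc.IH Suc.prems by auto
  obtain d p where d:
    "\<And>s e. matches k rs (b + l) s e \<Longrightarrow> ex d s (poly p (esize k e)) (s(b + l := bits (G l e)))"
    using fpkD[OF Suc.prems[of l], of rs "b + l"] assms(2) by (auto simp: trans_less_add1)
  have "ex (Seq c d) s (f (esize k e) + poly p (esize k e)) (?S (Suc l) s e)" if m: "matches k rs b s e" for s e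
  proof (rule ex_cong[OF ex_Seq[OF c[OF m] d]])
    show "matches k rs (b + l) (?S l s e) e"
      using m assms(2) by (fastforce simp: matches_def)
  qed auto
  then show ?case using f by (intro exI[of _ "Seq c d"] exI[of _ "\<lambda>n. f n + poly p n"]) auto
qed

lemma clear_block:
  "\<exists>c. \<forall>s xs. (\<forall>i<l. s (b + i) = bits (xs i)) \<longrightarrow>
    ex c s (\<Sum>i<l. 2 * length (xs i) + 1) (\<lambda>r. if b \<le> r \<and> r < b + l then [] else s r)"
proof (induction l)
  case 0
  have "ex Skip s 0 (\<lambda>r. if b \<le> r \<and> r < b + 0 then [] else s r)" for s
    by (rule ex_cong[OF ex_Skip]) (auto simp: fun_eq_iff)
  then show ?case by (intro exI[of _ Skip]) auto
next
  case (Suc l)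
  then obtain c where c: "\<And>s xs. (\<forall>i<l. s (b + i) = bits (xs i)) \<Longrightarrow>
    ex c s (\<Sum>i<l. 2 * length (xs i) + 1) (\<lambda>r. if b \<le> r \<and> r < b + l then [] else s r)" by blast
  have "ex (Seq c (clear (b + l))) s (\<Sum>i<Suc l. 2 * length (xs i) + 1)
      (\<lambda>r. if b \<le> r \<and> r < b + Suc l then [] else s r)"
    if xs: "\<forall>i<Suc l. s (b + i) = bits (xs i)" for s xs
    by (rule ex_cong[OF ex_Seq[OF c ex_clear[of _ _ "xs l"]]]) (use xs in auto)
  then show ?case by blast
qed

lemma fp_comp:
  assumes "fp F" "\<And>i. fp (G i)"
  shows "fp (\<lambda>e. F (\<lambda>i. G i e))"
proof -
  obtain k0 where "fpk k0 F" using assms(1) fp_def by blast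
  \<comment> \<open>A positive arity keeps the result register \<open>b + k\<close> of
    \<open>F\<close> apart from \<open>b\<close>, to which the result is moved at the end.\<close>
  then have F: "fpk (Suc k0) F" using fpk_mono by (metis le_SucI order_refl)
  define k where "k = Suc k0"
  have F: "fpk k F" and k: "0 < k" using F by (simp_all add: k_def)
  obtain K where K: "\<And>i. fpk (K i) (G i)" using assms(2) unfolding fp_def by metis
  define m where "m = (\<Sum>i<k. K i)"
  have G: "fpk m (G i)" if "i < k" for i
    using fpk_mono[OF K] member_le_sum[of i "{..<k}" K] that unfolding m_def by simp
  have "\<forall>i. \<exists>p. i < k \<longrightarrow> (\<forall>e. length (G i e) \<le> poly p (esize m e))"
    using G fpk_length by metis
  then obtain P where P: "\<And>i e. i < k \<Longrightarrow> length (G i e) \<le> poly (P i) (esize m e)" by metis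
  obtain q where q: "\<And>e. length (F e) \<le> poly q (esize k e)" using fpk_length[OF F] by blast
  have sz: "esize k (\<lambda>i. G i e) \<le> (\<Sum>i<k. poly (P i) (esize m e))" for e
    unfolding esize_def[of k] by (rule sum_mono) (use P in auto)
  have "fpk m (\<lambda>e. F (\<lambda>i. G i e))"
  proof (rule fpkI)
    fix rs :: "nat \<Rightarrow> nat" and b :: nat
    assume rs: "\<And>i. i < m \<Longrightarrow> rs i < b"
    let ?S = "\<lambda>s e r. if b \<le> r \<and> r < b + k then bits (G (r - b) e) else s r"
    obtain c f where f: "pbd f" and c: "\<And>s e. matches m rs b s e \<Longrightarrow> ex c s (f (esize m e)) (?S s e)"
      using eval_block[of k m G rs b] G rs by auto
    obtain d p where d: "\<And>s e. matches k ((+) b) (b + k) s e \<Longrightarrow>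
        ex d s (poly p (esize k e)) (s(b + k := bits (F e)))"
      using fpkD[OF F, of "(+) b" "b + k"] by auto
    obtain cl where cl: "\<And>s xs. (\<forall>i<k. s (b + i) = bits (xs i)) \<Longrightarrow>
        ex cl s (\<Sum>i<k. 2 * length (xs i) + 1) (\<lambda>r. if b \<le> r \<and> r < b + k then [] else s r)"
      using clear_block[of k b] by blast
    let ?c = "Seq c (Seq d (Seq cl (move (b + k) b (b + k + 1))))"
    let ?Q = "\<lambda>n. \<Sum>i<k. poly (P i) n"
    let ?f = "\<lambda>n. f n + (poly p (?Q n) + ((\<Sum>i<k. 2 * poly (P i) n + 1) + (10 * poly q (?Q n) + 2)))"
    have "ex ?c s (?f (esize m e)) (s(b := bits (F (\<lambda>i. G i e))))" if mt: "matches m rs b s e" for s e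
    proof -
      let ?e = "\<lambda>i. G i e"
      let ?s1 = "?S s e"
      let ?s2 = "?s1(b + k := bits (F ?e))"
      let ?s3 = "\<lambda>r. if b \<le> r \<and> r < b + k then [] else ?s2 r"
      have 1: "ex c s (f (esize m e)) ?s1" by (rule c[OF mt])
      have 2: "ex d ?s1 (poly p (?Q (esize m e))) ?s2"
        by (rule ex_cong[OF d]) (use mt sz in \<open>auto simp: matches_def intro: poly_nat_mono\<close>)
      have 3: "ex cl ?s2 (\<Sum>i<k. 2 * poly (P i) (esize m e) + 1) ?s3"
        by (rule ex_cong[OF cl[of _ ?e]]) (use P in \<open>auto intro!: sum_mono\<close>)
      have "length (F ?e) \<le> poly q (?Q (esize m e))"
        using q[of ?e] poly_nat_mono[OF sz] order_trans by blast
      then have 4: "ex (move (b + k) b (b + k + 1)) ?s3 (10 * poly q (?Q (esize m e)) + 2) (s(b := bits (F ?e)))"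
        by (intro ex_cong[OF ex_move[of _ _ "F ?e"]])
          (use k mt in \<open>auto simp: matches_def fun_eq_iff\<close>)
      show ?thesis by (rule ex_Seq[OF 1 ex_Seq[OF 2 ex_Seq[OF 3 4]]])
    qed
    moreover have "pbd ?f" using f by (intro pbd_add pbd_mult pbd_poly pbd_sum) auto
    ultimately show "\<exists>c f. pbd f \<and> (\<forall>s e. matches m rs b s e \<longrightarrow>
        ex c s (f (esize m e)) (s(b := bits (F (\<lambda>i. G i e)))))"
      by (intro exI[of _ ?c] exI[of _ ?f]) simp
  qed
  then show ?thesis unfolding fp_def by blast
qed

lemma fp_length:
  assumes "fp F"
  shows "\<exists>k p. \<forall>e. length (F e) \<le> poly p (esize k e)"
  using assms fpk_length unfolding fp_def by metis

text \<open>The counter (in unary) and the previous value are passed to \<open>H\<close> as the first two components of an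
  environment that continues with the original one.\<close>

lemma fp_rec:
  fixes R :: "nat \<Rightarrow> env \<Rightarrow> bool list"
  assumes N: "fp N" and G: "fp G"
    and H: "fp (\<lambda>e. H (length (e 0)) (e 1) (\<lambda>i. e (i + 2)))"
    and R0: "\<And>e. R 0 e = G e" and RS: "\<And>n e. R (Suc n) e = H n (R n e) e"
    and bound: "\<exists>k p. \<forall>e. \<forall>n \<le> length (N e). length (R n e) \<le> poly p (esize k e)"
  shows "fp (\<lambda>e. R (length (N e)) e)"
proof -
  obtain k1 k2 k3 k4 q0 where k1: "fpk k1 N" and k2: "fpk k2 G"
    and k3: "fpk k3 (\<lambda>e. H (length (e 0)) (e 1) (\<lambda>i. e (i + 2)))"
    and q0: "\<And>e n. n \<le> length (N e) \<Longrightarrow> length (R n e) \<le> poly q0 (esize k4 e)"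
    using N G H bound unfolding fp_def by blast
  define k where "k = k1 + k2 + k3 + k4"
  have N: "fpk k N" and G: "fpk k G"
    and H: "fpk (k + 2) (\<lambda>e. H (length (e 0)) (e 1) (\<lambda>i. e (i + 2)))"
    using fpk_mono[OF k1] fpk_mono[OF k2] fpk_mono[OF k3] by (simp_all add: k_def)
  have q: "length (R n e) \<le> poly q0 (esize k e)" if "n \<le> length (N e)" for e n
    using q0[OF that] poly_nat_mono[OF esize_mono[of k4 k e], of q0] by (auto simp: k_def intro: order_trans)
  obtain qN where qN: "\<And>e. length (N e) \<le> poly qN (esize k e)" using fpk_length[OF N] by blast
  have "fpk k (\<lambda>e. R (length (N e)) e)"
  proof (rule fpkI)
    fix rs :: "nat \<Rightarrow> nat" and b :: nat
    assume rs: "\<And>i. i < k \<Longrightarrow> rs i < b"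
    \<comment> \<open>Register \<open>b\<close> holds the current value, \<open>b + 1\<close> the
      rounds still to go (only its length counts), \<open>b + 2\<close> the counter in unary and
      \<open>b + 3\<close> the next value. \<open>rs'\<close> presents counter and value as
      components 0 and 1.\<close>
    define rs' where "rs' = (\<lambda>i. if i = 0 then b + 2 else if i = 1 then b else rs (i - 2))"
    let ?G = "\<lambda>i::nat. if i = 0 then G else N"
    obtain c f where f: "pbd f" and c: "\<And>s e. matches k rs b s e \<Longrightarrow> ex c s (f (esize k e))
        (\<lambda>r. if b \<le> r \<and> r < b + 2 then bits (?G (r - b) e) else s r)"
    proof -
      have "fpk k (?G i)" for i using G N by simp
      then show ?thesis using eval_block[of 2 k ?G rs b] rs that by blast
    qed
    have rs'_less: "rs' i < b + 3" if "i < k + 2" for i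
    proof -
      have "rs (i - 2) < b + 3" if "2 \<le> i" using rs[of "i - 2"] that \<open>i < k + 2\<close> by linarith
      then show ?thesis by (auto simp: rs'_def)
    qed
    then obtain d p where d: "\<And>s e. matches (k + 2) rs' (b + 3) s e \<Longrightarrow> ex d s (poly p (esize (k + 2) e))
        (s(b + 3 := bits (H (length (e 0)) (e 1) (\<lambda>i. e (i + 2)))))"
      using fpkD[OF H, of rs' "b + 3"] by blast
    let ?body = "Seq (Pop (b + 1)) (Seq d (Seq (clear b) (Seq (move (b + 3) b (b + 4)) (Push (b + 2) 2))))"
    let ?w = "While (b + 1) ?body"
    let ?c = "Seq c (Seq ?w (clear (b + 2)))"
    let ?B = "\<lambda>n. 1 + (poly p (poly qN n + poly q0 n + n) +
       ((2 * poly q0 n + 1) + ((10 * poly q0 n + 2) + 2)))"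
    let ?f = "\<lambda>n. f n + ((poly qN n * (?B n + 1) + 1) + (2 * poly qN n + 1))"
    have "ex ?c s (?f (esize k e)) (s(b := bits (R (length (N e)) e)))" if mt: "matches k rs b s e" for s e
    proof -
      let ?n = "esize k e"
      let ?N = "length (N e)"
      define st where "st = (\<lambda>n ys. s(b := bits (R n e), b + 1 := bits ys, b + 2 := replicate n 2))"
      have loop: "ex ?w (st n ys) (length ys * (?B ?n + 1) + 1) (st ?N [])" if "n + length ys = ?N" for n ys
        using that
      proof (induction ys arbitrary: n)
        case Nil
        show ?case by (rule ex_cong[OF ex_WhileF]) (use Nil in \<open>auto simp: st_def top_sym_def\<close>)
      next
        case (Cons y ys)
        have n: "n < ?N" using Cons.prems by simp
        let ?e = "\<lambda>i. if i = 0 then replicate n True else if i = 1 then R n e else e (i - 2)"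
        let ?s1 = "st n ys"
        let ?s2 = "?s1(b + 3 := bits (R (Suc n) e))"
        let ?s3 = "?s2(b := [])"
        let ?s4 = "?s1(b := bits (R (Suc n) e))"
        have 1: "ex (Pop (b + 1)) (st n (y # ys)) 1 ?s1"
          by (rule ex_cong[OF ex_Pop]) (auto simp: st_def pop_sym_def top_sym_def)
        have es: "esize (k + 2) ?e = n + length (R n e) + ?n"
          unfolding esize_def by (simp only: sum.lessThan_Suc_shift add_2_eq_Suc') (simp add: numeral_2_eq_2)
        have m': "matches (k + 2) rs' (b + 3) ?s1 ?e"
        proof -
          have "?s1 (rs' i) = bits (?e i)" if "i < k + 2" for i
          proof -
            have "i - 2 < k" if "2 \<le> i" using that \<open>i < k + 2\<close> by simp
            then have "2 \<le> i \<Longrightarrow> rs (i - 2) < b \<and> s (rs (i - 2)) = bits (e (i - 2))"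
              using rs mt by (simp add: matches_def)
            then show ?thesis by (auto simp: rs'_def st_def)
          qed
          then show ?thesis using mt by (simp add: matches_def st_def)
        qed
        have "esize (k + 2) ?e \<le> poly qN ?n + poly q0 ?n + ?n"
          unfolding es using qN[of e] q[of n e] n by linarith
        then have 2: "ex d ?s1 (poly p (poly qN ?n + poly q0 ?n + ?n)) ?s2"
          by (intro ex_cong[OF d[OF m']] poly_nat_mono) (auto simp: RS)
        have 3: "ex (clear b) ?s2 (2 * poly q0 ?n + 1) ?s3"
          by (rule ex_cong[OF ex_clear[of _ _ "R n e"]]) (use q[of n e] n in \<open>auto simp: st_def\<close>)
        have 4: "ex (move (b + 3) b (b + 4)) ?s3 (10 * poly q0 ?n + 2) ?s4"
          by (rule ex_cong[OF ex_move[of _ _ "R (Suc n) e"]])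
            (use q[of "Suc n" e] n mt in \<open>auto simp: st_def fun_eq_iff matches_def\<close>)
        have 5: "ex (Push (b + 2) 2) ?s4 2 (st (Suc n) ys)"
          by (rule ex_cong[OF ex_Push]) (auto simp: st_def)
        have "ex ?body (st n (y # ys)) (?B ?n) (st (Suc n) ys)"
          by (rule ex_Seq[OF 1 ex_Seq[OF 2 ex_Seq[OF 3 ex_Seq[OF 4 5]]]])
        moreover have "ex ?w (st (Suc n) ys) (length ys * (?B ?n + 1) + 1) (st ?N [])"
          using Cons by simp
        moreover have "top_sym (st n (y # ys) (b + 1)) \<noteq> 0" by (simp add: st_def top_sym_def)
        ultimately have "ex ?w (st n (y # ys)) (Suc (?B ?n) + (length ys * (?B ?n + 1) + 1)) (st ?N [])"
          using ex_WhileT by blast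
        then show ?case by (rule ex_mono) simp
      qed
      have 1: "ex c s (f ?n) (st 0 (N e))"
        by (rule ex_cong[OF c[OF mt]])
          (use mt in \<open>auto simp: st_def fun_eq_iff R0 matches_def not_less_eq_eq\<close>)
      have 2: "ex ?w (st 0 (N e)) (poly qN ?n * (?B ?n + 1) + 1) (st ?N [])"
        by (rule ex_mono[OF loop]) (use qN[of e] in \<open>auto intro!: add_mono mult_le_mono1 simp del: mult_Suc_right add_Suc_right\<close>)
      have 3: "ex (clear (b + 2)) (st ?N []) (2 * poly qN ?n + 1) (s(b := bits (R ?N e)))"
        by (rule ex_cong[OF ex_clear[of _ _ "replicate ?N True"]])
          (use qN[of e] mt in \<open>auto simp: st_def fun_eq_iff matches_def\<close>)
      show ?thesis by (rule ex_Seq[OF 1 ex_Seq[OF 2 3]])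
    qed
    moreover have "pbd ?f" using f by (intro pbd_add pbd_mult pbd_poly) auto
    ultimately show "\<exists>c f. pbd f \<and> (\<forall>s e. matches k rs b s e \<longrightarrow>
        ex c s (f (esize k e)) (s(b := bits (R (length (N e)) e))))"
      by (intro exI[of _ ?c] exI[of _ ?f]) simp
  qed
  then show ?thesis unfolding fp_def by blast
qed

text \<open>The heads start on the first input symbols; the prefixed states move them to the last ones, so that
  the input tapes become stacks, with the last symbol on top.\<close>

definition rewind :: "tm \<Rightarrow> tm" where
  "rewind M = M\<lparr>num_states := num_states M + 2, delta := (\<lambda>q ss.
     if q < 2 then
       (if ss ! q \<noteq> 0 then (q, (keep ss)[q := (ss ! q, MoveRight)])
        else (Suc q, map (\<lambda>i. (ss ! i, if i = q \<or> q = 0 \<and> 2 \<le> i then MoveLeft else Stay)) [0..<length ss]))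
     else apfst ((+) 2) (delta M (q - 2) ss))\<rparr>"

lemma wf_rewind: assumes "wf_tm M" shows "wf_tm (rewind M)"
  unfolding wf_tm_def
proof (intro conjI allI impI)
  fix q ss
  assume q: "q < num_states (rewind M)" and ss: "length ss = num_tapes (rewind M) \<and> set ss \<subseteq> {..<num_syms (rewind M)}"
  have K: "3 \<le> num_tapes M" and S: "3 \<le> num_syms M" using assms by (auto simp: wf_tm_def)
  have ss': "length ss = num_tapes M" "set ss \<subseteq> {..<num_syms M}" using ss by (auto simp: rewind_def)
  have nth: "ss ! i < num_syms M" if "i < length ss" for i
    using ss'(2) nth_mem[OF that] by blast
  have *: "fst ` set ((keep ss)[r := x]) \<subseteq> {..<num_syms M}" if "fst x < num_syms M" for r and x :: "nat \<times> dir"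
  proof -
    have "fst ` set ((keep ss)[r := x]) \<subseteq> insert (fst x) (set ss)"
      using image_mono[OF set_update_subset_insert[of "keep ss" r x], of fst] by (simp add: keep_def image_image)
    then show ?thesis using that ss' by auto
  qed
  have "fst (delta (rewind M) q ss) \<le> num_states (rewind M) \<and>
      length (snd (delta (rewind M) q ss)) = num_tapes (rewind M) \<and>
      fst ` set (snd (delta (rewind M) q ss)) \<subseteq> {..<num_syms (rewind M)}"
  proof (cases "q < 2")
    case True
    then have "q < length ss" using K ss' by simp
    then show ?thesis using True ss' nth *[of "(ss ! q, MoveRight)" q] by (auto simp: rewind_def keep_def)
  next
    case False
    then have "q - 2 < num_states M" using q by (simp add: rewind_def)
    then show ?thesis using False assms ss' by (simp add: rewind_def wf_tm_def)
  qed
  then show "fst (delta (rewind M) q ss) \<le> num_states (rewind M)"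
      "length (snd (delta (rewind M) q ss)) = num_tapes (rewind M)"
      "fst ` set (snd (delta (rewind M) q ss)) \<subseteq> {..<num_syms (rewind M)}" by auto
qed (use assms in \<open>auto simp: rewind_def wf_tm_def\<close>)

lemma contents_zero_iff: "contents x j = 0 \<longleftrightarrow> \<not> (0 \<le> j \<and> j < int (length x))"
  by (simp add: contents_def)

lemma stack_tape_contents: "stack_tape (rev (bits x)) = (contents x, int (length x) - 1)"
  by (auto simp: stack_tape_def contents_def fun_eq_iff bits_def rev_map)

lemma rewind_sel [simp]:
  "num_tapes (rewind M) = num_tapes M" "num_syms (rewind M) = num_syms M"
  "num_states (rewind M) = num_states M + 2"
  by (simp_all add: rewind_def)

lemma rewind_scan:
  assumes q: "q < 2"
  shows "q < length ts \<Longrightarrow> ts ! q = (contents x, int i) \<Longrightarrow> i \<le> length x \<Longrightarrow>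
    (step (rewind M) ^^ (length x - i)) (q, ts) = (q, ts[q := (contents x, int (length x))])"
proof (induction "length x - i" arbitrary: i ts)
  case 0
  then have "i = length x" by simp
  then have "ts[q := (contents x, int (length x))] = ts" using 0 by (metis list_update_id)
  then show ?case using 0 by simp
next
  case (Suc d)
  have i: "i < length x" using Suc by linarith
  have nz: "contents x (int i) \<noteq> 0" using i by (simp add: contents_zero_iff)
  have rd: "map read_tape ts ! q = contents x (int i)" using Suc.prems by (simp add: read_tape_def)
  have "delta (rewind M) q (map read_tape ts) =
      (q, (keep (map read_tape ts))[q := (contents x (int i), MoveRight)])"
    using q rd nz by (simp add: rewind_def)
  then have "step (rewind M) (q, ts) = (q, ts[q := act_tape (ts ! q) (contents x (int i), MoveRight)])"
    using q Suc.prems by (simp add: step_def map2_upd)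
  then have "step (rewind M) (q, ts) = (q, ts[q := (contents x, int (Suc i))])"
    using Suc.prems by (simp add: act_tape_def algebra_simps)
  moreover have "(step (rewind M) ^^ (length x - Suc i)) (q, ts[q := (contents x, int (Suc i))]) =
      (q, (ts[q := (contents x, int (Suc i))])[q := (contents x, int (length x))])"
    using Suc.prems Suc.hyps(2) i by (intro Suc.hyps(1)) auto
  moreover have "length x - i = Suc (length x - Suc i)" using i by simp
  ultimately show ?case by (simp del: funpow.simps add: funpow_Suc_right)
qed

text \<open>At the first blank the scanning head steps back onto the last symbol. In state 0 the
  heads of the work tapes also go to position -1, where an empty stack has its head.\<close>

lemma rewind_turn:
  assumes q: "q < 2" "q < length ts" and t: "ts ! q = (contents x, int (length x))"
  shows "step (rewind M) (q, ts) = (Suc q, map (\<lambda>i. (fst (ts ! i), snd (ts ! i) -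
    (if i = q \<or> q = 0 \<and> 2 \<le> i then 1 else 0))) [0..<length ts])"
proof -
  have "map read_tape ts ! q = 0" using assms by (simp add: read_tape_def contents_def)
  then have d: "delta (rewind M) q (map read_tape ts) =
      (Suc q, map (\<lambda>i. (map read_tape ts ! i, if i = q \<or> q = 0 \<and> 2 \<le> i then MoveLeft else Stay)) [0..<length ts])"
    using q by (simp add: rewind_def)
  have act: "act_tape t (read_tape t, d) = (fst t, snd t + offset d)" for t d
    by (simp add: act_tape_def read_tape_def)
  have "map2 act_tape ts (snd (delta (rewind M) q (map read_tape ts))) =
      map (\<lambda>i. (fst (ts ! i), snd (ts ! i) - (if i = q \<or> q = 0 \<and> 2 \<le> i then 1 else 0))) [0..<length ts]"
    unfolding d by (rule nth_equalityI) (auto simp: act)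
  then show ?thesis using q d by (simp add: step_def)
qed

lemma map_nth_Cons2:
  "map f [0..<length (a # b # xs)] = f 0 # f (Suc 0) # map (\<lambda>i. f (i + 2)) [0..<length xs]"
  by (rule nth_equalityI) (auto simp: nth_Cons nth_map_upt simp del: upt_Suc split: nat.splits)

lemma rewind_init:
  assumes K: "3 \<le> num_tapes M"
  shows "(step (rewind M) ^^ (length x + length r + 2)) (init M x r) =
    (2, tapes (num_tapes M) (\<lambda>i. if i = 0 then rev (bits x) else if i = 1 then rev (bits r) else []))"
proof -
  let ?K = "num_tapes M"
  define rest where "rest = replicate (?K - 2) (contents [], 0 :: int)"
  define rest' where "rest' = replicate (?K - 2) (contents [], - 1 :: int)"
  have "(step (rewind M) ^^ length x) (0, (contents x, 0) # (contents r, 0) # rest) =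
      (0, (contents x, int (length x)) # (contents r, 0) # rest)"
    using rewind_scan[of 0 "(contents x, 0) # (contents r, 0) # rest" x 0 M] by simp
  moreover have "(step (rewind M) ^^ 1) (0, (contents x, int (length x)) # (contents r, 0) # rest) =
      (1, (contents x, int (length x) - 1) # (contents r, 0) # rest')"
    using rewind_turn[of 0 "(contents x, int (length x)) # (contents r, 0) # rest" x M]
    unfolding map_nth_Cons2 by (auto intro!: nth_equalityI simp: rest_def rest'_def)
  moreover have "(step (rewind M) ^^ length r) (1, (contents x, int (length x) - 1) # (contents r, 0) # rest') =
      (1, (contents x, int (length x) - 1) # (contents r, int (length r)) # rest')"
    using rewind_scan[of 1 "(contents x, int (length x) - 1) # (contents r, 0) # rest'" r 0 M] by simp
  moreover have "(step (rewind M) ^^ 1) (1, (contents x, int (length x) - 1) # (contents r, int (length r)) # rest') =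
      (2, (contents x, int (length x) - 1) # (contents r, int (length r) - 1) # rest')"
    using rewind_turn[of 1 "(contents x, int (length x) - 1) # (contents r, int (length r)) # rest'" r M]
    unfolding map_nth_Cons2 by (auto intro!: nth_equalityI simp: rest_def rest'_def)
  ultimately have "(step (rewind M) ^^ (length x + (1 + (length r + 1)))) (0, (contents x, 0) # (contents r, 0) # rest) =
      (2, (contents x, int (length x) - 1) # (contents r, int (length r) - 1) # rest')"
    by (intro funpow_trans) auto
  moreover have "(contents x, int (length x) - 1) # (contents r, int (length r) - 1) # rest' =
      tapes ?K (\<lambda>i. if i = 0 then rev (bits x) else if i = 1 then rev (bits r) else [])"
  proof (rule nth_equalityI)
    fix i assume i: "i < length ((contents x, int (length x) - 1) # (contents r, int (length r) - 1) # rest')"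
    then have "i < ?K" using K by (simp add: rest'_def)
    moreover have "stack_tape [] = (contents [], -1)" by (auto simp: stack_tape_def contents_def)
    ultimately show "((contents x, int (length x) - 1) # (contents r, int (length r) - 1) # rest') ! i =
        tapes ?K (\<lambda>i. if i = 0 then rev (bits x) else if i = 1 then rev (bits r) else []) ! i"
      using i K stack_tape_contents[of x] stack_tape_contents[of r]
      by (auto simp: tapes_def rest'_def nth_Cons split: nat.splits)
  qed (use K in \<open>simp add: rest'_def tapes_def\<close>)
  ultimately show ?thesis by (simp add: init_def rest_def)
qed

section \<open>Stack programs as Turing machines with two inputs\<close>

definition env2 :: "bool list \<Rightarrow> bool list \<Rightarrow> env" where
  "env2 x r = (\<lambda>i. if i = 0 then x else if i = 1 then r else [])"

lemma esize_env2: "esize k (env2 x r) \<le> length x + length r"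
proof -
  have "esize k (env2 x r) \<le> esize (k + 2) (env2 x r)" by (rule esize_mono) simp
  also have "\<dots> = length x + length r"
    unfolding esize_def by (simp only: sum.lessThan_Suc_shift add_2_eq_Suc') (simp add: env2_def)
  finally show ?thesis .
qed

theorem fp_polytime:
  assumes "fp F"
  shows "polytime (\<lambda>x r. F (env2 x r))"
proof -
  obtain k where k: "fpk k F" using assms fp_def by blast
  \<comment> \<open>The two inputs are arguments 0 and 1. All other arguments are empty and share
    register 2, which stays empty until the result arrives there.\<close>
  define rs :: "nat \<Rightarrow> nat" where "rs = (\<lambda>i. if i = 0 then 3 else if i = 1 then 4 else 2)"
  obtain c p where c: "\<And>s e. matches k rs 5 s e \<Longrightarrow> ex c s (poly p (esize k e)) (s(5 := bits (F e)))"
    proof -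
    have "rs i < 5" for i by (simp add: rs_def)
    then show ?thesis using fpkD[OF k, of rs 5] that by blast
  qed
  obtain q where q: "\<And>e. length (F e) \<le> poly q (esize k e)" using fpk_length[OF k] by blast
  \<comment> \<open>After rewinding, the inputs have their last symbol on top, and \<open>mv\<close>
    reverses them into argument order. The final \<open>mv\<close> puts the first symbol of the
    result at the bottom, cell 0 of tape 2, as \<open>contents\<close> demands.\<close>
  let ?c = "Seq (mv 0 3) (Seq (mv 1 4) (Seq c (mv 5 2)))"
  obtain K S where "wfc K S ?c" using wfc_exists by blast
  then have wf: "wfc (K + 3) (S + 3) ?c" by (rule wfc_mono) auto
  define M where "M = compile (K + 3) (S + 3) ?c"
  have wfM: "wf_tm (rewind M)" unfolding M_def by (intro wf_rewind wf_compile wf) auto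
  let ?T = "[:0, 6:] + [:10:] + p + smult 5 q"
  have "computes_within (rewind M) x r (poly ?T (length x + length r)) (F (env2 x r))" for x r
  proof -
    let ?e = "env2 x r" and ?n = "length x + length r"
    let ?s0 = "\<lambda>i. if i = 0 then rev (bits x) else if i = 1 then rev (bits r) else []"
    let ?s1 = "?s0(0 := [], 3 := bits x)"
    let ?s2 = "?s1(1 := [], 4 := bits r)"
    let ?s3 = "?s2(5 := bits (F ?e))"
    let ?s4 = "?s2(2 := bits (rev (F ?e)))"
    have 1: "ex (mv 0 3) ?s0 (5 * length x + 1) ?s1"
      by (rule ex_cong[OF ex_mv[of _ _ "rev x"]]) auto
    have 2: "ex (mv 1 4) ?s1 (5 * length r + 1) ?s2"
      by (rule ex_cong[OF ex_mv[of _ _ "rev r"]]) auto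
    have m: "matches k rs 5 ?s2 ?e" by (auto simp: matches_def rs_def env2_def)
    have 3: "ex c ?s2 (poly p ?n) ?s3"
      by (rule ex_cong[OF c[OF m]]) (auto intro!: poly_nat_mono esize_env2)
    have "length (F ?e) \<le> poly q ?n"
      using q[of ?e] poly_nat_mono[OF esize_env2] order_trans by blast
    then have 4: "ex (mv 5 2) ?s3 (5 * poly q ?n + 1) ?s4"
      by (intro ex_cong[OF ex_mv[of _ _ "F ?e"]]) auto
    obtain t where t: "t \<le> (5 * length x + 1) + ((5 * length r + 1) + (poly p ?n + (5 * poly q ?n + 1)))"
      "(step M ^^ t) (0, tapes (K + 3) ?s0) = (nst ?c, tapes (K + 3) ?s4)"
      using compile_correct[OF ex_Seq[OF 1 ex_Seq[OF 2 ex_Seq[OF 3 4]]] wf] unfolding M_def by blast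
    have "\<exists>t'\<le>t. (step (rewind M) ^^ t') (2 + 0, tapes (K + 3) ?s0) = (2 + num_states M, tapes (K + 3) ?s4)"
    proof (rule embed_run[of M "rewind M" "\<lambda>q. 2 + q"])
      show "(step M ^^ t) (0, tapes (K + 3) ?s0) = (num_states M, tapes (K + 3) ?s4)"
        using t by (simp add: M_def)
    qed (simp_all add: rewind_def M_def trans_of_le del: nst.simps trans_of.simps)
    then obtain t' where t': "t' \<le> t"
      "(step (rewind M) ^^ t') (2, tapes (K + 3) ?s0) = (num_states (rewind M), tapes (K + 3) ?s4)"
      by auto
    have "init (rewind M) x r = init M x r" by (simp add: init_def)
    then have run: "(step (rewind M) ^^ (?n + 2 + t')) (init (rewind M) x r) =
        (num_states (rewind M), tapes (K + 3) ?s4)"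
      using rewind_init[of M x r] by (intro funpow_trans[OF _ t'(2)]) (simp add: M_def)
    have "?n + 2 + t' \<le> poly ?T ?n" using t(1) t'(1) by simp
    then have le: "?n + 2 + t' + (poly ?T ?n - (?n + 2 + t')) = poly ?T ?n" by simp
    have "(step (rewind M) ^^ poly ?T ?n) (init (rewind M) x r) =
        (num_states (rewind M), tapes (K + 3) ?s4)"
      using funpow_trans[OF run funpow_halted[of _ "rewind M" "poly ?T ?n - (?n + 2 + t')"]]
      unfolding le by (simp del: rewind_sel)
    moreover have "fst (tapes (K + 3) ?s4 ! 2) = contents (F ?e)"
      using stack_tape_contents[of "F ?e"] by (simp add: tapes_def)
    ultimately show ?thesis by (simp add: computes_within_def)
  qed
  then show ?thesis using wfM unfolding polytime_def by blast
qed

section \<open>A library of polynomial-time functions\<close>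

abbreviation fpn :: "(env \<Rightarrow> nat) \<Rightarrow> bool" where
  "fpn f \<equiv> fp (\<lambda>e. replicate (f e) True)"

abbreviation fpb :: "(env \<Rightarrow> bool) \<Rightarrow> bool" where
  "fpb P \<equiv> fp (\<lambda>e. [P e])"

definition pbe :: "(env \<Rightarrow> nat) \<Rightarrow> bool" where
  "pbe f \<longleftrightarrow> (\<exists>k p. \<forall>e. f e \<le> poly p (esize k e))"

lemma pbe_common:
  assumes "pbe f" "pbe g"
  shows "\<exists>k p q. \<forall>e. f e \<le> poly p (esize k e) \<and> g e \<le> poly q (esize k e)"
proof -
  obtain k1 p k2 q where 1: "\<And>e. f e \<le> poly p (esize k1 e)" and 2: "\<And>e. g e \<le> poly q (esize k2 e)"
    using assms unfolding pbe_def by blast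
  have "f e \<le> poly p (esize (k1 + k2) e)" "g e \<le> poly q (esize (k1 + k2) e)" for e
    using order_trans[OF 1 poly_nat_mono[OF esize_mono]] order_trans[OF 2 poly_nat_mono[OF esize_mono]]
    by simp_all
  then show ?thesis by blast
qed

lemma pbe_add [intro]: assumes "pbe f" "pbe g" shows "pbe (\<lambda>e. f e + g e)"
proof -
  obtain k p q where "\<And>e. f e \<le> poly p (esize k e)" "\<And>e. g e \<le> poly q (esize k e)"
    using pbe_common[OF assms] by blast
  then have "\<forall>e. f e + g e \<le> poly (p + q) (esize k e)" by (simp add: add_mono)
  then show ?thesis unfolding pbe_def by blast
qed

lemma pbe_mult [intro]: assumes "pbe f" "pbe g" shows "pbe (\<lambda>e. f e * g e)"
proof -
  obtain k p q where "\<And>e. f e \<le> poly p (esize k e)" "\<And>e. g e \<le> poly q (esize k e)"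
    using pbe_common[OF assms] by blast
  then have "\<forall>e. f e * g e \<le> poly (p * q) (esize k e)" by (simp add: mult_le_mono)
  then show ?thesis unfolding pbe_def by blast
qed

lemma pbe_const [intro]: "pbe (\<lambda>e. c)"
  unfolding pbe_def by (intro exI[of _ 0] exI[of _ "[:c:]"]) simp

lemma pbe_poly [intro]: assumes "pbe f" shows "pbe (\<lambda>e. poly p (f e))"
proof -
  obtain k q where "\<And>e. f e \<le> poly q (esize k e)" using assms unfolding pbe_def by blast
  then have "\<forall>e. poly p (f e) \<le> poly (pcompose p q) (esize k e)" by (simp add: poly_pcompose poly_nat_mono)
  then show ?thesis unfolding pbe_def by blast
qed

lemma pbe_esize [intro]: "pbe (esize k)"
  unfolding pbe_def by (intro exI[of _ k] exI[of _ "[:0, 1:]"]) simp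

lemma pbe_length [intro]: "fp F \<Longrightarrow> pbe (\<lambda>e. length (F e))"
  using fp_length unfolding pbe_def by blast

lemma pbe_fpn: "fpn f \<Longrightarrow> pbe f"
  using pbe_length[of "\<lambda>e. replicate (f e) True"] by simp

section \<open>Derived schemes for conditionals, Boolean connectives and lists\<close>

lemma fp_recursion:
  assumes "fpn N" "fp G" "fp (\<lambda>e. H (length (e 0)) (e (Suc 0)) (\<lambda>i. e (Suc (Suc i))))"
    and "\<And>e. R 0 e = G e" "\<And>n e. R (Suc n) e = H n (R n e) e"
    and "pbe B" "\<And>e n. n \<le> N e \<Longrightarrow> length (R n e) \<le> B e"
  shows "fp (\<lambda>e. R (N e) e)"
proof -
  obtain k p where kp: "\<And>e. B e \<le> poly p (esize k e)" using assms(6) unfolding pbe_def by blast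
  have "\<forall>e. \<forall>n \<le> length (replicate (N e) True). length (R n e) \<le> poly p (esize k e)"
    using order_trans[OF assms(7) kp] by simp
  moreover have "fp (\<lambda>e. H (length (e 0)) (e 1) (\<lambda>i. e (i + 2)))" using assms(3) by simp
  ultimately have "fp (\<lambda>e. R (length (replicate (N e) True)) e)"
    using fp_rec[of "\<lambda>e. replicate (N e) True" G H R] assms(1,2,4,5) by blast
  then show ?thesis by simp
qed

text \<open>A loop body sees the original environment behind its new components, as with de Bruijn
  indices; these rules weaken a function accordingly.\<close>

lemma fp_shift: "fp F \<Longrightarrow> fp (\<lambda>e. F (\<lambda>i. e (i + j)))"
  using fp_comp[of F "\<lambda>i e. e (i + j)"] fp_arg by blast

lemma fp_shift1: "fp F \<Longrightarrow> fp (\<lambda>e. F (\<lambda>i. e (Suc i)))"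
  using fp_shift[of F 1] by simp

lemma fp_shift2: "fp F \<Longrightarrow> fp (\<lambda>e. F (\<lambda>i. e (Suc (Suc i))))"
  using fp_shift[of F 2] by simp

lemma fp_const: "fp (\<lambda>e. xs)"
  by (induction xs) (auto intro: fp_Nil fp_Cons)

lemma fp_case:
  assumes "fp A" "fp B" "fp C" "fp D"
  shows "fp (\<lambda>e. if A e = [] then B e else if hd (A e) then C e else D e)"
proof -
  define G where "G = (\<lambda>i::nat. if i = 0 then A else if i = 1 then B else if i = 2 then C else D)"
  have "fp (G i)" for i using assms by (simp add: G_def)
  from fp_comp[OF fp_case_arg, of G, OF this] show ?thesis
    by (simp add: G_def cong: if_cong)
qed

lemma fp_if: "fpb P \<Longrightarrow> fp A \<Longrightarrow> fp B \<Longrightarrow> fp (\<lambda>e. if P e then A e else B e)"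
  using fp_case[of "\<lambda>e. [P e]" B A B] by simp

lemma fpb_const: "fpb (\<lambda>e. b)"
  by (rule fp_const)

lemma fpb_Not: "fpb P \<Longrightarrow> fpb (\<lambda>e. \<not> P e)"
  by (rule back_subst[of fp, OF fp_if[of P "\<lambda>e. [False]" "\<lambda>e. [True]"]]) (auto intro: fp_const)

lemma fpb_conj: "fpb P \<Longrightarrow> fpb Q \<Longrightarrow> fpb (\<lambda>e. P e \<and> Q e)"
  by (rule back_subst[of fp, OF fp_if[of P "\<lambda>e. [Q e]" "\<lambda>e. [False]"]]) (auto intro: fp_const)

lemma fpb_disj: "fpb P \<Longrightarrow> fpb Q \<Longrightarrow> fpb (\<lambda>e. P e \<or> Q e)"
  by (rule back_subst[of fp, OF fp_if[of P "\<lambda>e. [True]" "\<lambda>e. [Q e]"]]) (auto intro: fp_const)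

lemma fpb_iff: "fpb P \<Longrightarrow> fpb Q \<Longrightarrow> fpb (\<lambda>e. P e \<longleftrightarrow> Q e)"
  by (rule back_subst[of fp, OF fp_if[of P "\<lambda>e. [Q e]" "\<lambda>e. [\<not> Q e]"]]) (auto intro: fpb_Not)

lemma fpb_if: "fpb P \<Longrightarrow> fpb Q \<Longrightarrow> fpb R \<Longrightarrow> fpb (\<lambda>e. if P e then Q e else R e)"
  by (rule back_subst[of fp, OF fp_if[of P "\<lambda>e. [Q e]" "\<lambda>e. [R e]"]]) auto

lemma fpn_if: "fpb P \<Longrightarrow> fpn f \<Longrightarrow> fpn g \<Longrightarrow> fpn (\<lambda>e. if P e then f e else g e)"
  by (rule back_subst[of fp, OF fp_if[of P "\<lambda>e. replicate (f e) True" "\<lambda>e. replicate (g e) True"]]) auto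

lemma fp_bit_Cons: "fpb P \<Longrightarrow> fp A \<Longrightarrow> fp (\<lambda>e. P e # A e)"
  by (rule back_subst[of fp, OF fp_if[of P "\<lambda>e. True # A e" "\<lambda>e. False # A e"]]) (auto intro: fp_Cons)

lemma fpb_Nil: "fp A \<Longrightarrow> fpb (\<lambda>e. A e = [])"
  by (rule back_subst[of fp, OF fp_case[of A "\<lambda>e. [True]" "\<lambda>e. [False]" "\<lambda>e. [False]"]]) (auto intro: fp_const)

text \<open>Positions beyond the end count as \<open>False\<close>. Lookups are thus total, which
  spares range conditions in rows, parities and gate values.\<close>

definition bit_at :: "bool list \<Rightarrow> nat \<Rightarrow> bool" where
  "bit_at xs n \<longleftrightarrow> n < length xs \<and> xs ! n"

lemma bit_at_single: "bit_at [b] 0 = b"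
  by (simp add: bit_at_def)

text \<open>\<open>fp_rec\<close> loops once for each symbol of \<open>N e\<close>, whatever the
  symbols are; so \<open>A\<close> itself can serve as the loop bound that writes its own length in
  unary.\<close>

lemma fpn_length: "fp A \<Longrightarrow> fpn (\<lambda>e. length (A e))"
proof -
  assume A: "fp A"
  obtain k p where kp: "\<And>e. length (A e) \<le> poly p (esize k e)" using fp_length[OF A] by blast
  show ?thesis
    by (rule fp_rec[OF A, of "\<lambda>e. []" "\<lambda>n a e. True # a" "\<lambda>n e. replicate n True"])
      (use order_trans[OF _ kp] in \<open>auto intro!: fp_Nil fp_Cons fp_arg exI[of _ k] exI[of _ p]\<close>)
qed

lemma fp_drop: assumes "fpn n" "fp A" shows "fp (\<lambda>e. drop (n e) (A e))"
  by (rule fp_recursion[OF assms, of "\<lambda>n a e. tl a" "\<lambda>n e. drop n (A e)" "\<lambda>e. length (A e)"])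
    (auto intro!: fp_tl fp_arg assms simp: drop_Suc tl_drop)

lemma fpb_bit_at: assumes "fp A" "fpn n" shows "fpb (\<lambda>e. bit_at (A e) (n e))"
proof -
  have "fp (\<lambda>e. if drop (n e) (A e) = [] then [False] else if hd (drop (n e) (A e)) then [True] else [False])"
    by (intro fp_case fp_const fp_drop assms)
  moreover have "(if drop m xs = [] then [False] else if hd (drop m xs) then [True] else [False]) = [bit_at xs m]"
    for xs and m by (auto simp: bit_at_def hd_drop_conv_nth)
  ultimately show ?thesis by simp
qed

lemma fpb_less: assumes "fpn m" "fpn n" shows "fpb (\<lambda>e. m e < n e)"
  by (rule back_subst[of fp, OF fpb_bit_at[OF assms(2,1)]]) (auto simp: bit_at_def)

lemma fpb_le: assumes "fpn m" "fpn n" shows "fpb (\<lambda>e. m e \<le> n e)"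
  by (rule back_subst[of fp, OF fpb_Not[OF fpb_less[OF assms(2,1)]]]) auto

lemma fpb_eq: assumes "fpn m" "fpn n" shows "fpb (\<lambda>e. m e = n e)"
  by (rule back_subst[of fp, OF fpb_conj[OF fpb_le[OF assms] fpb_le[OF assms(2,1)]]]) (auto simp: eq_iff)

lemma fp_push_bit:
  assumes "fp A" "fpn n" "fp B"
  shows "fp (\<lambda>e. if n e < length (A e) then bit_at (A e) (n e) # B e else B e)"
  by (rule fp_if[OF fpb_less[OF assms(2) fpn_length[OF assms(1)]] fp_bit_Cons[OF fpb_bit_at[OF assms(1,2)] assms(3)] assms(3)])

lemma fp_rev_append: assumes "fp A" "fp B" shows "fp (\<lambda>e. rev (A e) @ B e)"
proof -
  have "fp (\<lambda>e. rev (take (length (A e)) (A e)) @ B e)"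
    by (rule fp_recursion[OF fpn_length[OF assms(1)] assms(2), of
        "\<lambda>n a e. if n < length (A e) then bit_at (A e) n # a else a"
        "\<lambda>n e. rev (take n (A e)) @ B e" "\<lambda>e. length (A e) + length (B e)"])
      (auto intro!: fp_push_bit fpn_length fp_arg assms[THEN fp_shift2] assms
        simp: take_Suc_conv_app_nth bit_at_def)
  then show ?thesis by simp
qed

lemma fp_rev: "fp A \<Longrightarrow> fp (\<lambda>e. rev (A e))"
  using fp_rev_append[OF _ fp_Nil] by simp

lemma fp_append: "fp A \<Longrightarrow> fp B \<Longrightarrow> fp (\<lambda>e. A e @ B e)"
  using fp_rev_append[OF fp_rev, of A B] by simp

lemma fp_take: assumes "fpn n" "fp A" shows "fp (\<lambda>e. take (n e) (A e))"
  by (rule fp_recursion[OF assms(1) fp_Nil, of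
        "\<lambda>n a e. if n < length (A e) then a @ [bit_at (A e) n] else a"
        "\<lambda>n e. take n (A e)" "\<lambda>e. length (A e)"])
      (auto intro!: fp_if fpb_less fp_append fpb_bit_at fpn_length fp_arg assms[THEN fp_shift2] assms
        simp: take_Suc_conv_app_nth bit_at_def)

section \<open>Unary arithmetic, bounded loops, sums and quantifiers\<close>

lemma fpn_const: "fpn (\<lambda>e. c)"
  by (rule fp_const)

lemma fpn_add: "fpn f \<Longrightarrow> fpn g \<Longrightarrow> fpn (\<lambda>e. f e + g e)"
  unfolding replicate_add by (rule fp_append)

lemma fpn_Suc: "fpn f \<Longrightarrow> fpn (\<lambda>e. Suc (f e))"
  using fp_Cons[of "\<lambda>e. replicate (f e) True" True] by simp

lemma fpn_diff: assumes "fpn f" "fpn g" shows "fpn (\<lambda>e. f e - g e)"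
  using fp_drop[OF assms(2,1)] by simp

lemma fpn_mult: assumes "fpn f" "fpn g" shows "fpn (\<lambda>e. f e * g e)"
  by (rule fp_recursion[OF assms(1) fp_Nil, of "\<lambda>n a e. replicate (g e) True @ a"
        "\<lambda>n e. replicate (n * g e) True" "\<lambda>e. f e * g e"])
    (auto intro!: fp_append fp_arg fp_shift2[OF assms(2)] assms[THEN pbe_fpn] simp: replicate_add)

lemma fpn_poly: assumes "fpn f" shows "fpn (\<lambda>e. poly p (f e))"
  by (induction p) (simp_all add: fp_Nil fpn_add fpn_mult fpn_const assms)

text \<open>The for-loop of this calculus, with the index in unary as a new first component. Sums,
  bounded quantifiers, rows of cells and the written formula are all obtained from it.\<close>

lemma fp_concat_upt:
  assumes N: "fpn N" and G: "fp (\<lambda>e. G (length (e 0)) (\<lambda>i. e (Suc i)))"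
  shows "fp (\<lambda>e. concat (map (\<lambda>i. G i e) [0..<N e]))"
proof -
  obtain k p where kp: "\<And>e. length (G (length (e 0)) (\<lambda>i. e (Suc i))) \<le> poly p (esize k e)"
    using fp_length[OF G] by blast
  have len: "length (G i e) \<le> poly p (N e + esize k e)" if "i \<le> N e" for i e
  proof -
    let ?e = "\<lambda>j. case j of 0 \<Rightarrow> replicate i True | Suc j \<Rightarrow> e j"
    have "esize k ?e \<le> esize (Suc k) ?e" by (rule esize_mono) simp
    also have "\<dots> \<le> N e + esize k e" unfolding esize_def sum.lessThan_Suc_shift using that by simp
    finally have "poly p (esize k ?e) \<le> poly p (N e + esize k e)" by (rule poly_nat_mono)
    then show ?thesis using kp[of ?e] by simp
  qed
  have "fp (\<lambda>e. e (Suc 0) @ G (length (e 0)) (\<lambda>i. e (Suc (Suc i))))"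
  proof (rule fp_append[OF fp_arg])
    show "fp (\<lambda>e. G (length (e 0)) (\<lambda>i. e (Suc (Suc i))))"
    proof -
      \<comment> \<open>In \<open>fp_recursion\<close> the accumulator is component 1.
        \<open>D\<close> skips it, so that \<open>G\<close> sees the index followed directly by the
        environment.\<close>
      define D :: "nat \<Rightarrow> env \<Rightarrow> bool list" where "D = (\<lambda>i e. e (if i = 0 then 0 else Suc i))"
      have "fp (D i)" for i unfolding D_def by (rule fp_arg)
      from fp_comp[OF G, of D, OF this] show ?thesis by (simp add: D_def)
    qed
  qed
  moreover have "length (concat (map (\<lambda>i. G i e) [0..<n])) \<le> N e * poly p (N e + esize k e)"
    if "n \<le> N e" for n e
  proof -
    have "length (concat (map (\<lambda>i. G i e) [0..<n])) = (\<Sum>i<n. length (G i e))"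
      by (simp add: length_concat comp_def interv_sum_list_conv_sum_set_nat atLeast0LessThan)
    also have "\<dots> \<le> (\<Sum>i<n. poly p (N e + esize k e))" using that by (intro sum_mono len) auto
    also have "\<dots> \<le> N e * poly p (N e + esize k e)" using that by simp
    finally show ?thesis .
  qed
  moreover have "pbe (\<lambda>e. N e * poly p (N e + esize k e))"
    by (intro pbe_mult pbe_poly pbe_add pbe_esize pbe_fpn N)
  ultimately show ?thesis
    by (intro fp_recursion[OF N fp_Nil, of "\<lambda>n a e. a @ G n e" "\<lambda>n e. concat (map (\<lambda>i. G i e) [0..<n])"
       "\<lambda>e. N e * poly p (N e + esize k e)"]) auto
qed

lemma fpn_sum:
  assumes "fpn N" "fpn (\<lambda>e. G (length (e 0)) (\<lambda>i. e (Suc i)))"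
  shows "fpn (\<lambda>e. \<Sum>i<N e. G i e)"
proof -
  have "concat (map (\<lambda>i. replicate (f i) True) [0..<n]) = replicate (\<Sum>i<n. f i) True" for f and n :: nat
    by (induction n) (simp_all add: replicate_add)
  then show ?thesis using fp_concat_upt[of N "\<lambda>i e. replicate (G i e) True"] assms by simp
qed

lemma fpb_all_less:
  assumes "fpn N" "fpb (\<lambda>e. P (length (e 0)) (\<lambda>i. e (Suc i)))"
  shows "fpb (\<lambda>e. \<forall>i < N e. P i e)"
proof -
  have "(\<forall>i<n. Q i) \<longleftrightarrow> (\<Sum>i<n. if Q i then 0 else 1) = (0 :: nat)" for n :: nat and Q
    by auto
  then show ?thesis by (simp only:) (intro fpb_eq fpn_sum fpn_if fpn_const assms)
qed

lemma fpb_ex_less: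
  assumes "fpn N" "fpb (\<lambda>e. P (length (e 0)) (\<lambda>i. e (Suc i)))"
  shows "fpb (\<lambda>e. \<exists>i < N e. P i e)"
proof -
  have "(\<exists>i<n. Q i) \<longleftrightarrow> \<not> (\<forall>i<n. \<not> Q i)" for n :: nat and Q by auto
  then show ?thesis by (simp only:) (intro fpb_Not fpb_all_less assms)
qed

lemma fpb_odd: assumes "fpn f" shows "fpb (\<lambda>e. odd (f e))"
  by (rule fp_recursion[OF assms(1) fp_const, of "\<lambda>n a e. [\<not> bit_at a 0]"
        "\<lambda>n e. [odd n]" "[False]" "\<lambda>e. 1"])
    (auto intro!: fpb_Not fpb_bit_at fp_arg fp_Nil simp: bit_at_single)

lemma fp_concat_list:
  "(\<And>x. x \<in> set xs \<Longrightarrow> fp (G x)) \<Longrightarrow> fp (\<lambda>e. concat (map (\<lambda>x. G x e) xs))"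
  by (induction xs) (auto intro: fp_Nil fp_append)

lemma fpb_ex_list:
  "(\<And>x. x \<in> set xs \<Longrightarrow> fpb (P x)) \<Longrightarrow> fpb (\<lambda>e. \<exists>x \<in> set xs. P x e)"
  by (induction xs) (auto intro: fpb_const fpb_disj)

lemma fpb_ex_upto_const:
  fixes n :: nat
  assumes "\<And>i. i < n \<Longrightarrow> fpb (P i)" shows "fpb (\<lambda>e. \<exists>i<n. P i e)"
  using fpb_ex_list[of "[0..<n]" P] assms by (simp add: Bex_def)

lemma fpb_eq_single_True: assumes "fp A" shows "fpb (\<lambda>e. A e = [True])"
proof -
  have "xs = [True] \<longleftrightarrow> bit_at xs 0 \<and> length xs = 1" for xs
    by (cases xs) (auto simp: bit_at_def)
  then show ?thesis by (simp only:) (intro fpb_conj fpb_bit_at fpn_const fpb_eq fpn_length assms)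
qed

text \<open>The decoder for \<open>enc_nat\<close>: on a string starting with
  \<open>enc_nat k\<close> it returns \<open>k\<close>.\<close>

definition ones :: "bool list \<Rightarrow> nat" where
  "ones xs = length (takeWhile id xs)"

text \<open>Recursion over prefixes: position \<open>n\<close> extends the initial run exactly if
  the count so far is \<open>n\<close>, that is, if every earlier symbol was
  \<open>True\<close>.\<close>

lemma fpn_ones: assumes "fp A" shows "fpn (\<lambda>e. ones (A e))"
proof -
  have "ones (take (Suc n) xs) = (if ones (take n xs) = n \<and> bit_at xs n then Suc (ones (take n xs)) else ones (take n xs))"
    for n xs
    by (induction xs arbitrary: n) (auto simp: ones_def bit_at_def take_Cons split: nat.splits)
  moreover have le: "ones (take n xs) \<le> length xs" for n xs
    using order_trans[OF length_takeWhile_le[of id "take n xs"]] by (simp add: ones_def)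
  moreover have "ones (take 0 xs) = 0" for xs by (simp add: ones_def)
  ultimately have "fp (\<lambda>e. replicate (ones (take (length (A e)) (A e))) True)"
    by (intro fp_recursion[OF fpn_length[OF assms(1)] fp_Nil, of
        "\<lambda>n a e. if length a = n \<and> bit_at (A e) n then True # a else a"
        "\<lambda>n e. replicate (ones (take n (A e))) True" "\<lambda>e. length (A e)"])
      (auto intro!: fp_if fpb_conj fpb_eq fpb_bit_at fpn_length fp_Cons fp_arg assms[THEN fp_shift2] assms
        simp: le)
  then show ?thesis by simp
qed

lemma fp_enc_nat: "fpn f \<Longrightarrow> fp (\<lambda>e. enc_nat (f e))"
  unfolding enc_nat_def by (intro fp_append fp_const)

section \<open>Turing machines as cellular automata centred at the heads\<close>

text \<open>Besides its neighbours a cell reads cell 0, which carries the state and the scanned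
  symbols. The rule is therefore not local, but it is uniform, and the heads never leave cell
  0.\<close>

primrec arun :: "(nat \<Rightarrow> nat \<Rightarrow> nat \<Rightarrow> nat \<Rightarrow> nat) \<Rightarrow> (nat \<Rightarrow> nat \<Rightarrow> bool \<Rightarrow> nat) \<Rightarrow>
    bool list \<Rightarrow> bool list \<Rightarrow> nat \<Rightarrow> int \<Rightarrow> nat" where
  "arun G I x r 0 i = I (contents x i) (contents r i) (i = 0)"
| "arun G I x r (Suc t) i = G (arun G I x r t 0) (arun G I x r t (i - 1)) (arun G I x r t i) (arun G I x r t (i + 1))"

type_synonym column = "nat \<times> nat list \<times> bool \<times> bool"

text \<open>Column \<open>i\<close> of a configuration: the state, the symbols at distance \<open>i\<close> from the heads, and whether the
  column is the origin of the output tape and whether it is the column of the heads. Since all tapes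
  are viewed relative to their heads, the next column is determined by the head column and the three
  neighbouring ones.\<close>

definition column :: "config \<Rightarrow> int \<Rightarrow> column" where
  "column cf i = (fst cf, map (\<lambda>t. fst t (snd t + i)) (snd cf), snd (snd cf ! 2) + i = 0, i = 0)"

text \<open>A head moving right shifts its tape to the left relative to the heads, so the new
  content comes from the right neighbour \<open>v3\<close>. The written symbol replaces the old one
  wherever the source is the head column. The origin flag travels with tape 2.\<close>

fun next_column :: "tm \<Rightarrow> column \<Rightarrow> column \<Rightarrow> column \<Rightarrow> column \<Rightarrow> column" where
  "next_column M (q, ss, _) v1 v2 v3 =
    (if q = num_states M then v2
     else let a = delta M q ss;
              src = (\<lambda>d. case d of MoveLeft \<Rightarrow> v1 | Stay \<Rightarrow> v2 | MoveRight \<Rightarrow> v3)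
       in (fst a,
           map (\<lambda>j. let v = src (snd (snd a ! j)) in if snd (snd (snd v)) then fst (snd a ! j) else fst (snd v) ! j)
             [0..<num_tapes M],
           fst (snd (snd (src (snd (snd a ! 2))))), snd (snd (snd v2))))"

definition valid_config :: "tm \<Rightarrow> config \<Rightarrow> bool" where
  "valid_config M cf \<longleftrightarrow> fst cf \<le> num_states M \<and> length (snd cf) = num_tapes M \<and>
     (\<forall>t \<in> set (snd cf). \<forall>j. fst t j < num_syms M)"

lemma valid_delta:
  assumes "wf_tm M" "valid_config M (q, ts)" "q \<noteq> num_states M" "delta M q (map read_tape ts) = (q', as)"
  shows "q' \<le> num_states M" "length as = num_tapes M" "\<And>j. j < num_tapes M \<Longrightarrow> fst (as ! j) < num_syms M"
proof -
  have "set (map read_tape ts) \<subseteq> {..<num_syms M}" "length (map read_tape ts) = num_tapes M" "q < num_states M"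
    using assms by (auto simp: valid_config_def read_tape_def)
  then have *: "q' \<le> num_states M \<and> length as = num_tapes M \<and> fst ` set as \<subseteq> {..<num_syms M}"
    using assms(1,4) unfolding wf_tm_def by (metis fst_conv snd_conv)
  then show "q' \<le> num_states M" "length as = num_tapes M" by auto
  show "fst (as ! j) < num_syms M" if "j < num_tapes M" for j
  proof -
    have "as ! j \<in> set as" using * that by simp
    then show ?thesis using * by blast
  qed
qed

lemma valid_step:
  assumes "wf_tm M" "valid_config M cf"
  shows "valid_config M (step M cf)"
proof (cases "fst cf = num_states M")
  case True
  then show ?thesis using assms by (simp add: step_def)
next
  case False
  obtain q ts where cf: "cf = (q, ts)" by (cases cf)
  obtain q' as where d: "delta M q (map read_tape ts) = (q', as)" by (cases "delta M q (map read_tape ts)")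
  have v: "q' \<le> num_states M" "length as = num_tapes M" "\<And>j. j < num_tapes M \<Longrightarrow> fst (as ! j) < num_syms M"
    using valid_delta[OF assms(1) _ _ d] assms(2) False cf by auto
  have "fst (act_tape (ts ! j) (as ! j)) i < num_syms M" if "j < num_tapes M" for i j
    using that v(3)[OF that] assms(2) by (auto simp: act_tape_def valid_config_def cf)
  then show ?thesis
    using False d v assms(2) by (auto simp: step_def cf valid_config_def set_zip)
qed

lemma valid_init: "wf_tm M \<Longrightarrow> valid_config M (init M x r)"
  by (auto simp: valid_config_def init_def contents_def wf_tm_def split: if_splits)

lemma column_step:
  assumes "wf_tm M" "valid_config M cf"
  shows "column (step M cf) i =
    next_column M (column cf 0) (column cf (i - 1)) (column cf i) (column cf (i + 1))"
proof (cases "fst cf = num_states M")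
  case True
  then show ?thesis by (simp add: step_def column_def)
next
  case False
  obtain q ts where cf: "cf = (q, ts)" by (cases cf)
  obtain q' as where d: "delta M q (map read_tape ts) = (q', as)" by (cases "delta M q (map read_tape ts)")
  have v: "q' \<le> num_states M" "length as = num_tapes M"
    using valid_delta[OF assms(1) _ _ d] assms(2) False cf by auto
  have ts: "length ts = num_tapes M" and K: "2 < num_tapes M"
    using assms by (auto simp: valid_config_def cf wf_tm_def)
  have read: "map (\<lambda>t. fst t (snd t + 0)) ts = map read_tape ts" by (simp add: read_tape_def)
  have st: "step M cf = (q', map2 act_tape ts as)" using False d by (simp add: step_def cf)
  have False': "q \<noteq> num_states M" using False cf by simp
  have c0: "column cf 0 = (q, map read_tape ts, snd (ts ! 2) = 0, True)"
    using read by (simp add: column_def cf)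
  have cen: "snd (snd (snd (column cf i))) \<longleftrightarrow> i = 0" by (simp add: column_def)
  define src where "src = (\<lambda>d. case d of MoveLeft \<Rightarrow> column cf (i - 1) | Stay \<Rightarrow> column cf i | MoveRight \<Rightarrow> column cf (i + 1))"
  have src: "src d = column cf (i + offset d)" for d by (cases d) (simp_all add: src_def)
  have nx: "next_column M (column cf 0) (column cf (i - 1)) (column cf i) (column cf (i + 1)) =
      (q', map (\<lambda>j. let v = src (snd (as ! j)) in if snd (snd (snd v)) then fst (as ! j) else fst (snd v) ! j)
             [0..<num_tapes M], fst (snd (snd (src (snd (as ! 2))))), i = 0)"
    unfolding c0 next_column.simps using False' d cen by (simp add: src_def Let_def cong: if_cong)
  have cell: "fst (act_tape (ts ! j) (as ! j)) (snd (act_tape (ts ! j) (as ! j)) + i) =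
      (let v = src (snd (as ! j)) in if snd (snd (snd v)) then fst (as ! j) else fst (snd v) ! j)"
    if "j < num_tapes M" for j
    using that ts by (auto simp: src column_def cf act_tape_def algebra_simps)
  have "map (\<lambda>t. fst t (snd t + i)) (map2 act_tape ts as) =
      map (\<lambda>j. let v = src (snd (as ! j)) in if snd (snd (snd v)) then fst (as ! j) else fst (snd v) ! j) [0..<num_tapes M]"
    by (rule nth_equalityI) (use ts v cell in \<open>auto simp: Let_def cong: if_cong\<close>)
  moreover have "snd (map2 act_tape ts as ! 2) + i = 0 \<longleftrightarrow> fst (snd (snd (src (snd (as ! 2)))))"
    using ts v K by (simp add: src column_def cf act_tape_def algebra_simps)
  ultimately show ?thesis unfolding nx st by (simp add: column_def)
qed

text \<open>Confines the output to a window around the heads whose size depends only on the time;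
  validity ensures that only finitely many columns occur.\<close>

lemma output_tape_bounds:
  assumes "wf_tm M" "cf = (step M ^^ t) (init M x r)"
  shows "valid_config M cf \<and> \<bar>snd (snd cf ! 2)\<bar> \<le> int t \<and> (\<forall>i. fst (snd cf ! 2) i \<noteq> 0 \<longrightarrow> \<bar>i\<bar> < int t)"
  using assms(2)
proof (induction t arbitrary: cf)
  case 0
  have "snd (init M x r) ! 2 = (contents [], 0)"
    using assms(1) by (auto simp: init_def wf_tm_def nth_Cons split: nat.splits)
  then show ?case using 0 valid_init[OF assms(1)] by (auto simp: contents_def)
next
  case (Suc t)
  define c where "c = (step M ^^ t) (init M x r)"
  have IH: "valid_config M c" "\<bar>snd (snd c ! 2)\<bar> \<le> int t" "\<And>i. fst (snd c ! 2) i \<noteq> 0 \<Longrightarrow> \<bar>i\<bar> < int t"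
    using Suc.IH[OF c_def] by auto
  have cf: "cf = step M c" using Suc.prems by (simp add: c_def)
  have v: "valid_config M cf" unfolding cf by (rule valid_step[OF assms(1) IH(1)])
  show ?case
  proof (cases "fst c = num_states M")
    case True
    then have "cf = c" by (simp add: cf step_def)
    moreover have "\<bar>i\<bar> < int (Suc t)" if "fst (snd c ! 2) i \<noteq> 0" for i using IH(3)[OF that] by simp
    ultimately show ?thesis using IH(1,2) by simp
  next
    case False
    obtain q ts where c: "c = (q, ts)" by (cases c)
    obtain q' as where d: "delta M q (map read_tape ts) = (q', as)" by (cases "delta M q (map read_tape ts)")
    have "length as = num_tapes M" using valid_delta[OF assms(1) _ _ d] IH(1) False c by auto
    moreover have "length ts = num_tapes M" "2 < num_tapes M"
      using IH assms by (auto simp: valid_config_def c wf_tm_def)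
    ultimately have "snd cf ! 2 = act_tape (ts ! 2) (as ! 2)"
      using False d by (simp add: cf step_def c)
    moreover have "\<bar>offset (snd (as ! 2))\<bar> \<le> 1" by (cases "snd (as ! 2)") auto
    ultimately have "\<bar>snd (snd cf ! 2)\<bar> \<le> int (Suc t)"
      using IH(2) by (simp add: act_tape_def c)
    moreover have "\<bar>i\<bar> < int (Suc t)" if "fst (snd cf ! 2) i \<noteq> 0" for i
      using that IH(2) IH(3)[of i] \<open>snd cf ! 2 = _\<close> by (auto simp: act_tape_def c split: if_splits)
    ultimately show ?thesis using v by simp
  qed
qed

text \<open>The finitely many columns are numbered. \<open>h\<close> is the head position on the
  output tape, so cell \<open>i\<close> shows output cell \<open>h + i\<close>, and
  \<open>org\<close> marks where the output begins.\<close>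

theorem tm_automaton:
  assumes "wf_tm M"
  shows "\<exists>N G I sym org. (\<forall>a b z. I a b z < N) \<and> (\<forall>u v1 v2 v3. G u v1 v2 v3 < N) \<and>
    (\<forall>x r T out. computes_within M x r T out \<longrightarrow> length out \<le> T \<and>
       (\<exists>h. \<bar>h\<bar> \<le> int T \<and> (\<forall>i. sym (arun G I x r T i) = contents out (h + i)) \<and>
          (\<forall>i. org (arun G I x r T i) \<longleftrightarrow> h + i = 0)))"
proof -
  let ?K = "num_tapes M"
  define COL :: "column set" where
    "COL = {..num_states M} \<times> {ss. set ss \<subseteq> {..<num_syms M} \<and> length ss = ?K} \<times> UNIV \<times> UNIV"
  have fin: "finite COL" unfolding COL_def by (intro finite_cartesian_product finite_lists_length_eq) auto
  obtain h0 where h0: "bij_betw h0 COL {0..<card COL}" using ex_bij_betw_finite_nat[OF fin] by blast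
  \<comment> \<open>The successor leaves room for the default code 0 of tuples outside
    \<open>COL\<close>, so all codes are below \<open>N\<close> unconditionally.\<close>
  define N where "N = Suc (card COL)"
  define en where "en = (\<lambda>v. if v \<in> COL then h0 v else 0)"
  define de where "de = inv_into COL h0"
  have en_less: "en v < N" for v
    using bij_betwE[OF h0] by (auto simp: en_def N_def intro: less_SucI)
  have de_en: "de (en v) = v" if "v \<in> COL" for v
    using that h0 by (simp add: de_def en_def bij_betw_inv_into_left)
  define G where "G = (\<lambda>u v1 v2 v3. en (next_column M (de u) (de v1) (de v2) (de v3)))"
  define I where "I = (\<lambda>a b z. en (0, a # b # replicate (?K - 2) 0, z, z))"
  define sym where "sym = (\<lambda>v. fst (snd (de v)) ! 2)"
  define org where "org = (\<lambda>v. fst (snd (snd (de v))))"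
  have K: "2 < ?K" using assms by (simp add: wf_tm_def)
  have col: "column cf i \<in> COL" if "valid_config M cf" for cf i
    using that by (auto simp: column_def COL_def valid_config_def)
  have run: "arun G I x r t i = en (column ((step M ^^ t) (init M x r)) i)" for x r t i
  proof (induction t arbitrary: i)
    case 0
    then show ?case using K by (simp add: I_def column_def init_def contents_def nth_Cons split: nat.splits)
  next
    case (Suc t)
    have "valid_config M ((step M ^^ t) (init M x r))" using output_tape_bounds[OF assms] by blast
    moreover have "G (en a) (en b) (en c) (en d) = en (next_column M a b c d)"
      if "a \<in> COL" "b \<in> COL" "c \<in> COL" "d \<in> COL" for a b c d
      using that by (simp add: G_def de_en)
    ultimately show ?case by (simp add: Suc column_step[OF assms] col)
  qed
  have "length out \<le> T \<and> (\<exists>h. \<bar>h\<bar> \<le> int T \<and> (\<forall>i. sym (arun G I x r T i) = contents out (h + i)) \<and>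
          (\<forall>i. org (arun G I x r T i) \<longleftrightarrow> h + i = 0))"
    if "computes_within M x r T out" for x r T out
  proof -
    define cf where "cf = (step M ^^ T) (init M x r)"
    have b: "valid_config M cf" "\<bar>snd (snd cf ! 2)\<bar> \<le> int T" "\<And>i. fst (snd cf ! 2) i \<noteq> 0 \<Longrightarrow> \<bar>i\<bar> < int T"
      using output_tape_bounds[OF assms cf_def] by auto
    have o: "fst (snd cf ! 2) = contents out" using that by (simp add: computes_within_def cf_def Let_def)
    have "length out \<le> T"
    proof (cases "out = []")
      case False
      then have "contents out (int (length out - 1)) \<noteq> 0" by (simp add: contents_def)
      then have "int (length out - 1) < int T" using b(3)[of "int (length out - 1)"] by (simp add: o)
      then show ?thesis using False by simp
    qed simp
    moreover have "sym (arun G I x r T i) = contents out (snd (snd cf ! 2) + i)" for i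
    proof -
      have "2 < length (snd cf)" using b(1) K by (simp add: valid_config_def)
      then show ?thesis
        unfolding run sym_def cf_def[symmetric] using de_en[OF col[OF b(1)]] by (simp add: column_def o)
    qed
    moreover have "org (arun G I x r T i) \<longleftrightarrow> snd (snd cf ! 2) + i = 0" for i
      unfolding run org_def cf_def[symmetric] using de_en[OF col[OF b(1)]] by (simp add: column_def)
    ultimately show ?thesis using b(2) by blast
  qed
  moreover have "I a b z < N" "G u v1 v2 v3 < N" for a b z u v1 v2 v3
    by (simp_all add: I_def G_def en_less)
  ultimately show ?thesis by (intro exI[of _ N] exI[of _ G] exI[of _ I] exI[of _ sym] exI[of _ org]) auto
qed

subsection \<open>Simulating a Turing machine by a stack program\<close>

text \<open>The automaton lives on the integers, finite rows on naturals: position \<open>p\<close>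
  stands for the integer \<open>p - C\<close>.\<close>

definition symb :: "bool list \<Rightarrow> nat \<Rightarrow> nat \<Rightarrow> nat" where
  "symb x C p = (if C \<le> p \<and> p - C < length x then if bit_at x (p - C) then 2 else 1 else 0)"

lemma contents_symb: "contents x (int p - int C) = symb x C p"
  by (auto simp: contents_def symb_def bit_at_def nat_diff_distrib simp flip: of_nat_diff)

lemma fpn_symb: "fp x \<Longrightarrow> fpn C \<Longrightarrow> fpn p \<Longrightarrow> fpn (\<lambda>e. symb (x e) (C e) (p e))"
  unfolding symb_def
  by (intro fpn_if fpb_conj fpb_le fpb_less fpb_bit_at fpn_diff fpn_length fp_const)

text \<open>With \<open>Q p v\<close> for "cell \<open>p\<close> holds \<open>v\<close>" this is a
  one-hot code, in which testing a value is one lookup at \<open>N * p + v\<close>. The nested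
  concatenations match the loop rules.\<close>

definition grid :: "nat \<Rightarrow> nat \<Rightarrow> (nat \<Rightarrow> nat \<Rightarrow> bool) \<Rightarrow> bool list" where
  "grid P N Q = concat (map (\<lambda>p. concat (map (\<lambda>v. [Q p v]) [0..<N])) [0..<P])"

lemma length_grid: "length (grid P N Q) = P * N"
  by (simp add: grid_def length_concat comp_def sum_list_triv)

lemma grid_Suc: "grid (Suc P) N Q = grid P N Q @ map (Q P) [0..<N]"
  by (simp add: grid_def)

lemma bit_at_grid: "p < P \<Longrightarrow> v < N \<Longrightarrow> bit_at (grid P N Q) (N * p + v) = Q p v"
proof (induction P)
  case (Suc P)
  show ?case
  proof (cases "p = P")
    case True
    then show ?thesis using Suc.prems by (simp add: bit_at_def grid_Suc nth_append length_grid mult.commute)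
  next
    case False
    then have p: "p < P" using Suc.prems by simp
    have "N * p + v < N * Suc p" using Suc.prems by simp
    also have "\<dots> \<le> N * P" using p by (intro mult_le_mono) auto
    finally have "N * p + v < length (grid P N Q)" by (simp add: length_grid mult.commute)
    then show ?thesis using Suc.IH[OF p] Suc.prems by (simp add: bit_at_def grid_Suc nth_append)
  qed
qed simp

lemma fp_grid:
  assumes "fpn P" "\<And>v. v < N \<Longrightarrow> fpb (\<lambda>e. Q (length (e 0)) v (\<lambda>i. e (Suc i)))"
  shows "fp (\<lambda>e. grid (P e) N (\<lambda>p v. Q p v e))"
  unfolding grid_def by (intro fp_concat_upt[OF assms(1)] fp_concat_list) (use assms(2) in auto)

text \<open>Blank cells contribute nothing, so a window that begins at or before the origin yields a
  prefix of the output.\<close>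

lemma concat_contents:
  assumes "s \<le> 0" "g 0 = []" "g 1 = [False]" "g 2 = [True]"
  shows "concat (map (\<lambda>p. g (contents out (s + int p))) [0..<W]) = take (nat (s + int W)) out"
proof (induction W)
  case 0
  then show ?case using assms by simp
next
  case (Suc W)
  have "nat (s + int (Suc W)) = (if 0 \<le> s + int W then Suc (nat (s + int W)) else 0)" by auto
  then show ?case using Suc assms by (auto simp: contents_def take_Suc_conv_app_nth not_le)
qed

theorem fp_of_polytime_arg:
  assumes "polytime f"
  shows "fp (\<lambda>e. f (e 0) (e 1))"
proof -
  obtain M p where M: "wf_tm M" and comp: "\<And>x r. computes_within M x r (poly p (length x + length r)) (f x r)"
    using assms unfolding polytime_def by blast
  obtain N G I sym org where I: "\<And>a b z. I a b z < N" and G: "\<And>u v1 v2 v3. G u v1 v2 v3 < N"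
    and run: "\<And>x r T out. computes_within M x r T out \<Longrightarrow> length out \<le> T \<and>
       (\<exists>h. \<bar>h\<bar> \<le> int T \<and> (\<forall>i. sym (arun G I x r T i) = contents out (h + i)) \<and>
          (\<forall>i. org (arun G I x r T i) \<longleftrightarrow> h + i = 0))"
    using tm_automaton[OF M] by metis
  define T where "T = (\<lambda>e :: env. poly p (length (e 0) + length (e 1)))"
  \<comment> \<open>Cells outside the row are unknown, and the error moves inwards by one cell per
    step; after \<open>T e\<close> steps cells T to 4T - 1 are still right. With the origin at 2T
    they show the output cells from h - T \<le> 0 to h + 2T - 1 \<ge> T - 1, hence the whole
    output.\<close>
  define C where "C = (\<lambda>e. 2 * T e)"
  define P where "P = (\<lambda>e. 5 * T e)"
  define A where "A = (\<lambda>t i e. arun G I (e 0) (e 1) t (int i - int (C e)))"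
  have less: "A t i e < N" for t i e by (cases t) (simp_all add: A_def I G)
  \<comment> \<open>\<open>N\<close> is a constant, so the four cell values are guessed by fixed
    finite disjunctions, and the arbitrary function \<open>G\<close> enters only through
    constants.\<close>
  define H where "H = (\<lambda>a e. grid (P e) N (\<lambda>p v. \<exists>u<N. \<exists>v1<N. \<exists>v2<N. \<exists>v3<N. G u v1 v2 v3 = v \<and>
    bit_at a (N * C e + u) \<and> bit_at a (N * (p - 1) + v1) \<and> bit_at a (N * p + v2) \<and> bit_at a (N * (p + 1) + v3)))"
  define R where "R = (\<lambda>n e. ((\<lambda>a. H a e) ^^ n) (grid (P e) N (\<lambda>p v. A 0 p e = v)))"
  have len: "length (R n e) = P e * N" for n e by (cases n) (simp_all add: R_def H_def length_grid)
  have correct: "bit_at (R t e) (N * p + v) \<longleftrightarrow> A t p e = v"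
    if "t \<le> p" "p + t < P e" "v < N" "t \<le> T e" for t p v e
    using that
  proof (induction t arbitrary: p v)
    case 0
    then show ?case by (simp add: R_def bit_at_grid)
  next
    case (Suc t)
    have IH: "bit_at (R t e) (N * q + w) \<longleftrightarrow> A t q e = w" if "t \<le> q" "q + t < P e" "w < N" for q w
      using Suc that by simp
    have c: "t \<le> C e" "C e + t < P e" using Suc.prems by (simp_all add: C_def P_def)
    have pp: "t \<le> p - 1" "p - 1 + t < P e" "t \<le> p" "p + t < P e" "t \<le> p + 1" "p + 1 + t < P e" "1 \<le> p"
      using Suc.prems by auto
    have "A (Suc t) p e = G (A t (C e) e) (A t (p - 1) e) (A t p e) (A t (p + 1) e)"
      using pp(7) by (simp add: A_def algebra_simps of_nat_diff)
    moreover have "bit_at (R (Suc t) e) (N * p + v) \<longleftrightarrow>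
      (\<exists>u<N. \<exists>v1<N. \<exists>v2<N. \<exists>v3<N. G u v1 v2 v3 = v \<and> A t (C e) e = u \<and> A t (p - 1) e = v1 \<and>
        A t p e = v2 \<and> A t (p + 1) e = v3)"
      using Suc.prems IH[OF c] IH[OF pp(1,2)] IH[OF pp(3,4)] IH[OF pp(5,6)]
      by (simp add: R_def H_def bit_at_grid cong: conj_cong)
    ultimately show ?case using less by auto
  qed
  define g where "g = (\<lambda>b::nat. if b = 2 then [True] else if b = 1 then [False] else [])"
  define W where "W = (\<lambda>e. concat (map (\<lambda>p. concat (map (\<lambda>v. if bit_at (R (T e) e) (N * (T e + p) + v) then g (sym v) else [])
    [0..<N])) [0..<3 * T e]))"
  have "W = (\<lambda>e. f (e 0) (e 1))"
  proof
    fix e :: env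
    let ?out = "f (e 0) (e 1)"
    have "computes_within M (e 0) (e 1) (T e) ?out" using comp by (simp add: T_def)
    then obtain h where l: "length ?out \<le> T e" and h: "\<bar>h\<bar> \<le> int (T e)"
      and s: "\<And>i. sym (arun G I (e 0) (e 1) (T e) i) = contents ?out (h + i)"
      using run by blast
    have "concat (map (\<lambda>v. if bit_at (R (T e) e) (N * (T e + p) + v) then g (sym v) else []) [0..<N]) =
        g (contents ?out (h - int (T e) + int p))" if "p < 3 * T e" for p
    proof -
      have "concat (map (\<lambda>v. if bit_at (R (T e) e) (N * (T e + p) + v) then g (sym v) else []) [0..<N]) =
          concat (map (\<lambda>v. if A (T e) (T e + p) e = v then g (sym v) else []) [0..<N])"
        using that correct[of "T e" "T e + p" e] by (intro arg_cong[of _ _ concat] map_cong) (auto simp: P_def)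
      also have "\<dots> = g (sym (A (T e) (T e + p) e))"
      proof -
        have "concat (map (\<lambda>v. if a = v then g' v else []) [0..<n]) = (if a < n then g' a else [])"
          for a n :: nat and g' :: "nat \<Rightarrow> bool list"
          by (induction n) auto
        then show ?thesis using less by simp
      qed
      also have "\<dots> = g (contents ?out (h - int (T e) + int p))"
        using s[of "int p - int (T e)"] by (simp add: A_def C_def algebra_simps)
      finally show ?thesis .
    qed
    then have "W e = concat (map (\<lambda>p. g (contents ?out (h - int (T e) + int p))) [0..<3 * T e])"
      unfolding W_def by (intro arg_cong[of _ _ concat] map_cong) auto
    also have "\<dots> = take (nat (h - int (T e) + int (3 * T e))) ?out"
      by (rule concat_contents) (use h in \<open>auto simp: g_def\<close>)
    also have "\<dots> = ?out" using h l by (intro take_all) linarith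
    finally show "W e = f (e 0) (e 1)" .
  qed
  moreover have "fp W"
  proof -
    have T: "fpn (\<lambda>e. T (\<lambda>i. e (d + i)))" for d
      unfolding T_def by (intro fpn_poly fpn_add fpn_length fp_arg)
    have fpR: "fp (\<lambda>e. R (T e) e)"
    proof (rule fp_recursion[of T "\<lambda>e. grid (P e) N (\<lambda>p v. A 0 p e = v)" "\<lambda>n a e. H a e"])
      show "fpn T" using T[of 0] by simp
      have "A 0 p e = v \<longleftrightarrow> (\<exists>a<3. \<exists>b<3. symb (e 0) (C e) p = a \<and> symb (e 1) (C e) p = b \<and>
          (if p = C e then I a b True = v else I a b False = v))" for p v e
      proof -
        have "symb x c p < 3" for x c by (simp add: symb_def)
        then show ?thesis by (auto simp: A_def contents_symb)
      qed
      then show "fp (\<lambda>e. grid (P e) N (\<lambda>p v. A 0 p e = v))"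
        unfolding P_def C_def T_def by (simp only:)
          (intro fp_grid fpb_ex_upto_const fpb_conj fpb_eq fpn_symb fpb_if fpn_mult fpn_poly fpn_add fpn_length
            fp_arg fp_const)
      show "fp (\<lambda>e. H (e (Suc 0)) (\<lambda>i. e (Suc (Suc i))))"
        unfolding H_def P_def C_def T_def
        by (intro fp_grid fpb_ex_upto_const fpb_conj fpb_bit_at fpn_mult fpn_poly fpn_add fpn_diff fpn_length
            fp_arg fp_const)
      show "pbe (\<lambda>e. P e * N)"
        unfolding P_def T_def by (intro pbe_mult pbe_const pbe_poly pbe_add pbe_length fp_arg)
      show "length (R n e) \<le> P e * N" for n e by (simp add: len)
    qed (simp_all add: R_def)
    define S where "S = (\<lambda>e :: env. concat (map (\<lambda>p. concat (map (\<lambda>v. if bit_at (e 0) (N * (T (\<lambda>i. e (Suc i)) + p) + v)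
        then g (sym v) else []) [0..<N])) [0..<3 * T (\<lambda>i. e (Suc i))]))"
    have "fp S"
      unfolding S_def T_def
      by (intro fp_concat_upt fp_concat_list fp_if fpb_bit_at fpn_mult fpn_poly fpn_add fpn_length
            fp_arg fp_const)
    moreover define D where "D = (\<lambda>i e. if i = 0 then R (T e) e else e (i - 1))"
    moreover have "fp (D i)" for i unfolding D_def by (cases "i = 0") (auto intro: fpR fp_arg)
    ultimately have "fp (\<lambda>e. S (\<lambda>i. D i e))" using fp_comp[of S D] by blast
    moreover have "S (\<lambda>i. D i e) = W e" for e unfolding S_def W_def D_def by simp
    ultimately show ?thesis by simp
  qed
  ultimately show ?thesis by simp
qed

lemma fp_of_polytime:
  assumes "polytime f" "fp A" "fp B"
  shows "fp (\<lambda>e. f (A e) (B e))"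
proof -
  define D where "D = (\<lambda>i::nat. if i = 0 then A else B)"
  have "fp (D i)" for i using assms by (simp add: D_def)
  from fp_comp[OF fp_of_polytime_arg[OF assms(1)], of D, OF this] show ?thesis by (simp add: D_def)
qed

section \<open>Formulas expressing accepting computations\<close>

abbreviation "YV j \<equiv> FVar (Y j)"

text \<open>Formulas have no constants; \<open>Y 1\<close> is an output of every instance that is
  built.\<close>

definition f_true :: form where "f_true = FOr (YV 1) (FNot (YV 1))"
definition f_false :: form where "f_false = FAnd (YV 1) (FNot (YV 1))"

definition conj_list :: "form list \<Rightarrow> form" where
  "conj_list fs = foldr FAnd fs f_true"

definition disj_list :: "form list \<Rightarrow> form" where
  "disj_list fs = foldr FOr fs f_false"

lemma form_val_conj_list: "form_val (conj_list fs) x y \<longleftrightarrow> (\<forall>f \<in> set fs. form_val f x y)"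
  by (induction fs) (auto simp: conj_list_def f_true_def)

lemma form_val_disj_list: "form_val (disj_list fs) x y \<longleftrightarrow> (\<exists>f \<in> set fs. form_val f x y)"
  by (induction fs) (auto simp: disj_list_def f_false_def)

lemma vars_conj_list: "vars (conj_list fs) = insert (Y 1) (\<Union>f \<in> set fs. vars f)"
  by (induction fs) (auto simp: conj_list_def f_true_def)

lemma vars_disj_list: "vars (disj_list fs) = insert (Y 1) (\<Union>f \<in> set fs. vars f)"
  by (induction fs) (auto simp: disj_list_def f_false_def)

lemma length_le_fsize_conj_list: "length fs \<le> fsize (conj_list fs)"
  by (induction fs) (auto simp: conj_list_def)

locale centred_automaton =
  fixes N :: nat and G :: "nat \<Rightarrow> nat \<Rightarrow> nat \<Rightarrow> nat \<Rightarrow> nat" and I :: "nat \<Rightarrow> nat \<Rightarrow> bool \<Rightarrow> nat"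
    and sym :: "nat \<Rightarrow> nat" and org :: "nat \<Rightarrow> bool"
  assumes I_less: "I a b c < N" and G_less: "G u v1 v2 v3 < N"
begin

text \<open>\<open>Y 1\<close> is the selected bit and \<open>Y 2\<close> to
  \<open>Y (m + 1)\<close> are the witness. The facts follow in mixed radix, with digits
  \<open>v < N\<close>, \<open>p < 4 * T + 2\<close> and leading digit \<open>t\<close>.\<close>

definition fact_index :: "nat \<Rightarrow> nat \<Rightarrow> nat \<Rightarrow> nat \<Rightarrow> nat \<Rightarrow> nat" where
  "fact_index m T t p v = 2 + m + (v + N * (p + (4 * T + 2) * t))"

text \<open>The variable \<open>fact_index m T t p v\<close> says that at time \<open>t\<close> column \<open>p\<close> has the value \<open>v\<close>. The clauses are
  implications from facts to facts, so a satisfying assignment makes at least the facts of the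
  actual computation true; the last clauses exclude those of a rejecting one.\<close>

definition fact :: "nat \<Rightarrow> nat \<Rightarrow> nat \<Rightarrow> nat \<Rightarrow> nat \<Rightarrow> form" where
  "fact m T t p v = YV (fact_index m T t p v)"

text \<open>The input symbols are known when the formula is written, the witness symbols are not: a
  witness cell needs one clause for symbol 2 (bit true) and one for symbol 1.\<close>

definition init_clauses :: "bool list \<Rightarrow> nat \<Rightarrow> nat \<Rightarrow> form list" where
  "init_clauses z m T = concat (map (\<lambda>p.
     if 2 * T \<le> p \<and> p < 2 * T + m then
       [FOr (FNot (YV (2 + (p - 2 * T)))) (fact m T 0 p (I (symb z (2 * T) p) 2 (p = 2 * T))),
        FOr (YV (2 + (p - 2 * T))) (fact m T 0 p (I (symb z (2 * T) p) 1 (p = 2 * T)))]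
     else [fact m T 0 p (I (symb z (2 * T) p) 0 (p = 2 * T))]) [0..<4 * T + 2])"

definition step_clauses :: "nat \<Rightarrow> nat \<Rightarrow> form list" where
  "step_clauses m T = concat (map (\<lambda>t. concat (map (\<lambda>p.
     concat (map (\<lambda>u. concat (map (\<lambda>v1. concat (map (\<lambda>v2. concat (map (\<lambda>v3.
       [FOr (FNot (FAnd (FAnd (fact m T t (2 * T) u) (fact m T t p v1))
                        (FAnd (fact m T t (p + 1) v2) (fact m T t (p + 2) v3))))
            (fact m T (t + 1) (p + 1) (G u v1 v2 v3))])
     [0..<N])) [0..<N])) [0..<N])) [0..<N])) [0..<4 * T])) [0..<T])"

text \<open>The output is \<open>[True]\<close> exactly if its origin carries symbol 2 and the next
  cell is blank, so two adjacent columns decide.\<close>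

definition final_clauses :: "nat \<Rightarrow> nat \<Rightarrow> form list" where
  "final_clauses m T = concat (map (\<lambda>p. concat (map (\<lambda>v. concat (map (\<lambda>v'.
     if org v \<and> \<not> (sym v = 2 \<and> sym v' = 0) then [FNot (FAnd (fact m T T p v) (fact m T T (p + 1) v'))] else [])
     [0..<N])) [0..<N])) [0..<4 * T + 1])"

definition selector_clauses :: "nat \<Rightarrow> form list" where
  "selector_clauses m =
     concat (map (\<lambda>j. [FOr (FNot (FAnd (FVar (X (Suc j))) (YV (2 + j)))) (YV 1)]) [0..<m]) @
     [FOr (FNot (YV 1)) (disj_list (map (\<lambda>j. FAnd (FVar (X (Suc j))) (YV (2 + j))) [0..<m]))]"

definition tableau :: "bool list \<Rightarrow> nat \<Rightarrow> nat \<Rightarrow> form" where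
  "tableau z m T = conj_list (selector_clauses m @ init_clauses z m T @ step_clauses m T @ final_clauses m T)"

definition num_outputs :: "nat \<Rightarrow> nat \<Rightarrow> nat" where
  "num_outputs m T = 2 + m + N * ((4 * T + 2) * (T + 1))"

lemma fact_index_le:
  assumes "v < N" "p < 4 * T + 2" "t \<le> T"
  shows "fact_index m T t p v \<le> num_outputs m T"
proof -
  have "p + (4 * T + 2) * t < (4 * T + 2) * Suc t" using assms by simp
  also have "\<dots> \<le> (4 * T + 2) * (T + 1)" using assms by (intro mult_le_mono) auto
  finally have "Suc (p + (4 * T + 2) * t) \<le> (4 * T + 2) * (T + 1)" by simp
  then have "N * Suc (p + (4 * T + 2) * t) \<le> N * ((4 * T + 2) * (T + 1))" by (rule mult_le_mono2)
  then show ?thesis using assms(1) by (simp add: fact_index_def num_outputs_def)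
qed

lemma vars_tableau: "vars (tableau z m T) \<subseteq> all_vars m (num_outputs m T)"
proof -
  have Y: "Y j \<in> all_vars m (num_outputs m T) \<longleftrightarrow> 1 \<le> j \<and> j \<le> num_outputs m T" for j
    by (auto simp: all_vars_def)
  have X: "X j \<in> all_vars m (num_outputs m T) \<longleftrightarrow> 1 \<le> j \<and> j \<le> m" for j
    by (auto simp: all_vars_def)
  have f: "vars (fact m T t p v) \<subseteq> all_vars m (num_outputs m T)"
    if "v < N" "p < 4 * T + 2" "t \<le> T" for t p v
    using fact_index_le[OF that, of m] by (auto simp: fact_def Y) (simp add: fact_index_def)
  have no: "2 + m \<le> num_outputs m T" by (simp add: num_outputs_def)
  have "vars g \<subseteq> all_vars m (num_outputs m T)" if "g \<in> set (selector_clauses m)" for g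
    using that no by (auto simp: selector_clauses_def vars_disj_list X Y)
  moreover have "vars g \<subseteq> all_vars m (num_outputs m T)" if i: "g \<in> set (init_clauses z m T)" for g
  proof -
    have in_concat: "f \<in> set (concat (map F xs)) \<longleftrightarrow> (\<exists>p \<in> set xs. f \<in> set (F p))"
      for f :: form and F and xs :: "nat list" by auto
    obtain p where p: "p \<in> set [0..<4 * T + 2]" and g: "g \<in> set (if 2 * T \<le> p \<and> p < 2 * T + m then
       [FOr (FNot (YV (2 + (p - 2 * T)))) (fact m T 0 p (I (symb z (2 * T) p) 2 (p = 2 * T))),
        FOr (YV (2 + (p - 2 * T))) (fact m T 0 p (I (symb z (2 * T) p) 1 (p = 2 * T)))]
     else [fact m T 0 p (I (symb z (2 * T) p) 0 (p = 2 * T))])"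
      using i unfolding init_clauses_def in_concat by (rule bexE)
    have fa: "vars (fact m T 0 p (I a b c)) \<subseteq> all_vars m (num_outputs m T)" for a b c
      using p by (intro f I_less) auto
    have "Y (2 + (p - 2 * T)) \<in> all_vars m (num_outputs m T)" if "p < 2 * T + m"
      using that no unfolding Y by simp
    then show ?thesis
      using g fa by (cases "2 * T \<le> p \<and> p < 2 * T + m") (simp; elim disjE; simp)+
  qed
  moreover have "vars g \<subseteq> all_vars m (num_outputs m T)" if g': "g \<in> set (step_clauses m T)" for g
  proof -
    obtain t p u v1 v2 v3 where *: "t < T" "p < 4 * T" "u < N" "v1 < N" "v2 < N" "v3 < N"
      and g: "g = FOr (FNot (FAnd (FAnd (fact m T t (2 * T) u) (fact m T t p v1))
                        (FAnd (fact m T t (p + 1) v2) (fact m T t (p + 2) v3))))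
            (fact m T (t + 1) (p + 1) (G u v1 v2 v3))"
      using g' by (auto simp: step_clauses_def)
    show ?thesis unfolding g vars.simps by (intro Un_least f) (use * G_less in auto)
  qed
  moreover have "vars g \<subseteq> all_vars m (num_outputs m T)" if g': "g \<in> set (final_clauses m T)" for g
  proof -
    have "\<exists>p \<in> set [0..<4 * T + 1]. \<exists>v \<in> set [0..<N]. \<exists>v' \<in> set [0..<N].
        g = FNot (FAnd (fact m T T p v) (fact m T T (p + 1) v'))"
      using g' unfolding final_clauses_def set_concat set_map by (auto split: if_splits simp del: set_upt) blast+
    then obtain p v v' where *: "p < 4 * T + 1" "v < N" "v' < N"
      and g: "g = FNot (FAnd (fact m T T p v) (fact m T T (p + 1) v'))"
      unfolding set_upt by (meson atLeastLessThan_iff)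
    show ?thesis unfolding g vars.simps by (intro Un_least f) (use * in auto)
  qed
  moreover have "Y 1 \<in> all_vars m (num_outputs m T)" using no by (simp add: Y)
  ultimately show ?thesis unfolding tableau_def vars_conj_list by fastforce
qed

text \<open>The size bound for circuits is a polynomial in \<open>fsize\<close>; the selector
  clauses alone make the formula long enough for it.\<close>

lemma m_le_fsize_tableau: "m \<le> fsize (tableau z m T)"
proof -
  have "m \<le> length (selector_clauses m)" by (simp add: selector_clauses_def length_concat comp_def sum_list_triv)
  then show ?thesis
    using length_le_fsize_conj_list[of "selector_clauses m @ init_clauses z m T @ step_clauses m T @ final_clauses m T"]
    by (simp add: tableau_def)
qed

text \<open>The meaning of all clauses except those for the selector. Neither \<open>x\<close> nor
  \<open>Y 1\<close> occurs, so the run is encoded independently of the selector inputs.\<close>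

definition accepting :: "bool list \<Rightarrow> nat \<Rightarrow> nat \<Rightarrow> (nat \<Rightarrow> bool) \<Rightarrow> bool" where
  "accepting z m T y \<longleftrightarrow>
    (\<forall>p < 4 * T + 2. if 2 * T \<le> p \<and> p < 2 * T + m
       then y (fact_index m T 0 p (I (symb z (2 * T) p) (if y (2 + (p - 2 * T)) then 2 else 1) (p = 2 * T)))
       else y (fact_index m T 0 p (I (symb z (2 * T) p) 0 (p = 2 * T)))) \<and>
    (\<forall>t<T. \<forall>p<4 * T. \<forall>u<N. \<forall>v1<N. \<forall>v2<N. \<forall>v3<N. y (fact_index m T t (2 * T) u) \<longrightarrow>
       y (fact_index m T t p v1) \<longrightarrow> y (fact_index m T t (p + 1) v2) \<longrightarrow> y (fact_index m T t (p + 2) v3) \<longrightarrow>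
       y (fact_index m T (t + 1) (p + 1) (G u v1 v2 v3))) \<and>
    (\<forall>p<4 * T + 1. \<forall>v<N. \<forall>v'<N. y (fact_index m T T p v) \<longrightarrow> y (fact_index m T T (p + 1) v') \<longrightarrow>
       org v \<longrightarrow> sym v = 2 \<and> sym v' = 0)"

lemma form_val_tableau:
  "form_val (tableau z m T) x y \<longleftrightarrow> (y 1 \<longleftrightarrow> (\<exists>j<m. x (Suc j) \<and> y (2 + j))) \<and> accepting z m T y"
proof -
  have ball_concat: "(\<forall>f \<in> set (concat (map g [0..<n])). Q f) \<longleftrightarrow> (\<forall>i<n. \<forall>f \<in> set (g i). Q f)"
    for g n and Q :: "form \<Rightarrow> bool" by auto
  have "(\<forall>f \<in> set (selector_clauses m). form_val f x y) \<longleftrightarrow> (y 1 \<longleftrightarrow> (\<exists>j<m. x (Suc j) \<and> y (2 + j)))"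
    by (auto simp: selector_clauses_def form_val_disj_list)
  moreover have "(\<forall>f \<in> set (init_clauses z m T). form_val f x y) \<longleftrightarrow>
    (\<forall>p < 4 * T + 2. if 2 * T \<le> p \<and> p < 2 * T + m
       then y (fact_index m T 0 p (I (symb z (2 * T) p) (if y (2 + (p - 2 * T)) then 2 else 1) (p = 2 * T)))
       else y (fact_index m T 0 p (I (symb z (2 * T) p) 0 (p = 2 * T))))"
    unfolding init_clauses_def ball_concat by (intro all_cong1 imp_cong refl) (simp add: fact_def)
  moreover have "(\<forall>f \<in> set (step_clauses m T). form_val f x y) \<longleftrightarrow>
    (\<forall>t<T. \<forall>p<4 * T. \<forall>u<N. \<forall>v1<N. \<forall>v2<N. \<forall>v3<N. y (fact_index m T t (2 * T) u) \<longrightarrow>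
       y (fact_index m T t p v1) \<longrightarrow> y (fact_index m T t (p + 1) v2) \<longrightarrow> y (fact_index m T t (p + 2) v3) \<longrightarrow>
       y (fact_index m T (t + 1) (p + 1) (G u v1 v2 v3)))"
    unfolding step_clauses_def ball_concat by (intro all_cong1 imp_cong refl) (auto simp: fact_def)
  moreover have "(\<forall>f \<in> set (final_clauses m T). form_val f x y) \<longleftrightarrow>
    (\<forall>p<4 * T + 1. \<forall>v<N. \<forall>v'<N. y (fact_index m T T p v) \<longrightarrow> y (fact_index m T T (p + 1) v') \<longrightarrow>
       org v \<longrightarrow> sym v = 2 \<and> sym v' = 0)"
    unfolding final_clauses_def ball_concat by (intro all_cong1 imp_cong refl) (auto simp: fact_def)
  ultimately show ?thesis
    by (simp only: tableau_def form_val_conj_list set_append ball_Un accepting_def)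
qed

text \<open>Induction over the shrinking window makes all facts of the actual run true. Further
  facts may be true as well, but the final clauses bind every pair of true facts, in particular the
  actual one.\<close>

lemma accepting_sound:
  assumes w: "w = map (\<lambda>j. y (2 + j)) [0..<m]" and acc: "accepting z m T y"
    and h: "\<bar>h\<bar> \<le> int T" "\<And>i. sym (arun G I z w T i) = contents out (h + i)"
      "\<And>i. org (arun G I z w T i) \<longleftrightarrow> h + i = 0"
  shows "out = [True]"
proof -
  let ?A = "\<lambda>t p. arun G I z w t (int p - int (2 * T))"
  have less: "arun G I z w t i < N" for t i by (cases t) (simp_all add: I_less G_less)
  have facts: "y (fact_index m T t p (?A t p))" if "t \<le> T" "t \<le> p" "p + t < 4 * T + 2" for t p
    using that
  proof (induction t arbitrary: p)
    case 0
    have "symb w (2 * T) p = (if 2 * T \<le> p \<and> p < 2 * T + m then if y (2 + (p - 2 * T)) then 2 else 1 else 0)"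
      by (auto simp: symb_def bit_at_def w)
    moreover have "int p - int (2 * T) = 0 \<longleftrightarrow> p = 2 * T" by auto
    ultimately show ?case
      using acc 0 unfolding accepting_def by (auto simp: contents_symb simp del: of_nat_mult split: if_splits)
  next
    case (Suc t)
    then obtain q where q: "p = Suc q" by (cases p) auto
    have IH: "y (fact_index m T t r (?A t r))" if "t \<le> r" "r + t < 4 * T + 2" for r
      using Suc that by simp
    have "y (fact_index m T (t + 1) (q + 1) (G (?A t (2 * T)) (?A t q) (?A t (q + 1)) (?A t (q + 2))))"
      using acc Suc.prems q less IH[of "2 * T"] IH[of q] IH[of "q + 1"] IH[of "q + 2"]
      unfolding accepting_def by simp
    then show ?case by (simp add: q algebra_simps)
  qed
  \<comment> \<open>The column at distance \<open>- h\<close> from the heads shows output cell 0. As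
    \<open>p \<le> 3 * T\<close>, the column \<open>p + 1\<close> is still in the reliable window at
    time \<open>T\<close> when rows have \<open>4 * T + 2\<close> columns.\<close>
  define p where "p = nat (int (2 * T) - h)"
  have p: "int p - int (2 * T) = - h" "int (p + 1) - int (2 * T) = 1 - h" using h(1) by (auto simp: p_def)
  have b: "T \<le> p" "p + 1 + T < 4 * T + 2" using h(1) by (auto simp: p_def nat_le_iff)
  have "sym (?A T p) = 2 \<and> sym (?A T (p + 1)) = 0"
  proof -
    have "y (fact_index m T T p (?A T p))" "y (fact_index m T T (p + 1) (?A T (p + 1)))"
      using b by (intro facts; simp)+
    moreover have "org (?A T p)" unfolding p using h(3) by simp
    moreover have "p < 4 * T + 1" using b by simp
    ultimately show ?thesis using acc less unfolding accepting_def by blast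
  qed
  then have "contents out 0 = 2" "contents out 1 = 0" unfolding p h(2) by simp_all
  then show ?thesis by (cases out) (auto simp: contents_def split: if_splits)
qed

text \<open>Exactly the facts of the actual run are made true. They are read off the unbounded
  automaton, so the clauses at the edges of the window hold too. The value \<open>b\<close> of
  \<open>Y 1\<close> is left to the selector.\<close>

lemma accepting_complete:
  assumes w: "length w = m"
    and h: "\<And>i. sym (arun G I z w T i) = contents [True] (h + i)" "\<And>i. org (arun G I z w T i) \<longleftrightarrow> h + i = 0"
  obtains y where "accepting z m T y" "\<And>j. j < m \<Longrightarrow> y (2 + j) = w ! j" "y 1 = b"
proof -
  let ?A = "\<lambda>t p. arun G I z w t (int p - int (2 * T))"
  let ?P = "4 * T + 2"
  have less: "arun G I z w t i < N" for t i by (cases t) (simp_all add: I_less G_less)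
  \<comment> \<open>The divisions by \<open>N\<close> and by the row length undo
    \<open>fact_index\<close>.\<close>
  define y where "y = (\<lambda>i. if i = 1 then b else if i < 2 + m then w ! (i - 2) else
    (let k = i - 2 - m; q = k div N in ?A (q div ?P) (q mod ?P) = k mod N))"
  have fct: "y (fact_index m T t p v) \<longleftrightarrow> ?A t p = v" if "v < N" "p < ?P" for t p v
  proof -
    let ?i = "fact_index m T t p v"
    have k: "?i - 2 - m = v + N * (p + ?P * t)" "\<not> ?i < 2 + m" "?i \<noteq> 1" by (simp_all add: fact_index_def)
    have "(v + N * (p + ?P * t)) div N = p + ?P * t" "(v + N * (p + ?P * t)) mod N = v"
      using that(1) by (simp_all only: div_mult_self2 mod_mult_self2 mod_less div_less)
    moreover have "(p + ?P * t) div ?P = t" "(p + ?P * t) mod ?P = p"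
      using that(2) by (simp_all only: div_mult_self2 mod_mult_self2 mod_less div_less)
    ultimately show ?thesis using k by (simp only: y_def Let_def if_False)
  qed
  have wit: "y (2 + j) = w ! j" if "j < m" for j using that by (simp add: y_def)
  have "accepting z m T y"
    unfolding accepting_def
  proof (intro conjI allI impI)
    fix p assume p: "p < ?P"
    have "symb w (2 * T) p = (if 2 * T \<le> p \<and> p < 2 * T + m then if y (2 + (p - 2 * T)) then 2 else 1 else 0)"
      using wit[of "p - 2 * T"] by (auto simp: symb_def bit_at_def w)
    moreover have "int p - int (2 * T) = 0 \<longleftrightarrow> p = 2 * T" by auto
    ultimately have A: "?A 0 p = (if 2 * T \<le> p \<and> p < 2 * T + m
        then I (symb z (2 * T) p) (if y (2 + (p - 2 * T)) then 2 else 1) (p = 2 * T)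
        else I (symb z (2 * T) p) 0 (p = 2 * T))"
      by (simp add: contents_symb del: of_nat_mult)
    then show "if 2 * T \<le> p \<and> p < 2 * T + m
       then y (fact_index m T 0 p (I (symb z (2 * T) p) (if y (2 + (p - 2 * T)) then 2 else 1) (p = 2 * T)))
       else y (fact_index m T 0 p (I (symb z (2 * T) p) 0 (p = 2 * T)))"
      unfolding fct[OF I_less p] by simp
  next
    fix t p u v1 v2 v3
    assume *: "t < T" "p < 4 * T" "u < N" "v1 < N" "v2 < N" "v3 < N" "y (fact_index m T t (2 * T) u)"
       "y (fact_index m T t p v1)" "y (fact_index m T t (p + 1) v2)" "y (fact_index m T t (p + 2) v3)"
    then have "?A t (2 * T) = u" "?A t p = v1" "?A t (p + 1) = v2" "?A t (p + 2) = v3"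
      using fct by simp_all
    then have "?A (t + 1) (p + 1) = G u v1 v2 v3" by (simp add: algebra_simps)
    then show "y (fact_index m T (t + 1) (p + 1) (G u v1 v2 v3))" using * fct[OF G_less, of "p + 1"] by simp
  next
    fix p v v'
    assume *: "p < 4 * T + 1" "v < N" "v' < N" "y (fact_index m T T p v)" "y (fact_index m T T (p + 1) v')" "org v"
    then have v: "?A T p = v" "?A T (p + 1) = v'" using fct by simp_all
    then have "h + (int p - int (2 * T)) = 0" using * h(2) by blast
    moreover from this have "h + (int (p + 1) - int (2 * T)) = 1" by simp
    ultimately show "sym v = 2" "sym v' = 0" using v h(1) by (auto simp: contents_def)
  qed
  then show ?thesis using that[of y] wit by (simp add: y_def)
qed

end

subsection \<open>Writing down the formula\<close>

lemma fp_enc_FVar_Y: "fpn i \<Longrightarrow> fp (\<lambda>e. enc_form (YV (i e)))"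
  by (simp, intro fp_append fp_const fp_Cons fp_enc_nat)

lemma fp_enc_FVar_X: "fpn i \<Longrightarrow> fp (\<lambda>e. enc_form (FVar (X (i e))))"
  by (simp, intro fp_append fp_const fp_Cons fp_enc_nat)

lemma fp_enc_FNot: "fp (\<lambda>e. enc_form (F e)) \<Longrightarrow> fp (\<lambda>e. enc_form (FNot (F e)))"
  by (simp, intro fp_append fp_const)

lemma fp_enc_FAnd: "fp (\<lambda>e. enc_form (F e)) \<Longrightarrow> fp (\<lambda>e. enc_form (H e)) \<Longrightarrow> fp (\<lambda>e. enc_form (FAnd (F e) (H e)))"
  by (simp, intro fp_append fp_const)

lemma fp_enc_FOr: "fp (\<lambda>e. enc_form (F e)) \<Longrightarrow> fp (\<lambda>e. enc_form (H e)) \<Longrightarrow> fp (\<lambda>e. enc_form (FOr (F e) (H e)))"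
  by (simp, intro fp_append fp_const)

text \<open>\<open>enc_form\<close> is prefix notation, so a right fold of \<open>FAnd\<close> (tag
  2) or \<open>FOr\<close> (tag 3) is written as a flat sequence of tagged members followed by the
  neutral formula. Flat concatenations are what \<open>fp_concat_upt\<close> produces.\<close>

definition encs :: "nat \<Rightarrow> form list \<Rightarrow> bool list" where
  "encs k fs = concat (map (\<lambda>f. enc_nat k @ enc_form f) fs)"

lemma enc_form_conj_list: "enc_form (conj_list fs) = encs 2 fs @ enc_form f_true"
  by (induction fs) (simp_all add: conj_list_def encs_def)

lemma enc_form_disj_list: "enc_form (disj_list fs) = encs 3 fs @ enc_form f_false"
  by (induction fs) (simp_all add: disj_list_def encs_def)

lemma encs_Nil: "encs k [] = []"
  by (simp add: encs_def)

lemma encs_Cons: "encs k (f # fs) = enc_nat k @ enc_form f @ encs k fs"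
  by (simp add: encs_def)

lemma encs_append: "encs k (fs @ gs) = encs k fs @ encs k gs"
  by (simp add: encs_def)

lemma encs_concat: "encs k (concat (map g xs)) = concat (map (\<lambda>i. encs k (g i)) xs)"
  by (induction xs) (simp_all add: encs_Nil encs_append)

lemma encs_if: "encs k (if c then fs else gs) = (if c then encs k fs else encs k gs)"
  by simp

lemmas fp_enc_intros = fp_enc_FVar_Y fp_enc_FVar_X fp_enc_FNot fp_enc_FAnd fp_enc_FOr
  fp_append fp_if fp_concat_upt fp_concat_list fpb_conj fpb_less fpb_le fpb_eq fpn_if
  fpn_mult fpn_add fpn_diff fpn_Suc fpn_symb fpn_length fp_arg fp_const

context centred_automaton
begin

lemma fp_enc_fact: "fpn m \<Longrightarrow> fpn T \<Longrightarrow> fpn t \<Longrightarrow> fpn p \<Longrightarrow> fpn v \<Longrightarrow>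
    fp (\<lambda>e. enc_form (fact (m e) (T e) (t e) (p e) (v e)))"
  unfolding fact_def fact_index_def by (intro fp_enc_intros)

text \<open>\<open>I\<close> is an arbitrary function, but \<open>symb\<close> has only three
  values, so a finite table suffices.\<close>

lemma fpn_I_symb:
  assumes "fp z" "fpn C" "fpn p"
  shows "fpn (\<lambda>e. I (symb (z e) (C e) (p e)) b (p e = C e))"
proof -
  have "I (symb z C p) b (p = C) = (if symb z C p = 0 then if p = C then I 0 b True else I 0 b False
      else if symb z C p = 1 then if p = C then I 1 b True else I 1 b False
      else if p = C then I 2 b True else I 2 b False)" for z C p
    by (auto simp: symb_def)
  then show ?thesis by (simp only:) (intro fp_enc_intros assms)
qed

lemma fp_enc_tableau_arg: "fp (\<lambda>e. enc_form (tableau (e 0) (length (e 1)) (length (e 2))))"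
proof -
  have "fp (\<lambda>e. encs 2 (selector_clauses (length (e 1))))"
  proof -
    have m: "map f xs = concat (map (\<lambda>i. [f i]) xs)" for f :: "nat \<Rightarrow> form" and xs by (induction xs) auto
    show ?thesis
      unfolding selector_clauses_def encs_append encs_concat encs_Cons encs_Nil enc_form.simps(2-)
        enc_form_disj_list
      by (subst m) (unfold encs_concat encs_Cons encs_Nil enc_form.simps(2-) f_false_def, intro fp_enc_intros)
  qed
  moreover have "fp (\<lambda>e. encs 2 (init_clauses (e 0) (length (e 1)) (length (e 2))))"
    unfolding init_clauses_def encs_append encs_concat encs_if encs_Cons encs_Nil
    by (intro fp_enc_fact fpn_I_symb fp_enc_intros)
  moreover have "fp (\<lambda>e. encs 2 (step_clauses (length (e 1)) (length (e 2))))"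
    unfolding step_clauses_def encs_append encs_concat encs_if encs_Cons encs_Nil
    by (intro fp_enc_fact fp_enc_intros)
  moreover have "fp (\<lambda>e. encs 2 (final_clauses (length (e 1)) (length (e 2))))"
    unfolding final_clauses_def encs_append encs_concat encs_if encs_Cons encs_Nil
    by (intro fp_enc_fact fp_enc_intros)
  ultimately show ?thesis
    unfolding tableau_def enc_form_conj_list encs_append f_true_def
    by (intro fp_append fp_const)
qed

lemma fp_enc_instance_tableau:
  assumes "fp z" "fpn m" "fpn T"
  shows "fp (\<lambda>e. enc_instance (m e) (num_outputs (m e) (T e)) (tableau (z e) (m e) (T e)) 1)"
proof -
  define D where "D = (\<lambda>i::nat. if i = 0 then z else if i = 1 then (\<lambda>e. replicate (m e) True) else (\<lambda>e. replicate (T e) True))"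
  have "fp (D i)" for i using assms by (simp add: D_def)
  from fp_comp[OF fp_enc_tableau_arg, of D, OF this]
  have "fp (\<lambda>e. enc_form (tableau (z e) (m e) (T e)))" by (simp add: D_def)
  then show ?thesis
    unfolding enc_instance_def num_outputs_def by (intro fp_append fp_enc_nat fp_enc_intros assms)
qed

end

section \<open>Evaluating circuits\<close>

text \<open>These functions parse an encoded circuit gate by gate and evaluate it on the assignment that makes
  only \<open>X\<^sub>j\<close> true; the values on strings that do not encode a circuit are junk.\<close>

definition after_ones :: "bool list \<Rightarrow> bool list" where
  "after_ones r = drop (ones r + 1) r"

definition skip_gate :: "bool list \<Rightarrow> bool list" where
  "skip_gate r = (let t = ones r; r1 = after_ones r in
     if t = 0 then tl r1 else if t = 1 then after_ones (tl r1)
     else if t = 2 then after_ones r1 else after_ones (after_ones r1))"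

definition gate_value :: "nat \<Rightarrow> bool list \<Rightarrow> bool list \<Rightarrow> bool" where
  "gate_value j r ws = (let t = ones r; r1 = after_ones r; a = ones r1; b = ones (after_ones r1) in
     if t = 0 then bit_at r1 0 else if t = 1 then \<not> bit_at r1 0 \<and> ones (tl r1) = j
     else if t = 2 then \<not> bit_at ws a
     else if t = 3 then bit_at ws a \<and> bit_at ws b else bit_at ws a \<or> bit_at ws b)"

primrec gate_values :: "nat \<Rightarrow> bool list \<Rightarrow> nat \<Rightarrow> bool list" where
  "gate_values j r 0 = []"
| "gate_values j r (Suc n) = (if (skip_gate ^^ n) r = [] then gate_values j r n
     else gate_values j r n @ [gate_value j ((skip_gate ^^ n) r) (gate_values j r n)])"

definition eval_unit :: "nat \<Rightarrow> bool list \<Rightarrow> bool" where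
  "eval_unit j r = (let ws = gate_values j r (length r) in bit_at ws (length ws - 1))"

lemma fp_after_ones: "fp A \<Longrightarrow> fp (\<lambda>e. after_ones (A e))"
  unfolding after_ones_def by (intro fp_drop fpn_ones fpn_add fp_const)

lemma fp_skip_gate: "fp A \<Longrightarrow> fp (\<lambda>e. skip_gate (A e))"
  unfolding skip_gate_def Let_def by (intro fp_if fp_after_ones fpn_ones fpb_eq fp_tl fp_const)

lemma length_skip_gates: "length ((skip_gate ^^ n) r) \<le> length r"
proof (induction n)
  case (Suc n)
  have "length (skip_gate r) \<le> length r" for r by (simp add: skip_gate_def after_ones_def Let_def)
  then show ?case using Suc order_trans by auto
qed simp

lemma fp_skip_gates: assumes "fpn n" "fp A" shows "fp (\<lambda>e. (skip_gate ^^ n e) (A e))"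
  by (rule fp_recursion[OF assms, of "\<lambda>n a e. skip_gate a" "\<lambda>n e. (skip_gate ^^ n) (A e)" "\<lambda>e. length (A e)"])
    (auto intro!: fp_skip_gate fp_arg assms length_skip_gates)

lemma fpb_gate_value: "fpn j \<Longrightarrow> fp A \<Longrightarrow> fp W \<Longrightarrow> fpb (\<lambda>e. gate_value (j e) (A e) (W e))"
  unfolding gate_value_def Let_def
  by (intro fpb_if fpb_conj fpb_disj fpb_Not fpb_bit_at fp_after_ones fp_tl fpn_ones fpb_eq fp_const)

lemma length_gate_values: "length (gate_values j r n) \<le> n"
  by (induction n) auto

lemma fp_gate_values: assumes "fpn j" "fp A" "fpn n" shows "fp (\<lambda>e. gate_values (j e) (A e) (n e))"
proof (rule fp_recursion[OF assms(3) fp_Nil, of "\<lambda>n a e. if (skip_gate ^^ n) (A e) = [] then a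
    else a @ [gate_value (j e) ((skip_gate ^^ n) (A e)) a]" "\<lambda>n e. gate_values (j e) (A e) n" n])
  show "fp (\<lambda>e. if (skip_gate ^^ length (e 0)) (A (\<lambda>i. e (Suc (Suc i)))) = [] then e (Suc 0)
      else e (Suc 0) @ [gate_value (j (\<lambda>i. e (Suc (Suc i)))) ((skip_gate ^^ length (e 0)) (A (\<lambda>i. e (Suc (Suc i))))) (e (Suc 0))])"
    by (intro fp_if fpb_Nil fp_append fp_skip_gates fpb_gate_value fpn_length fp_arg assms[THEN fp_shift2])
  show "pbe n" by (rule pbe_fpn[OF assms(3)])
  show "length (gate_values (j e) (A e) k) \<le> n e" if "k \<le> n e" for e k
    using length_gate_values order_trans that by blast
qed simp_all

lemma fpb_eval_unit: assumes "fpn j" "fp A" shows "fpb (\<lambda>e. eval_unit (j e) (A e))"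
  unfolding eval_unit_def Let_def
  by (intro fpb_bit_at fpn_diff fpn_length fp_gate_values fp_const assms)

section \<open>Correctness of the circuit evaluation\<close>

lemma ones_enc_nat [simp]: "ones (enc_nat k @ u) = k" "ones (enc_nat k) = k"
  by (simp_all add: ones_def enc_nat_def takeWhile_append)

lemma after_ones_enc_nat [simp]: "after_ones (enc_nat k @ u) = u" "after_ones (enc_nat k) = []"
  unfolding after_ones_def ones_enc_nat by (simp_all add: enc_nat_def)

lemma after_ones_Nil [simp]: "after_ones [] = []"
  by (simp add: after_ones_def)

lemma skip_enc_gate: "skip_gate (enc_gate g @ u) = u"
proof (cases g)
  case (GVar v) then show ?thesis by (cases v) (simp_all add: skip_gate_def Let_def)
qed (simp_all add: skip_gate_def Let_def)

lemma enc_gate_not_Nil: "enc_gate g \<noteq> []"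
  by (cases g) (simp_all add: enc_nat_def)

definition circuit_vals :: "circuit \<Rightarrow> (nat \<Rightarrow> bool) \<Rightarrow> (nat \<Rightarrow> bool) \<Rightarrow> bool list" where
  "circuit_vals C x y = foldl (\<lambda>ws g. ws @ [gate_val x y ws g]) [] C"

lemma circuit_vals_snoc: "circuit_vals (C @ [g]) x y = circuit_vals C x y @ [gate_val x y (circuit_vals C x y) g]"
  by (simp add: circuit_vals_def)

lemma length_circuit_vals: "length (circuit_vals C x y) = length C"
  by (induction C rule: rev_induct) (simp_all add: circuit_vals_snoc, simp add: circuit_vals_def)

lemma gate_value_enc:
  assumes "gate_preds g \<subseteq> {..<length ws}" "gate_vars g \<subseteq> range X"
  shows "gate_value j (enc_gate g @ u) ws = gate_val (\<lambda>i. i = j) y ws g"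
  using assms
proof (cases g)
  case (GVar v) then show ?thesis using assms by (cases v) (auto simp: gate_value_def bit_at_def)
qed (auto simp: gate_value_def Let_def bit_at_def)

text \<open>A circuit over \<open>all_vars m 0\<close> reads no output variable, which is why
  \<open>y\<close> is arbitrary; later it comes from a satisfying assignment.\<close>

lemma eval_unit_enc_circuit:
  assumes "circuit_on (all_vars m 0) C"
  shows "eval_unit j (enc_circuit C) = circuit_val C (\<lambda>i. i = j) y"
proof -
  let ?r = "enc_circuit C"
  have skip: "(skip_gate ^^ n) ?r = enc_circuit (drop n C)" for n
  proof (induction n)
    case (Suc n)
    show ?case
    proof (cases "n < length C")
      case True
      then have "drop n C = C ! n # drop (Suc n) C" by (simp add: Cons_nth_drop_Suc)
      then show ?thesis using Suc by (simp add: enc_circuit_def skip_enc_gate)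
    qed (use Suc in \<open>simp add: enc_circuit_def skip_gate_def Let_def\<close>)
  qed simp
  have vals: "gate_values j ?r n = circuit_vals (take n C) (\<lambda>i. i = j) y" for n
  proof (induction n)
    case (Suc n)
    show ?case
    proof (cases "n < length C")
      case True
      then have d: "drop n C = C ! n # drop (Suc n) C" by (simp add: Cons_nth_drop_Suc)
      have "gate_preds (C ! n) \<subseteq> {..<n}" "gate_vars (C ! n) \<subseteq> all_vars m 0"
        using assms True by (auto simp: circuit_on_def)
      then have "gate_value j (enc_gate (C ! n) @ enc_circuit (drop (Suc n) C)) (circuit_vals (take n C) (\<lambda>i. i = j) y) =
          gate_val (\<lambda>i. i = j) y (circuit_vals (take n C) (\<lambda>i. i = j) y) (C ! n)"
        using True by (intro gate_value_enc) (auto simp: length_circuit_vals all_vars_def)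
      then show ?thesis
        using Suc True enc_gate_not_Nil
        by (simp add: skip d take_Suc_conv_app_nth circuit_vals_snoc) (simp add: enc_circuit_def)
    qed (use Suc skip[of n] in \<open>simp add: enc_circuit_def\<close>)
  qed (simp add: circuit_vals_def)
  \<comment> \<open>\<open>eval_unit\<close> runs for \<open>length r\<close> rounds. Every gate
    occupies at least one symbol, so all gates are reached.\<close>
  have "length C \<le> length ?r"
  proof (induction C)
    case (Cons g C)
    then show ?case using enc_gate_not_Nil[of g] by (cases "enc_gate g") (auto simp: enc_circuit_def)
  qed simp
  then have "gate_values j ?r (length ?r) = circuit_vals C (\<lambda>i. i = j) y" by (simp add: vals)
  moreover have "C \<noteq> []" using assms by (simp add: circuit_on_def)
  moreover from this have "circuit_vals C (\<lambda>i. i = j) y \<noteq> []"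
    using length_circuit_vals[of C "\<lambda>i. i = j" y] by auto
  ultimately show ?thesis
    by (simp add: eval_unit_def bit_at_def Let_def circuit_val_def last_conv_nth flip: circuit_vals_def)
qed

text \<open>The Skolem circuit with the witness \<open>w\<close> hard-wired. Its mere existence
  meets the promise; the reduction never constructs it. The last gate holds the disjunction so far,
  and a new \<open>GOr\<close> joins it with the variable gate placed right after it.\<close>

primrec selector_circuit :: "bool list \<Rightarrow> nat \<Rightarrow> circuit" where
  "selector_circuit w 0 = [GConst False]"
| "selector_circuit w (Suc k) = selector_circuit w k @ (if w ! k then
     [GVar (X (Suc k)), GOr (length (selector_circuit w k) - 1) (length (selector_circuit w k))] else [])"

lemma selector_circuit:
  shows "length (selector_circuit w k) \<le> 2 * k + 1"
    and "circuit_on (all_vars k 0) (selector_circuit w k)"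
    and "circuit_val (selector_circuit w k) x y \<longleftrightarrow> (\<exists>j<k. x (Suc j) \<and> w ! j)"
proof -
  show "length (selector_circuit w k) \<le> 2 * k + 1" by (induction k) auto
  show "circuit_on (all_vars k 0) (selector_circuit w k)"
  proof (induction k)
    case 0
    then show ?case by (auto simp: circuit_on_def)
  next
    case (Suc k)
    have "all_vars k 0 \<subseteq> all_vars (Suc k) 0" "X (Suc k) \<in> all_vars (Suc k) 0" by (auto simp: all_vars_def)
    then show ?case using Suc by (fastforce simp: circuit_on_def nth_append less_Suc_eq nth_Cons split: nat.splits)
  qed
  have "selector_circuit w k \<noteq> []" for k by (induction k) auto
  have ne: "circuit_vals (selector_circuit w k) x y \<noteq> []" for k
    using \<open>selector_circuit w k \<noteq> []\<close> length_circuit_vals[of "selector_circuit w k" x y] by auto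
  have "last (circuit_vals (selector_circuit w k) x y) \<longleftrightarrow> (\<exists>j<k. x (Suc j) \<and> w ! j)"
  proof (induction k)
    case 0
    then show ?case by (simp add: circuit_vals_def)
  next
    case (Suc k)
    let ?S = "selector_circuit w k"
    let ?vs = "circuit_vals ?S x y"
    have "circuit_vals (?S @ [GVar (X (Suc k)), GOr (length ?S - 1) (length ?S)]) x y =
        ?vs @ [x (Suc k), last ?vs \<or> x (Suc k)]"
      using ne[of k] circuit_vals_snoc[of "?S @ [GVar (X (Suc k))]" "GOr (length ?S - 1) (length ?S)" x y]
      by (simp add: circuit_vals_snoc nth_append last_conv_nth flip: length_circuit_vals[of _ x y])
    then show ?case using Suc by (auto simp: less_Suc_eq)
  qed
  then show "circuit_val (selector_circuit w k) x y \<longleftrightarrow> (\<exists>j<k. x (Suc j) \<and> w ! j)"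
    by (simp add: circuit_val_def circuit_vals_def)
qed

section \<open>Isolating a witness by random parity conditions\<close>

definition pr :: "nat \<Rightarrow> (bool list \<Rightarrow> bool) \<Rightarrow> real" where
  "pr n Q = measure_pmf.prob (coins n) {r. Q r}"

lemma finite_bool_lists: "finite {r :: bool list. length r = n \<and> Q r}"
  using finite_lists_length_eq[of "UNIV :: bool set" n] by (auto intro: rev_finite_subset)

lemma finite_bool_lists': "finite {r :: bool list. length r = n}"
  using finite_bool_lists[of n "\<lambda>_. True"] by simp

lemma card_bool_lists: "card {r :: bool list. length r = n} = 2 ^ n"
  using card_lists_length_eq[of "UNIV :: bool set" n] by simp

lemma pr_card: "pr n Q = real (card {r. length r = n \<and> Q r}) / 2 ^ n"
proof -
  have "{r :: bool list. length r = n} \<noteq> {}" using Ex_list_of_length[of n] by auto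
  moreover have "finite {r :: bool list. length r = n}" by (rule finite_bool_lists')
  ultimately show ?thesis
    unfolding pr_def coins_def by (simp add: measure_pmf_of_set card_bool_lists Collect_conj_eq)
qed

lemma pr_cong: "(\<And>r. length r = n \<Longrightarrow> Q r \<longleftrightarrow> Q' r) \<Longrightarrow> pr n Q = pr n Q'"
  unfolding pr_card by (intro arg_cong[of _ _ "\<lambda>S. real (card S) / 2 ^ n"]) auto

lemma pr_mono: assumes "\<And>r. length r = n \<Longrightarrow> Q r \<Longrightarrow> Q' r" shows "pr n Q \<le> pr n Q'"
  unfolding pr_card
  by (intro divide_right_mono of_nat_mono card_mono finite_bool_lists) (use assms in auto)

lemma pr_le_1: "pr n Q \<le> 1"
  by (simp add: pr_def)

lemma pr_not: "pr n (\<lambda>r. \<not> Q r) = 1 - pr n Q"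
proof -
  have "{r. \<not> Q r} = UNIV - {r. Q r}" by auto
  then show ?thesis unfolding pr_def using measure_pmf.prob_compl[of "{r. Q r}" "coins n"] by simp
qed

lemma pr_split: "pr (a + b) (\<lambda>r. Q (take a r) \<and> R (drop a r)) = pr a Q * pr b R"
proof -
  have "bij_betw (\<lambda>(u, v). u @ v) ({r. length r = a \<and> Q r} \<times> {r. length r = b \<and> R r})
      {r. length r = a + b \<and> Q (take a r) \<and> R (drop a r)}"
    by (rule bij_betw_byWitness[of _ "\<lambda>r. (take a r, drop a r)"]) auto
  from bij_betw_same_card[OF this] show ?thesis
    unfolding pr_card by (simp add: card_cartesian_product power_add flip: of_nat_mult)
qed

lemma pr_prefix: assumes "a \<le> n" shows "pr n (\<lambda>r. Q (take a r)) = pr a Q"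
proof -
  have "pr (n - a) (\<lambda>_. True) = 1" by (simp add: pr_def)
  then show ?thesis using pr_split[of a "n - a" Q "\<lambda>_. True"] assms by simp
qed

text \<open>By the hypothesis \<open>Q\<close> looks at the first \<open>n\<close> bits only, so the
  \<open>k\<close>-th condition depends on the \<open>k\<close>-th block alone, and the blocks are
  independent.\<close>

lemma pr_blocks:
  assumes "\<And>r. Q (take n r) = Q r"
  shows "pr (K * n) (\<lambda>h. \<forall>k<K. Q (drop (k * n) h)) = pr n Q ^ K"
proof (induction K)
  case 0
  then show ?case by (simp add: pr_def)
next
  case (Suc K)
  have "(\<forall>k<Suc K. Q (drop (k * n) h)) \<longleftrightarrow> Q (take n h) \<and> (\<forall>k<K. Q (drop (k * n) (drop n h)))" for h
    by (auto simp: assms less_Suc_eq_0_disj add.commute)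
  then have "pr (Suc K * n) (\<lambda>h. \<forall>k<Suc K. Q (drop (k * n) h)) =
      pr (n + K * n) (\<lambda>h. Q (take n h) \<and> (\<forall>k<K. Q (drop (k * n) (drop n h))))" by simp
  also have "\<dots> = pr n Q * pr (K * n) (\<lambda>h. \<forall>k<K. Q (drop (k * n) h))" by (rule pr_split)
  finally show ?case using Suc by simp
qed

section \<open>Parity conditions as pairwise independent hash functions\<close>

definition parity :: "nat \<Rightarrow> bool list \<Rightarrow> bool list \<Rightarrow> bool" where
  "parity m r w \<longleftrightarrow> odd (\<Sum>j<m. if bit_at r j \<and> bit_at w j then 1 else 0 :: nat)"

text \<open>An affine equation over the two-element field: the first \<open>m\<close> bits of
  \<open>r\<close> are coefficients, bit \<open>m\<close> is the constant term. Without a constant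
  term the zero vector would satisfy every equation.\<close>

definition row_ok :: "nat \<Rightarrow> bool list \<Rightarrow> bool list \<Rightarrow> bool" where
  "row_ok m w r \<longleftrightarrow> (parity m r w \<longleftrightarrow> bit_at r m)"

definition hash_ok :: "nat \<Rightarrow> nat \<Rightarrow> bool list \<Rightarrow> bool list \<Rightarrow> bool" where
  "hash_ok m K h w \<longleftrightarrow> (\<forall>k<K. row_ok m w (drop (k * (m + 1)) h))"

lemma bit_at_append: "bit_at (u @ v) j = (if j < length u then bit_at u j else bit_at v (j - length u))"
  by (auto simp: bit_at_def nth_append)

lemma bit_at_take: "bit_at (take n r) j \<longleftrightarrow> j < n \<and> bit_at r j"
  by (auto simp: bit_at_def)

lemma parity_take: "m \<le> n \<Longrightarrow> parity m (take n r) w = parity m r w"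
  unfolding parity_def by (intro arg_cong[of _ _ odd] sum.cong) (auto simp: bit_at_take)

lemma parity_append: "length u = m \<Longrightarrow> parity m (u @ v) w = parity m u w"
  using parity_take[of m m "u @ v" w] by simp

lemma row_ok_take: "row_ok m w (take (m + 1) r) = row_ok m w r"
  by (simp add: row_ok_def parity_take bit_at_take)

text \<open>For each coefficient vector exactly one constant term fits.\<close>

lemma pr_row: "pr (m + 1) (row_ok m w) = 1 / 2"
proof -
  have "bij_betw (\<lambda>u. u @ [parity m u w]) {u. length u = m} {r. length r = m + 1 \<and> row_ok m w r}"
  proof (rule bij_betw_byWitness[of _ butlast])
    show "\<forall>r \<in> {r. length r = m + 1 \<and> row_ok m w r}. butlast r @ [parity m (butlast r) w] = r"
    proof
      fix r assume r: "r \<in> {r. length r = m + 1 \<and> row_ok m w r}"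
      then obtain u b where "r = u @ [b]" "length u = m" by (cases r rule: rev_cases) auto
      then show "butlast r @ [parity m (butlast r) w] = r"
        using r by (simp add: row_ok_def parity_append bit_at_append bit_at_single)
    qed
  qed (auto simp: row_ok_def parity_append bit_at_append bit_at_single)
  from bij_betw_same_card[OF this] show ?thesis
    unfolding pr_card by (simp add: card_bool_lists)
qed

text \<open>Both equations hold iff the coefficients give \<open>w\<close> and \<open>w'\<close> the
  same parity and the constant term equals it. Flipping a coefficient where \<open>w\<close> and
  \<open>w'\<close> differ changes just one of the parities, so half of the coefficient vectors
  agree; the constant term contributes another 1/2.\<close>

lemma pr_row_pair:
  assumes "length w = m" "length w' = m" "w \<noteq> w'"
  shows "pr (m + 1) (\<lambda>r. row_ok m w r \<and> row_ok m w' r) = 1 / 4"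
proof -
  obtain j where j: "j < m" "w ! j \<noteq> w' ! j" using assms nth_equalityI[of w w'] by auto
  let ?E = "{u. length u = m \<and> parity m u w = parity m u w'}"
  let ?D = "{u. length u = m \<and> parity m u w \<noteq> parity m u w'}"
  have flip: "parity m (u[j := \<not> u ! j]) v \<longleftrightarrow> (parity m u v \<noteq> v ! j)" if "length u = m" "length v = m" for u v
  proof -
    let ?f = "\<lambda>u i. if bit_at u i \<and> bit_at v i then 1 else 0 :: nat"
    have s: "(\<Sum>i<m. ?f u i) = ?f u j + (\<Sum>i\<in>{..<m} - {j}. ?f u i)" for u
      using j by (intro sum.remove) auto
    have "(\<Sum>i\<in>{..<m} - {j}. ?f (u[j := \<not> u ! j]) i) = (\<Sum>i\<in>{..<m} - {j}. ?f u i)"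
      by (intro sum.cong) (auto simp: bit_at_def)
    then show ?thesis unfolding parity_def s using that j by (auto simp: bit_at_def)
  qed
  have "bij_betw (\<lambda>u. u[j := \<not> u ! j]) ?E ?D"
    by (rule bij_betw_byWitness[of _ "\<lambda>u. u[j := \<not> u ! j]"]) (use j assms flip in auto)
  then have "card ?E = card ?D" by (rule bij_betw_same_card)
  moreover have "card ?E + card ?D = 2 ^ m"
    unfolding card_bool_lists[symmetric, of m]
    by (subst card_Un_disjoint[symmetric]) (auto intro!: finite_bool_lists arg_cong[of _ _ card])
  ultimately have E: "2 * card ?E = 2 ^ m" by simp
  have "bij_betw (\<lambda>u. u @ [parity m u w]) ?E {r. length r = m + 1 \<and> row_ok m w r \<and> row_ok m w' r}"
  proof (rule bij_betw_byWitness[of _ butlast])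
    show "\<forall>r \<in> {r. length r = m + 1 \<and> row_ok m w r \<and> row_ok m w' r}. butlast r @ [parity m (butlast r) w] = r"
    proof
      fix r assume r: "r \<in> {r. length r = m + 1 \<and> row_ok m w r \<and> row_ok m w' r}"
      then obtain u b where "r = u @ [b]" "length u = m" by (cases r rule: rev_cases) auto
      then show "butlast r @ [parity m (butlast r) w] = r"
        using r by (simp add: row_ok_def parity_append bit_at_append bit_at_single)
    qed
    show "butlast ` {r. length r = m + 1 \<and> row_ok m w r \<and> row_ok m w' r} \<subseteq> ?E"
    proof
      fix u assume "u \<in> butlast ` {r. length r = m + 1 \<and> row_ok m w r \<and> row_ok m w' r}"
      then obtain r where r: "length r = m + 1" "row_ok m w r" "row_ok m w' r" "u = butlast r" by auto
      then obtain b where b: "r = u @ [b]" by (cases r rule: rev_cases) auto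
      then have "length u = m" using r(1) by simp
      then show "u \<in> ?E" using r(2,3) unfolding b by (simp add: row_ok_def parity_append)
    qed
  qed (auto simp: row_ok_def parity_append bit_at_append bit_at_single)
  then have "card ?E = card {r. length r = m + 1 \<and> row_ok m w r \<and> row_ok m w' r}"
    by (rule bij_betw_same_card)
  from E[unfolded this]
  have "real (2 * card {r. length r = m + 1 \<and> row_ok m w r \<and> row_ok m w' r}) = real (2 ^ m)"
    by (rule arg_cong)
  then show ?thesis unfolding pr_card by (simp add: field_simps)
qed

lemma pr_hash: "pr (K * (m + 1)) (\<lambda>h. hash_ok m K h w) = (1 / 2) ^ K"
  unfolding hash_ok_def using pr_blocks[of "row_ok m w" "m + 1" K, OF row_ok_take] by (simp only: pr_row)

lemma pr_hash_pair:
  assumes "length w = m" "length w' = m" "w \<noteq> w'"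
  shows "pr (K * (m + 1)) (\<lambda>h. hash_ok m K h w \<and> hash_ok m K h w') = (1 / 4) ^ K"
proof -
  have "hash_ok m K h w \<and> hash_ok m K h w' \<longleftrightarrow>
      (\<forall>k<K. row_ok m w (drop (k * (m + 1)) h) \<and> row_ok m w' (drop (k * (m + 1)) h))" for h
    by (auto simp: hash_ok_def)
  then show ?thesis
    using pr_blocks[of "\<lambda>r. row_ok m w r \<and> row_ok m w' r" "m + 1" K] row_ok_take
    by (simp only: pr_row_pair[OF assms])
qed

text \<open>The Valiant-Vazirani isolation lemma; the first two terms of inclusion-exclusion suffice.\<close>

lemma pr_isolate:
  assumes W: "W \<subseteq> {w. length w = m}" and K: "2 ^ K \<le> 4 * card W" "2 * card W \<le> 2 ^ K"
  shows "1 / 8 \<le> pr (K * (m + 1)) (\<lambda>h. \<exists>!w. w \<in> W \<and> hash_ok m K h w)"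
proof -
  let ?n = "K * (m + 1)"
  let ?p = "measure_pmf.prob (coins ?n)"
  have fin: "finite W" by (rule finite_subset[OF W finite_bool_lists'])
  \<comment> \<open>\<open>U w\<close> is the event that \<open>w\<close> alone survives. These
    events are disjoint, so their probabilities add up; each is bounded below by subtracting all
    collisions with \<open>w\<close>.\<close>
  define U where "U = (\<lambda>w. {h. hash_ok m K h w \<and> (\<forall>w' \<in> W - {w}. \<not> hash_ok m K h w')})"
  let ?c = "real (card W)"
  have Uw: "(1 / 2) ^ K - ?c * (1 / 4) ^ K \<le> ?p (U w)" if w: "w \<in> W" for w
  proof -
    let ?B = "\<lambda>w'. {h. hash_ok m K h w \<and> hash_ok m K h w'}"
    have "{h. hash_ok m K h w} \<subseteq> U w \<union> (\<Union>w' \<in> W - {w}. ?B w')" by (auto simp: U_def)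
    then have "?p {h. hash_ok m K h w} \<le> ?p (U w \<union> (\<Union>w' \<in> W - {w}. ?B w'))"
      by (intro measure_pmf.finite_measure_mono) auto
    also have "\<dots> \<le> ?p (U w) + ?p (\<Union>w' \<in> W - {w}. ?B w')"
      by (intro measure_Un_le) auto
    also have "?p (\<Union>w' \<in> W - {w}. ?B w') \<le> (\<Sum>w' \<in> W - {w}. ?p (?B w'))"
      using fin by (intro measure_UNION_le) auto
    also have "\<dots> = (\<Sum>w' \<in> W - {w}. (1 / 4) ^ K)"
      using W w pr_hash_pair[of w m _ K] by (intro sum.cong) (auto simp: pr_def)
    also have "\<dots> \<le> ?c * (1 / 4) ^ K"
      using fin by (simp add: card_Diff1_le mult_right_mono)
    finally show ?thesis using pr_hash[of K m w] by (simp add: pr_def)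
  qed
  have "?c * ((1 / 2) ^ K - ?c * (1 / 4) ^ K) \<le> (\<Sum>w\<in>W. ?p (U w))"
    using sum_mono[OF Uw, of W "\<lambda>w. w"] by simp
  also have "\<dots> = ?p (\<Union>w\<in>W. U w)"
    using fin by (intro measure_pmf.finite_measure_finite_Union[symmetric])
      (auto simp: disjoint_family_on_def U_def)
  also have "(\<Union>w\<in>W. U w) = {h. \<exists>!w. w \<in> W \<and> hash_ok m K h w}" by (auto simp: U_def)
  finally have main: "?c * ((1 / 2) ^ K - ?c * (1 / 4) ^ K) \<le> pr ?n (\<lambda>h. \<exists>!w. w \<in> W \<and> hash_ok m K h w)"
    by (simp add: pr_def)
  \<comment> \<open>\<open>x\<close> is the expected number of survivors and the lower bound reads
    x(1 - x). The choice of \<open>K\<close> puts \<open>x\<close> between 1/4 and 1/2, so the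
    factors are at least 1/4 and 1/2.\<close>
  define x where "x = ?c / 2 ^ K"
  have "(2 :: real) ^ K \<le> 4 * ?c" "2 * ?c \<le> 2 ^ K"
    using of_nat_mono[OF K(1), where 'a = real] of_nat_mono[OF K(2), where 'a = real] by simp_all
  then have x: "1 / 4 \<le> x" "x \<le> 1 / 2" by (simp_all add: x_def field_simps)
  have "(1 / 8 :: real) \<le> 1 / 4 * (1 / 2)" by simp
  also have "\<dots> \<le> x * (1 - x)" using x by (intro mult_mono) auto
  also have "\<dots> = ?c * ((1 / 2) ^ K - ?c * (1 / 4) ^ K)"
  proof -
    have "(1 / 4 :: real) ^ K = (1 / 2) ^ K * (1 / 2) ^ K" by (simp flip: power_mult_distrib)
    moreover have "x = ?c * (1 / 2) ^ K" by (simp add: x_def power_divide)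
    ultimately show ?thesis by (simp add: algebra_simps)
  qed
  finally show ?thesis using main by linarith
qed

text \<open>For the least \<open>k\<close> with \<open>card W \<le> 2 ^ k\<close> minimality gives
  \<open>2 ^ k \<le> 2 * card W\<close>; take \<open>K = k + 1\<close>.\<close>

lemma isolation_level:
  assumes "W \<subseteq> {w :: bool list. length w = m}" "W \<noteq> {}"
  shows "\<exists>K \<le> m + 2. 2 ^ K \<le> 4 * card W \<and> 2 * card W \<le> 2 ^ K"
proof -
  have fin: "finite W" by (rule finite_subset[OF assms(1) finite_bool_lists'])
  have le: "card W \<le> 2 ^ m"
    using card_mono[OF finite_bool_lists' assms(1)] by (simp only: card_bool_lists)
  have pos: "1 \<le> card W" using fin assms(2) by (simp add: Suc_le_eq card_gt_0_iff)
  define k where "k = (LEAST k. card W \<le> 2 ^ k)"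
  have k: "card W \<le> 2 ^ k" "k \<le> m" unfolding k_def using le by (rule LeastI, rule Least_le)
  have "2 ^ k \<le> 2 * card W"
  proof (cases k)
    case (Suc l)
    then have "l < k" by simp
    then have "\<not> card W \<le> 2 ^ l" unfolding k_def by (rule not_less_Least)
    then show ?thesis using Suc by simp
  qed (use pos in simp)
  then show ?thesis using k by (intro exI[of _ "Suc k"]) auto
qed

lemma fpb_parity:
  assumes "fpn m" "fp r" "fp w"
  shows "fpb (\<lambda>e. parity (m e) (r e) (w e))"
  unfolding parity_def
  by (intro fpb_odd fpn_sum fpn_if fpb_conj fpb_bit_at fpn_length fp_arg fp_const assms assms[THEN fp_shift1])

lemma fpb_row_ok: "fpn m \<Longrightarrow> fp w \<Longrightarrow> fp r \<Longrightarrow> fpb (\<lambda>e. row_ok (m e) (w e) (r e))"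
  unfolding row_ok_def by (intro fpb_iff fpb_parity fpb_bit_at)

lemma fpb_hash_ok:
  assumes "fpn m" "fpn K" "fp h" "fp w"
  shows "fpb (\<lambda>e. hash_ok (m e) (K e) (h e) (w e))"
  unfolding hash_ok_def
  by (intro fpb_all_less fpb_row_ok fp_drop fpn_mult fpn_add fpn_length fp_arg fp_const assms assms[THEN fp_shift1])

section \<open>Finding a unique witness\<close>

abbreviation skolem_algorithm :: "nat poly \<Rightarrow> (bool list \<Rightarrow> bool list pmf) \<Rightarrow> bool" where
  "skolem_algorithm q A \<equiv> rand_polytime A \<and>
    (\<forall>n m F i.
       1 \<le> i \<and> i \<le> m \<and> vars F \<subseteq> all_vars n m \<and>
       (\<forall>x. \<exists>y. form_val F x y) \<and>
       (\<exists>s \<le> poly q (fsize F). uniquely_defined_by_size n F i s) \<longrightarrow>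
       measure_pmf.prob (A (enc_instance n m F i)) {enc_circuit C | C. skolem_circuit n F i C}
         \<ge> 1 / 2)"

lemma fp_map_eval_unit:
  assumes "fp r" "fpn m"
  shows "fp (\<lambda>e. map (\<lambda>j. eval_unit (Suc j) (r e)) [0..<m e])"
proof -
  have "map f xs = concat (map (\<lambda>j. [f j]) xs)" for f :: "nat \<Rightarrow> bool" and xs by (induction xs) auto
  then show ?thesis
    by (simp only:) (intro fp_concat_upt assms(2) fpb_eval_unit fpn_Suc fpn_length fp_arg fp_shift1[OF assms(1)])
qed

text \<open>By soundness the witness bits of a satisfying assignment are accepted, hence equal to
  \<open>w\<close>, and the selector clauses then fix \<open>Y 1\<close>.\<close>

lemma (in centred_automaton) tableau_skolem:
  assumes run: "\<And>v. length v = m \<Longrightarrow> \<exists>h. \<bar>h\<bar> \<le> int T \<and> (\<forall>i. sym (arun G I z v T i) = contents (out v) (h + i)) \<and>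
          (\<forall>i. org (arun G I z v T i) \<longleftrightarrow> h + i = 0)"
    and uniq: "\<And>v. length v = m \<Longrightarrow> out v = [True] \<longleftrightarrow> v = w" and w: "length w = m"
  shows "\<exists>y. form_val (tableau z m T) x y"
    and "form_val (tableau z m T) x y \<Longrightarrow> y 1 \<longleftrightarrow> (\<exists>j<m. x (Suc j) \<and> w ! j)"
proof -
  have "out w = [True]" using uniq w by simp
  then obtain h where h: "\<And>i. sym (arun G I z w T i) = contents [True] (h + i)"
      "\<And>i. org (arun G I z w T i) \<longleftrightarrow> h + i = 0"
    using run[OF w] by auto
  obtain y where y: "accepting z m T y" "\<And>j. j < m \<Longrightarrow> y (2 + j) = w ! j"
      "y 1 = (\<exists>j<m. x (Suc j) \<and> w ! j)"
    using accepting_complete[OF w h] by blast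
  then have "form_val (tableau z m T) x y" unfolding form_val_tableau by auto
  then show "\<exists>y. form_val (tableau z m T) x y" by blast
next
  show "y 1 \<longleftrightarrow> (\<exists>j<m. x (Suc j) \<and> w ! j)" if "form_val (tableau z m T) x y"
  proof -
    have y: "y 1 \<longleftrightarrow> (\<exists>j<m. x (Suc j) \<and> y (2 + j))" "accepting z m T y"
      using that unfolding form_val_tableau by auto
    let ?v = "map (\<lambda>j. y (2 + j)) [0..<m]"
    obtain h where "\<bar>h\<bar> \<le> int T" "\<And>i. sym (arun G I z ?v T i) = contents (out ?v) (h + i)"
      "\<And>i. org (arun G I z ?v T i) \<longleftrightarrow> h + i = 0"
      using run[of ?v] by auto
    then have "out ?v = [True]" using accepting_sound[OF refl y(2)] by blast
    then have "?v = w" using uniq[of ?v] by simp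
    then have "w ! j = y (2 + j)" if "j < m" for j using that by auto
    then show ?thesis using y(1) by auto
  qed
qed

text \<open>\<open>S\<close> receives an instance, the witness length and coins. It works for every
  sufficiently long coin string, so that a caller can allot coins by one polynomial although its
  instances vary in length.\<close>

lemma unique_witness_search:
  assumes skolem: "\<And>q. \<exists>A. skolem_algorithm q A" and V: "polytime V"
  obtains S q where "fp (\<lambda>e. S (e 0) (length (e 1)) (e 2))"
    "\<And>z m n w. poly q (length z + m) \<le> n \<Longrightarrow> length w = m \<Longrightarrow>
       (\<And>v. length v = m \<Longrightarrow> V z v = [True] \<longleftrightarrow> v = w) \<Longrightarrow> 1 / 2 \<le> pr n (\<lambda>s. S z m s = w)"
proof -
  obtain M p where M: "wf_tm M" and comp: "\<And>x r. computes_within M x r (poly p (length x + length r)) (V x r)"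
    using V unfolding polytime_def by blast
  obtain N G I sym org where I: "\<And>a b z. I a b z < N" and G: "\<And>u v1 v2 v3. G u v1 v2 v3 < N"
    and run: "\<And>x r T out. computes_within M x r T out \<Longrightarrow> length out \<le> T \<and>
       (\<exists>h. \<bar>h\<bar> \<le> int T \<and> (\<forall>i. sym (arun G I x r T i) = contents out (h + i)) \<and>
          (\<forall>i. org (arun G I x r T i) \<longleftrightarrow> h + i = 0))"
    using tm_automaton[OF M] by metis
  interpret centred_automaton N G I sym org by unfold_locales (rule I G)+
  \<comment> \<open>The polynomial 1 + 2n covers the size \<open>2 * m + 1\<close> of the selector
    circuit.\<close>
  obtain A where A: "skolem_algorithm [:1, 2:] A" using skolem by blast
  then obtain f pA where f: "polytime f" and Af: "\<And>x. A x = map_pmf (f x) (coins (poly pA (length x)))"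
    unfolding rand_polytime_def by blast
  define T where "T = (\<lambda>(z :: bool list) m. poly p (length z + m))"
  define inst where "inst = (\<lambda>z m. enc_instance m (num_outputs m (T z m)) (tableau z m (T z m)) 1)"
  \<comment> \<open>Each unit vector selects one witness bit. Only as many coins as the algorithm
    asks for are taken from \<open>s\<close>.\<close>
  define S where "S = (\<lambda>z m s. map (\<lambda>j. eval_unit (Suc j) (f (inst z m) (take (poly pA (length (inst z m))) s))) [0..<m])"
  have fp_inst: "fp (\<lambda>e. inst (e 0) (length (e 1)))"
    unfolding inst_def T_def
    by (intro fp_enc_instance_tableau fpn_poly fpn_add fpn_length fp_arg)
  then obtain k pI where pI: "\<And>e. length (inst (e 0) (length (e 1))) \<le> poly pI (esize k e)"
    using fp_length[OF fp_inst] by blast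
  have fp_S: "fp (\<lambda>e. S (e 0) (length (e 1)) (e 2))"
    unfolding S_def
    by (intro fp_map_eval_unit fp_of_polytime[OF f] fp_take fpn_poly fpn_length fp_inst fp_arg)
  have len: "length (inst z m) \<le> poly pI (length z + m)" for z m
  proof -
    have "length (inst z m) \<le> poly pI (esize k (env2 z (replicate m True)))"
      using pI[of "env2 z (replicate m True)"] by (simp add: env2_def)
    also have "\<dots> \<le> poly pI (length z + m)"
      using esize_env2[of k z "replicate m True"] by (intro poly_nat_mono) simp
    finally show ?thesis .
  qed
  have "1 / 2 \<le> pr n (\<lambda>s. S z m s = w)"
    if n: "poly (pcompose pA pI) (length z + m) \<le> n" and w: "length w = m"
      and uniq: "\<And>v. length v = m \<Longrightarrow> V z v = [True] \<longleftrightarrow> v = w" for z m n w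
  proof -
    let ?F = "tableau z m (T z m)" and ?M = "num_outputs m (T z m)"
    have h: "\<exists>h. \<bar>h\<bar> \<le> int (T z m) \<and> (\<forall>i. sym (arun G I z v (T z m) i) = contents (V z v) (h + i)) \<and>
          (\<forall>i. org (arun G I z v (T z m) i) \<longleftrightarrow> h + i = 0)" if "length v = m" for v
      using run[OF comp[of z v]] that by (simp add: T_def)
    have F: "\<exists>y. form_val ?F x y" "form_val ?F x y \<Longrightarrow> y 1 \<longleftrightarrow> (\<exists>j<m. x (Suc j) \<and> w ! j)" for x y
      using tableau_skolem[where out = "V z" and m = m and T = "T z m" and z = z and w = w] h uniq w by blast+
    have sc: "skolem_circuit m ?F 1 (selector_circuit w m)"
      unfolding skolem_circuit_def using F(2) selector_circuit(2,3) by simp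
    have "length (selector_circuit w m) \<le> poly [:1, 2:] (fsize ?F)"
      using selector_circuit(1)[of w m] m_le_fsize_tableau[of m z "T z m"] by simp
    then have "\<exists>s \<le> poly [:1, 2:] (fsize ?F). uniquely_defined_by_size m ?F 1 s"
      using sc unfolding uniquely_defined_by_size_def by blast
    moreover have "1 \<le> ?M" by (simp add: num_outputs_def)
    ultimately have "1 / 2 \<le> measure_pmf.prob (A (inst z m)) {enc_circuit C | C. skolem_circuit m ?F 1 C}"
      using A vars_tableau F(1) unfolding inst_def by blast
    also have "\<dots> = pr (poly pA (length (inst z m))) (\<lambda>s. \<exists>C. f (inst z m) s = enc_circuit C \<and> skolem_circuit m ?F 1 C)"
      unfolding Af pr_def measure_map_pmf by (simp add: vimage_def)
    also have "\<dots> \<le> pr (poly pA (length (inst z m))) (\<lambda>s. map (\<lambda>j. eval_unit (Suc j) (f (inst z m) s)) [0..<m] = w)"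
    proof (rule pr_mono)
      fix s assume "\<exists>C. f (inst z m) s = enc_circuit C \<and> skolem_circuit m ?F 1 C"
      then obtain C where C: "f (inst z m) s = enc_circuit C" "skolem_circuit m ?F 1 C" by blast
      have "eval_unit (Suc j) (enc_circuit C) = w ! j" if j: "j < m" for j
      proof -
        \<comment> \<open>A Skolem circuit is tied to \<open>Y 1\<close> only on satisfying
          assignments; one exists above this unit vector because the formula is satisfiable for all
          \<open>X\<close>.\<close>
        obtain y where y: "form_val ?F (\<lambda>i. i = Suc j) y" using F(1) by blast
        have "eval_unit (Suc j) (enc_circuit C) = circuit_val C (\<lambda>i. i = Suc j) y"
          using C(2) by (intro eval_unit_enc_circuit[of m]) (simp add: skolem_circuit_def)
        also have "\<dots> = y 1" using C(2) y by (simp add: skolem_circuit_def)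
        also have "\<dots> = w ! j" using F(2)[OF y] j by auto
        finally show ?thesis .
      qed
      then show "map (\<lambda>j. eval_unit (Suc j) (f (inst z m) s)) [0..<m] = w"
        using w C(1) by (intro nth_equalityI) auto
    qed
    also have "\<dots> = pr n (\<lambda>s. S z m s = w)"
    proof -
      have "poly pA (length (inst z m)) \<le> n"
        using n poly_nat_mono[OF len[of z m], of pA] by (simp add: poly_pcompose)
      from pr_prefix[OF this, of "\<lambda>s. map (\<lambda>j. eval_unit (Suc j) (f (inst z m) s)) [0..<m] = w"]
      show ?thesis by (simp add: S_def)
    qed
    finally show ?thesis .
  qed
  then show ?thesis using that fp_S by blast
qed

section \<open>Randomized reduction\<close>

text \<open>The Skolem instance depends on the parity conditions drawn first. Each good first part
  has at least a fraction \<open>c\<close> of good continuations; summing over the first parts gives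
  the product.\<close>

lemma pr_split_dep:
  assumes "\<And>h. length h = a \<Longrightarrow> Q h \<Longrightarrow> c \<le> pr b (R h)"
  shows "pr a Q * c \<le> pr (a + b) (\<lambda>r. Q (take a r) \<and> R (take a r) (drop a r))"
proof -
  let ?H = "{h. length h = a \<and> Q h}"
  have "bij_betw (\<lambda>(u, v). u @ v) (SIGMA h : ?H. {s. length s = b \<and> R h s})
      {r. length r = a + b \<and> Q (take a r) \<and> R (take a r) (drop a r)}"
    by (rule bij_betw_byWitness[of _ "\<lambda>r. (take a r, drop a r)"]) auto
  from bij_betw_same_card[OF this, symmetric]
  have "card {r. length r = a + b \<and> Q (take a r) \<and> R (take a r) (drop a r)} =
      (\<Sum>h\<in>?H. card {s. length s = b \<and> R h s})"
    by (rule trans[OF _ card_SigmaI]) (auto intro: finite_bool_lists)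
  then have "real (card {r. length r = a + b \<and> Q (take a r) \<and> R (take a r) (drop a r)}) =
      (\<Sum>h\<in>?H. real (card {s. length s = b \<and> R h s}))" by simp
  also have "\<dots> \<ge> (\<Sum>h\<in>?H. c * 2 ^ b)"
    using assms by (intro sum_mono) (simp add: pr_card field_simps)
  finally show ?thesis unfolding pr_card by (simp add: power_add field_simps)
qed

lemma pr_repeat:
  "pr (N * D) (\<lambda>r. \<exists>i<N. Q (take D (drop (i * D) r))) = 1 - (1 - pr D Q) ^ N"
proof -
  have "pr (N * D) (\<lambda>r. \<forall>i<N. \<not> Q (take D (drop (i * D) r))) = pr D (\<lambda>r. \<not> Q (take D r)) ^ N"
    by (rule pr_blocks) simp
  moreover have "pr D (\<lambda>r. \<not> Q (take D r)) = 1 - pr D Q"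
    unfolding pr_not[symmetric] by (rule pr_cong) simp
  moreover have "pr (N * D) (\<lambda>r. \<exists>i<N. Q (take D (drop (i * D) r))) =
      1 - pr (N * D) (\<lambda>r. \<forall>i<N. \<not> Q (take D (drop (i * D) r)))"
    unfolding pr_not[symmetric] by simp
  ultimately show ?thesis by simp
qed

lemma pmf_coins: "pmf (map_pmf g (coins n)) y = pr n (\<lambda>r. g r = y)"
  by (simp add: pmf.rep_eq pr_def vimage_def)

text \<open>The coin tosses become the certificate: the acceptance probability is nonzero iff some
  coin sequence is accepted.\<close>

lemma RP_subset_NP: "RP \<subseteq> NP"
proof
  fix L assume "L \<in> RP"
  then obtain A where A: "rand_polytime A" and L: "\<And>x. x \<in> L \<Longrightarrow> pmf (A x) [True] \<ge> 1 / 2"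
      "\<And>x. x \<notin> L \<Longrightarrow> pmf (A x) [True] = 0"
    unfolding RP_def by blast
  obtain f p where f: "polytime f" "\<And>x. A x = map_pmf (f x) (coins (poly p (length x)))"
    using A unfolding rand_polytime_def by blast
  have "x \<in> L \<longleftrightarrow> (\<exists>w. length w = poly p (length x) \<and> f x w = [True])" for x
  proof -
    let ?S = "{w. length w = poly p (length x) \<and> f x w = [True]}"
    have "pmf (A x) [True] = real (card ?S) / 2 ^ poly p (length x)"
      by (simp add: f(2) pmf_coins pr_card)
    then have "pmf (A x) [True] = 0 \<longleftrightarrow> ?S = {}" using finite_bool_lists by simp
    moreover have "x \<in> L \<longleftrightarrow> pmf (A x) [True] \<noteq> 0" using L[of x] by auto
    ultimately show ?thesis by auto
  qed
  then show "L \<in> NP" using f(1) unfolding NP_def by blast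
qed

lemma NP_subset_RP:
  assumes skolem: "\<And>q. \<exists>A. skolem_algorithm q A"
  shows "NP \<subseteq> RP"
proof
  fix L assume "L \<in> NP"
  then obtain V pw where V: "polytime V"
    and L: "\<And>x. x \<in> L \<longleftrightarrow> (\<exists>w. length w = poly pw (length x) \<and> V x w = [True])"
    unfolding NP_def by blast
  \<comment> \<open>A verifier has one input besides the witness, so \<open>x\<close>,
    \<open>K\<close> and the conditions \<open>h\<close> are packed into a string that can be taken
    apart again.\<close>
  define pair where "pair = (\<lambda>x K h. enc_nat (length x) @ x @ enc_nat K @ h)"
  define V' where "V' = (\<lambda>z w. [V (take (ones z) (after_ones z)) w = [True] \<and>
    hash_ok (length w) (ones (drop (ones z) (after_ones z))) (after_ones (drop (ones z) (after_ones z))) w])"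
  have V'_pair: "V' (pair x K h) w = [V x w = [True] \<and> hash_ok (length w) K h w]" for x K h w
    by (simp add: V'_def pair_def)
  have "fp (\<lambda>e. V' (e 0) (e 1))"
    unfolding V'_def
    by (intro fpb_conj fpb_eq_single_True fp_of_polytime[OF V] fpb_hash_ok fp_take fp_drop fpn_ones
      fp_after_ones fpn_length fp_arg)
  from fp_polytime[OF this] have V': "polytime V'" by (simp add: env2_def)
  obtain S q where fp_S: "fp (\<lambda>e. S (e 0) (length (e 1)) (e 2))"
    and S: "\<And>z m n w. poly q (length z + m) \<le> n \<Longrightarrow> length w = m \<Longrightarrow>
       (\<And>v. length v = m \<Longrightarrow> V' z v = [True] \<longleftrightarrow> v = w) \<Longrightarrow> 1 / 2 \<le> pr n (\<lambda>s. S z m s = w)"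
    using unique_witness_search[OF skolem V'] by blast
  \<comment> \<open>Enough coins for \<open>K \<le> m + 2\<close> conditions of \<open>m + 1\<close>
    bits each, \<open>m\<close> being the witness length. The argument of \<open>q\<close> in
    \<open>pR\<close> bounds the length of \<open>pair x K h\<close>, at most 2|x| + 2 + K + |h|,
    plus \<open>m\<close>.\<close>
  define pH where "pH = (pw + [:2:]) * (pw + [:1:])"
  define pR where "pR = pcompose q ([:2, 2:] + pw + [:2:] + pH + pw)"
  define pD where "pD = pH + pR"
  define attempt where "attempt = (\<lambda>x K h s. V x (S (pair x K h) (poly pw (length x)) s) = [True])"
  \<comment> \<open>The right \<open>K\<close> is unknown, so all are tried on the same coins and
    the analysis follows the right one. The length test belongs to certificate checking:
    \<open>L\<close> admits only certificates of this exact length, and \<open>S\<close> is known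
    only through its success probability.\<close>
  define round where "round = (\<lambda>x r. \<exists>K < poly pw (length x) + 3.
    attempt x K (take (K * (poly pw (length x) + 1)) r) (drop (poly pH (length x)) r) \<and>
    length (S (pair x K (take (K * (poly pw (length x) + 1)) r)) (poly pw (length x)) (drop (poly pH (length x)) r)) =
      poly pw (length x))"
  define f where "f = (\<lambda>x r. [\<exists>i<12. round x (take (poly pD (length x)) (drop (i * poly pD (length x)) r))])"
  have S_comp: "fp (\<lambda>e. S (a e) (b e) (c e))" if "fp a" "fpn b" "fp c" for a b c
  proof -
    define D where "D = (\<lambda>i::nat. if i = 0 then a else if i = 1 then (\<lambda>e. replicate (b e) True) else c)"
    have "fp (D i)" for i using that by (simp add: D_def)
    from fp_comp[OF fp_S, of D, OF this] show ?thesis by (simp add: D_def)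
  qed
  have "fp (\<lambda>e. f (e 0) (e 1))"
    unfolding f_def round_def attempt_def pair_def
    by (intro fpb_ex_upto_const fpb_ex_less fpb_conj fpb_eq_single_True fp_of_polytime[OF V] S_comp fpb_eq fpn_length
       fp_append fp_enc_nat fp_take fp_drop fpn_poly fpn_mult fpn_add fp_arg fp_const)
  from fp_polytime[OF this] have f: "polytime f" by (simp add: env2_def)
  define A where "A = (\<lambda>x. map_pmf (f x) (coins (poly (smult 12 pD) (length x))))"
  have "rand_polytime A" unfolding rand_polytime_def A_def using f by blast
  moreover have "pmf (A x) [True] = 0" if "x \<notin> L" for x
  proof -
    have "\<not> round x r" for r using that unfolding round_def attempt_def L by blast
    then show ?thesis by (simp add: A_def pmf_coins f_def pr_def)
  qed
  moreover have "1 / 2 \<le> pmf (A x) [True]" if "x \<in> L" for x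
  proof -
    let ?m = "poly pw (length x)" and ?H = "poly pH (length x)" and ?R = "poly pR (length x)"
    define W where "W = {w. length w = ?m \<and> V x w = [True]}"
    have W: "W \<subseteq> {w. length w = ?m}" "W \<noteq> {}" using that by (auto simp: W_def L)
    obtain K where K: "K \<le> ?m + 2" "2 ^ K \<le> 4 * card W" "2 * card W \<le> 2 ^ K"
      using isolation_level[OF W] by blast
    let ?n = "K * (?m + 1)"
    have nH: "?n \<le> ?H" using mult_le_mono1[OF K(1), of "?m + 1"] by (simp add: pH_def algebra_simps)
    let ?Q = "\<lambda>h. \<exists>!w. w \<in> W \<and> hash_ok ?m K h w"
    let ?R' = "\<lambda>h s. attempt x K (take ?n h) s \<and> length (S (pair x K (take ?n h)) ?m s) = ?m"
    have "1 / 2 \<le> pr ?R (?R' h)" if h: "length h = ?H" "?Q (take ?n h)" for h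
    proof -
      let ?z = "pair x K (take ?n h)"
      obtain w where w: "w \<in> W" "hash_ok ?m K (take ?n h) w"
        and u: "\<And>v. v \<in> W \<Longrightarrow> hash_ok ?m K (take ?n h) v \<Longrightarrow> v = w" using h(2) by blast
      have "1 / 2 \<le> pr ?R (\<lambda>s. S ?z ?m s = w)"
      proof (rule S)
        show "length w = ?m" using w by (simp add: W_def)
        show "V' ?z v = [True] \<longleftrightarrow> v = w" if "length v = ?m" for v
          using that w u[of v] by (auto simp: V'_pair W_def)
        have "length ?z \<le> 2 * length x + 2 + K + ?n" by (simp add: pair_def enc_nat_def)
        also have "\<dots> \<le> 2 * length x + 2 + (?m + 2) + ?H" using K(1) nH by simp
        finally show "poly q (length ?z + ?m) \<le> ?R"
          unfolding pR_def poly_pcompose by (intro poly_nat_mono) simp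
      qed
      also have "\<dots> \<le> pr ?R (?R' h)"
        by (rule pr_mono) (use w in \<open>auto simp: attempt_def W_def\<close>)
      finally show ?thesis .
    qed
    then have "pr ?H (\<lambda>h. ?Q (take ?n h)) * (1 / 2) \<le>
        pr (?H + ?R) (\<lambda>r. ?Q (take ?n (take ?H r)) \<and> ?R' (take ?H r) (drop ?H r))"
      by (rule pr_split_dep)
    also have "\<dots> \<le> pr (?H + ?R) (round x)"
    proof (rule pr_mono)
      fix r assume "?Q (take ?n (take ?H r)) \<and> ?R' (take ?H r) (drop ?H r)"
      then have "attempt x K (take ?n r) (drop ?H r) \<and> length (S (pair x K (take ?n r)) ?m (drop ?H r)) = ?m"
        using nH by (simp add: min_absorb1)
      then show "round x r" unfolding round_def using K(1) by (intro exI[of _ K]) simp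
    qed
    finally have "pr ?H (\<lambda>h. ?Q (take ?n h)) * (1 / 2) \<le> pr (?H + ?R) (round x)" .
    moreover have "pr ?H (\<lambda>h. ?Q (take ?n h)) = pr ?n ?Q" by (rule pr_prefix[OF nH])
    ultimately have "pr ?n ?Q * (1 / 2) \<le> pr (?H + ?R) (round x)" by (simp only:)
    moreover have "1 / 8 \<le> pr ?n ?Q" by (rule pr_isolate[OF W(1) K(2,3)])
    moreover have "?H + ?R = poly pD (length x)" by (simp add: pD_def)
    ultimately have 1: "1 / 16 \<le> pr (poly pD (length x)) (round x)" by simp
    have "(1 - pr (poly pD (length x)) (round x)) ^ 12 \<le> (15 / 16) ^ 12"
      by (intro power_mono) (use 1 pr_le_1 in auto)
    also have "\<dots> \<le> (1 / 2 :: real)" by (simp add: power_divide)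
    finally show ?thesis
      using pr_repeat[of 12 "poly pD (length x)" "round x"] by (simp add: A_def pmf_coins f_def)
  qed
  ultimately show "L \<in> RP" unfolding RP_def by blast
qed

theorem theorem6:
  assumes "\<And>q :: nat poly. \<exists>A. rand_polytime A \<and>
    (\<forall>n m F i.
       1 \<le> i \<and> i \<le> m \<and> vars F \<subseteq> all_vars n m \<and>
       (\<forall>x. \<exists>y. form_val F x y) \<and>
       (\<exists>s \<le> poly q (fsize F). uniquely_defined_by_size n F i s) \<longrightarrow>
       measure_pmf.prob (A (enc_instance n m F i)) {enc_circuit C | C. skolem_circuit n F i C}
         \<ge> 1 / 2)"
  shows "NP = RP"
  using NP_subset_RP[OF assms] RP_subset_NP by blast

end
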